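(* Let $n\ge1$, $\hbar>0$ and $p\in\mathbb{C}^n$. The locally convex topology of $\mathcal{A}_{p,\hbar}$ is complete, i.e. $\mathcal{A}_{p,\hbar}$ is a Fréchet space.
   Context: Conventions: $\mathbb{N}=\{0,1,2,\dots\}$; $z=(z^1,\dots,z^n)$ are the standard holomorphic coordinates on $\mathbb{C}^n$; multiindex notation is the usual componentwise one; $\sum_{N=0}^\infty$ means summation over $N\in\mathbb{N}^n$ and $\sum_{I=0}^R$ summation over $I\in\mathbb{N}^n$ with $I\le R$. For $f\in C^\infty(\mathbb{C}^n)$ (complex-valued smooth functions), $m\in\mathbb{N}$, $\ell\in\{0,\dots,2^m-1\}$, $R,S\in\mathbb{N}^n$ define recursively, with values in $[0,+\infty]$, $$h^{p,\hbar}_{0,0,R,S}(f)=\sum_{N=0}^\infty\frac{(2\hbar)^{|R|+|S|+|N|}}{N!}\left|\frac{\partial^{|R|+|S|+|N|}f}{\partial z^R\partial\overline{z}^{N+S}}(p)\right|^2,$$ and for $m\ge1$ $$h^{p,\hbar}_{m,\ell,R,S}(f)=\sum_{N=0}^\infty\frac1{N!}\Big(\sum_{I=0}^R\sum_{J=0}^{N+S}\tbinom{R}{I}\tbinom{N+S}{J}h^{p,\hbar}_{m-1,\ell/2,I,J}(f)\Big)^2\quad(\ell\text{ even}),$$ $$h^{p,\hbar}_{m,\ell,R,S}(f)=\sum_{N=0}^\infty\frac1{N!}\Big(\sum_{I=0}^R\sum_{J=0}^{N+S}\tbinom{R}{I}\tbinom{N+S}{J}h^{p,\hbar}_{m-1,(\ell-1)/2,J,I}(f)\Big)^2\quad(\ell\text{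 odd}).$$ Put $\|f\|^{p,\hbar}_{m,\ell,R,S}=\big(h^{p,\hbar}_{m,\ell,R,S}(f)\big)^{1/2^{m+1}}$ and $\widetilde{\mathcal{A}}_{p,\hbar}=\{f\in C^\infty(\mathbb{C}^n)\mid \|f\|^{p,\hbar}_{m,\ell,R,S}<\infty\text{ for all }m,\ell,R,S\}$, a vector space on which these are seminorms. Define $\mathcal{A}_{p,\hbar}=\widetilde{\mathcal{A}}_{p,\hbar}/\{f\in C^\infty(\mathbb{C}^n)\mid \mathsf{j}^\infty_pf=0\}$ (quotient by the functions with vanishing $\infty$-jet at $p$), with the Hausdorff locally convex topology induced by all the seminorms $\|\cdot\|^{p,\hbar}_{m,\ell,R,S}$. Every class has a unique real-analytic representative, so $\mathcal{A}_{p,\hbar}$ is identified with a subspace of $C^\omega(\mathbb{C}^n)$. *)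

theory Defs
  imports
    "HOL-Analysis.Analysis"
    "HOL-Algebra.Module"
    "HOL-Algebra.Algebraic_Closure_Type"
    "HOL-Library.Set_Algebras"
    "HOL-Library.Function_Algebras"
begin

section \<open>Frechet spaces over the complex numbers\<close>

text \<open>
  The spaces below depend on term parameters, so a complex vector space is a module record with
  an explicit carrier over the field of complex numbers, together with an abstract topology.
\<close>

definition convex_in :: "(complex, 'v, 'm) module_scheme \<Rightarrow> 'v set \<Rightarrow> bool" where
  "convex_in V C \<longleftrightarrow>
     (\<forall>x\<in>C. \<forall>y\<in>C. \<forall>t\<in>{0..1::real}.
        (complex_of_real t \<odot>\<^bsub>V\<^esub> x) \<oplus>\<^bsub>V\<^esub> (complex_of_real (1 - t) \<odot>\<^bsub>V\<^esub> y) \<in> C)"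

definition topological_vector_space ::
  "(complex, 'v, 'm) module_scheme \<Rightarrow> 'v topology \<Rightarrow> bool" where
  "topological_vector_space V T \<longleftrightarrow>
     module (ring_of_type_algebra :: complex ring) V \<and>
     topspace T = carrier V \<and>
     continuous_map (prod_topology T T) T (\<lambda>(x, y). x \<oplus>\<^bsub>V\<^esub> y) \<and>
     continuous_map (prod_topology euclidean T) T (\<lambda>(c, x). c \<odot>\<^bsub>V\<^esub> x)"

definition locally_convex_space ::
  "(complex, 'v, 'm) module_scheme \<Rightarrow> 'v topology \<Rightarrow> bool" where
  "locally_convex_space V T \<longleftrightarrow>
     topological_vector_space V T \<and>
     (\<forall>U. openin T U \<and> \<zero>\<^bsub>V\<^esub> \<in> U \<longrightarrow>
        (\<exists>C. openin T C \<and> \<zero>\<^bsub>V\<^esub> \<in> C \<and> C \<subseteq> U \<and> convex_in V C))"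

definition tvs_cauchy_filter ::
  "(complex, 'v, 'm) module_scheme \<Rightarrow> 'v topology \<Rightarrow> 'v filter \<Rightarrow> bool" where
  "tvs_cauchy_filter V T F \<longleftrightarrow>
     eventually (\<lambda>x. x \<in> carrier V) F \<and>
     (\<forall>U. openin T U \<and> \<zero>\<^bsub>V\<^esub> \<in> U \<longrightarrow>
        eventually (\<lambda>(x, y). x \<ominus>\<^bsub>V\<^esub> y \<in> U) (F \<times>\<^sub>F F))"

definition complete_tvs ::
  "(complex, 'v, 'm) module_scheme \<Rightarrow> 'v topology \<Rightarrow> bool" where
  "complete_tvs V T \<longleftrightarrow>
     (\<forall>F. F \<noteq> bot \<and> tvs_cauchy_filter V T F \<longrightarrow> (\<exists>l. limitin T (\<lambda>x. x) l F))"

definition frechet_space ::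
  "(complex, 'v, 'm) module_scheme \<Rightarrow> 'v topology \<Rightarrow> bool" where
  "frechet_space V T \<longleftrightarrow>
     locally_convex_space V T \<and> Hausdorff_space T \<and> metrizable_space T \<and> complete_tvs V T"

text \<open>
  The locally convex topology induced by a family of seminorms; the open balls of the individual
  seminorms, with arbitrary centres, form a subbasis.
\<close>

definition seminorm_topology ::
  "(complex, 'v, 'm) module_scheme \<Rightarrow> ('v \<Rightarrow> real) set \<Rightarrow> 'v topology" where
  "seminorm_topology V Q =
     topology_generated_by
       {{y \<in> carrier V. q (y \<ominus>\<^bsub>V\<^esub> x) < e} |q x e. q \<in> Q \<and> x \<in> carrier V \<and> 0 < e}"


section \<open>Smooth functions, jets and Wirtinger derivatives\<close>

text \<open>Smoothness is meant in the real sense: derivatives are Frechet derivatives over the reals.\<close>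

definition dir_deriv ::
  "'a::real_normed_vector \<Rightarrow> ('a \<Rightarrow> 'b::real_normed_vector) \<Rightarrow> 'a \<Rightarrow> 'b" where
  "dir_deriv v f = (\<lambda>x. frechet_derivative f (at x) v)"

primrec C_k :: "nat \<Rightarrow> ('a::real_normed_vector \<Rightarrow> 'b::real_normed_vector) \<Rightarrow> bool" where
  "C_k 0 f \<longleftrightarrow> continuous_on UNIV f"
| "C_k (Suc k) f \<longleftrightarrow> (\<forall>x. f differentiable (at x)) \<and> (\<forall>v. C_k k (dir_deriv v f))"

definition C_infinity :: "('a::real_normed_vector \<Rightarrow> 'b::real_normed_vector) set" where
  "C_infinity = {f. \<forall>k. C_k k f}"

definition jet_vanishes ::
  "'a::real_normed_vector \<Rightarrow> ('a \<Rightarrow> 'b::real_normed_vector) \<Rightarrow> bool" where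
  "jet_vanishes p f \<longleftrightarrow> (\<forall>vs. fold dir_deriv vs f p = 0)"

definition flat_functions :: "complex^'n \<Rightarrow> (complex^'n \<Rightarrow> complex) set" where
  "flat_functions p = {f \<in> C_infinity. jet_vanishes p f}"

definition d_z :: "'n \<Rightarrow> (complex^'n \<Rightarrow> complex) \<Rightarrow> complex^'n \<Rightarrow> complex" where
  "d_z i f = (\<lambda>x. (dir_deriv (axis i 1) f x - \<i> * dir_deriv (axis i \<i>) f x) / 2)"

definition d_zbar :: "'n \<Rightarrow> (complex^'n \<Rightarrow> complex) \<Rightarrow> complex^'n \<Rightarrow> complex" where
  "d_zbar i f = (\<lambda>x. (dir_deriv (axis i 1) f x + \<i> * dir_deriv (axis i \<i>) f x) / 2)"

text \<open>
  Iterated derivatives are taken along an arbitrary enumeration of the coordinates; on smooth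
  functions the partial derivatives commute, so the choice of enumeration is irrelevant.
\<close>

definition coords :: "'n::finite list" where
  "coords = (SOME is. distinct is \<and> set is = UNIV)"

definition multi_deriv :: "('n::finite \<Rightarrow> 'f \<Rightarrow> 'f) \<Rightarrow> nat^'n \<Rightarrow> 'f \<Rightarrow> 'f" where
  "multi_deriv D R f = fold (\<lambda>i. D i ^^ (R $ i)) coords f"

definition wirtinger ::
  "nat^'n \<Rightarrow> nat^'n \<Rightarrow> (complex^'n \<Rightarrow> complex) \<Rightarrow> complex^'n \<Rightarrow> complex" where
  "wirtinger R S f = multi_deriv d_z R (multi_deriv d_zbar S f)"


section \<open>The seminorms and the quotient space\<close>

definition mi_size :: "nat^'n \<Rightarrow> nat" where
  "mi_size N = (\<Sum>i\<in>UNIV. N $ i)"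

definition mi_fact :: "nat^'n \<Rightarrow> nat" where
  "mi_fact N = (\<Prod>i\<in>UNIV. fact (N $ i))"

definition mi_binom :: "nat^'n \<Rightarrow> nat^'n \<Rightarrow> nat" where
  "mi_binom R I = (\<Prod>i\<in>UNIV. (R $ i) choose (I $ i))"

text \<open>Sums over all multiindices are unconditional sums in \<open>[0, \<infinity>]\<close>.\<close>

primrec h_val ::
  "complex^'n \<Rightarrow> real \<Rightarrow> (complex^'n \<Rightarrow> complex) \<Rightarrow> nat \<Rightarrow> nat \<Rightarrow> nat^'n \<Rightarrow> nat^'n \<Rightarrow> ennreal" where
  "h_val p hbar f 0 = (\<lambda>l R S.
     \<Sum>\<^sub>\<infinity>N\<in>UNIV. ennreal ((2 * hbar) ^ (mi_size R + mi_size S + mi_size N) / real (mi_fact N)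
                     * (cmod (wirtinger R (N + S) f p))\<^sup>2))"
| "h_val p hbar f (Suc m) = (\<lambda>l R S.
     if even l then
       \<Sum>\<^sub>\<infinity>N\<in>UNIV. ennreal (1 / real (mi_fact N)) *
         (\<Sum>I\<in>{I. I \<le> R}. \<Sum>J\<in>{J. J \<le> N + S}.
            of_nat (mi_binom R I) * of_nat (mi_binom (N + S) J)
            * h_val p hbar f m (l div 2) I J)\<^sup>2
     else
       \<Sum>\<^sub>\<infinity>N\<in>UNIV. ennreal (1 / real (mi_fact N)) *
         (\<Sum>I\<in>{I. I \<le> R}. \<Sum>J\<in>{J. J \<le> N + S}.
            of_nat (mi_binom R I) * of_nat (mi_binom (N + S) J)
            * h_val p hbar f m ((l - 1) div 2) J I)\<^sup>2)"

definition ennroot :: "nat \<Rightarrow> ennreal \<Rightarrow> ennreal" where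
  "ennroot k x = (if x = \<infinity> then \<infinity> else ennreal (root k (enn2real x)))"

definition h_norm ::
  "complex^'n \<Rightarrow> real \<Rightarrow> nat \<Rightarrow> nat \<Rightarrow> nat^'n \<Rightarrow> nat^'n \<Rightarrow> (complex^'n \<Rightarrow> complex) \<Rightarrow> ennreal" where
  "h_norm p hbar m l R S f = ennroot (2 ^ (m + 1)) (h_val p hbar f m l R S)"

definition A_tilde :: "complex^'n \<Rightarrow> real \<Rightarrow> (complex^'n \<Rightarrow> complex) set" where
  "A_tilde p hbar = {f \<in> C_infinity. \<forall>m. \<forall>l<2 ^ m. \<forall>R S. h_norm p hbar m l R S f < \<infinity>}"

text \<open>
  The quotient by the flat functions: elements are cosets, addition is addition of cosets
  (pointwise addition of sets). Adding \<open>flat_functions p\<close> in the scalar multiplication only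
  matters for the scalar \<open>0\<close>. The multiplicative part of the record is not used by modules.
\<close>

definition A_space ::
  "complex^'n \<Rightarrow> real \<Rightarrow> (complex, (complex^'n \<Rightarrow> complex) set) module" where
  "A_space p hbar =
     \<lparr>carrier = (\<lambda>f. f +o flat_functions p) ` A_tilde p hbar,
      monoid.mult = undefined,
      one = undefined,
      zero = flat_functions p,
      add = (\<lambda>A B. A + B),
      smult = (\<lambda>c A. (\<lambda>f x. c * f x) ` A + flat_functions p)\<rparr>"

text \<open>The quotient seminorm; the seminorms depend only on the \<open>\<infinity>\<close>-jet, so that
  they are constant on cosets.\<close>

definition A_seminorm ::
  "complex^'n \<Rightarrow> real \<Rightarrow> nat \<Rightarrow> nat \<Rightarrow> nat^'n \<Rightarrow> nat^'n \<Rightarrow> (complex^'n \<Rightarrow> complex) set \<Rightarrow> real" where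
  "A_seminorm p hbar m l R S A = enn2real (INF f\<in>A. h_norm p hbar m l R S f)"

definition A_topology :: "complex^'n \<Rightarrow> real \<Rightarrow> (complex^'n \<Rightarrow> complex) set topology" where
  "A_topology p hbar =
     seminorm_topology (A_space p hbar) {A_seminorm p hbar m l R S |m l R S. l < 2 ^ m}"

end

theory Submission
  imports Defs
begin

text \<open>
  The value \<open>h_val\<close> depends only on the array of Wirtinger derivatives at \<open>p\<close>. As a function of
  that array it is convex and homogeneous of degree \<open>2 ^ (m + 1)\<close>, so its root is a seminorm, and
  by Fatou's lemma it is lower semicontinuous for entrywise convergence. The seminorms with
  \<open>m = 0\<close> dominate each entry, so a Cauchy sequence converges entrywise, and by lower
  semicontinuity the limit array has finite values and is the limit in every seminorm.
  Finiteness for \<open>m = l = 1\<close> bounds the entry at \<open>(R, S)\<close> by a multiple of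
  \<open>q ^ (|R| + |S|) * sqrt (R! * S!)\<close>; hence the Taylor series in \<open>z\<close> and its conjugate with these
  coefficients converges everywhere and realizes the limit array by a smooth function. Countably
  many seminorms that separate points give a metrizable topology, for which sequential
  completeness suffices.
\<close>

section \<open>Countable families of seminorms\<close>

text \<open>A Cauchy sequence yields only a limit array of numbers, whereas a point of the space is
  a class of smooth functions. The values with m = 0 control growth in the antiholomorphic index
  alone: |a R S|^2 \<le> C_R * S! / (2 hbar)^(|R| + |S|), where C_R is the value at (R, 0) and
  nothing relates different R. One more level with odd l swaps the two indices, so the value at m =
  l = 1, R = S = 0 dominates the sum of C_R^2 / R!. Growth in R is then of the same kind, and sqrt
  (R! * S!) is harmless against the denominators R! * S! of the Taylor series. The nested weighted
  sums are not a standard norm; convexity and homogeneity, however, pass through every level of the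
  recursion. Entrywise limits need not commute with the infinite sums, but an upper bound for the
  limit is all that is needed when one index of the Cauchy condition tends to infinity, and Fatou's
  inequality provides it.\<close>

locale seminormed_module = module "ring_of_type_algebra :: complex ring" V
  for V :: "(complex, 'v, 'm) module_scheme" (structure) +
  fixes Q :: "('v \<Rightarrow> real) set"
  assumes seminorms_nonempty: "Q \<noteq> {}"
    and seminorms_countable: "countable Q"
    and seminorm_add: "\<lbrakk>q \<in> Q; x \<in> carrier V; y \<in> carrier V\<rbrakk> \<Longrightarrow> q (x \<oplus>\<^bsub>V\<^esub> y) \<le> q x + q y"
    and seminorm_smult: "\<lbrakk>q \<in> Q; x \<in> carrier V\<rbrakk> \<Longrightarrow> q (c \<odot>\<^bsub>V\<^esub> x) = cmod c * q x"
    and seminorms_separate: "\<lbrakk>x \<in> carrier V; \<And>q. q \<in> Q \<Longrightarrow> q x = 0\<rbrakk> \<Longrightarrow> x = \<zero>\<^bsub>V\<^esub>"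
begin

abbreviation T :: "'v topology" where "T \<equiv> seminorm_topology V Q"

lemma scalar_simps [simp]:
  "carrier (ring_of_type_algebra :: complex ring) = UNIV"
  "add (ring_of_type_algebra :: complex ring) = (+)"
  "monoid.mult (ring_of_type_algebra :: complex ring) = (*)"
  "one (ring_of_type_algebra :: complex ring) = 1"
  "zero (ring_of_type_algebra :: complex ring) = 0"
  by (auto simp: ring_of_type_algebra_def)

lemma smult_closed' [simp, intro]: "x \<in> carrier V \<Longrightarrow> c \<odot>\<^bsub>V\<^esub> x \<in> carrier V"
  using smult_closed[of c x] by simp

lemma uminus_eq_smult: "x \<in> carrier V \<Longrightarrow> \<ominus>\<^bsub>V\<^esub> x = (-1) \<odot>\<^bsub>V\<^esub> x"
proof -
  assume x: "x \<in> carrier V"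
  have "x \<oplus>\<^bsub>V\<^esub> ((-1) \<odot>\<^bsub>V\<^esub> x) = (1 + (-1)) \<odot>\<^bsub>V\<^esub> x"
    using smult_l_distr[of 1 "-1" x] smult_one[of x] x by simp
  also have "\<dots> = \<zero>\<^bsub>V\<^esub>" using smult_l_null[of x] x by simp
  finally show ?thesis using x
    by (metis M.add.inv_equality M.add.m_comm smult_closed')
qed

lemma seminorm_zero: "q \<in> Q \<Longrightarrow> q \<zero>\<^bsub>V\<^esub> = 0"
  using seminorm_smult[of q "\<zero>\<^bsub>V\<^esub>" 0] smult_l_null[of "\<zero>\<^bsub>V\<^esub>"] by simp

lemma seminorm_uminus: "q \<in> Q \<Longrightarrow> x \<in> carrier V \<Longrightarrow> q (\<ominus>\<^bsub>V\<^esub> x) = q x"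
  by (simp add: uminus_eq_smult seminorm_smult)

text \<open>Sign is not among the locale assumptions; it follows from 0 = q (x - x) \<le> q x + q (-
  x) = 2 * q x.\<close>

lemma seminorm_nonneg: "q \<in> Q \<Longrightarrow> x \<in> carrier V \<Longrightarrow> 0 \<le> q x"
  using seminorm_add[of q x "\<ominus>\<^bsub>V\<^esub> x"] by (simp add: seminorm_uminus seminorm_zero M.r_neg)

lemma diff_add_diff:
  assumes "x \<in> carrier V" "y \<in> carrier V" "z \<in> carrier V"
  shows "(x \<ominus>\<^bsub>V\<^esub> y) \<oplus>\<^bsub>V\<^esub> (y \<ominus>\<^bsub>V\<^esub> z) = x \<ominus>\<^bsub>V\<^esub> z"
  using assms by (simp add: M.minus_eq M.a_assoc M.r_neg1)

lemma seminorm_triangle: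
  assumes "q \<in> Q" "x \<in> carrier V" "y \<in> carrier V" "z \<in> carrier V"
  shows "q (x \<ominus>\<^bsub>V\<^esub> z) \<le> q (x \<ominus>\<^bsub>V\<^esub> y) + q (y \<ominus>\<^bsub>V\<^esub> z)"
  using seminorm_add[of q "x \<ominus>\<^bsub>V\<^esub> y" "y \<ominus>\<^bsub>V\<^esub> z"] assms by (simp add: diff_add_diff)

lemma seminorm_diff_commute:
  assumes "q \<in> Q" "x \<in> carrier V" "y \<in> carrier V"
  shows "q (x \<ominus>\<^bsub>V\<^esub> y) = q (y \<ominus>\<^bsub>V\<^esub> x)"
proof -
  have "\<ominus>\<^bsub>V\<^esub> (x \<ominus>\<^bsub>V\<^esub> y) = y \<ominus>\<^bsub>V\<^esub> x"
    using assms by (simp add: M.minus_eq M.minus_add M.a_comm)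
  then show ?thesis using seminorm_uminus[of q "x \<ominus>\<^bsub>V\<^esub> y"] assms by simp
qed

lemma diff_self: "x \<in> carrier V \<Longrightarrow> x \<ominus>\<^bsub>V\<^esub> x = \<zero>\<^bsub>V\<^esub>"
  by (simp add: M.minus_eq M.r_neg)

lemma diff_zero: "x \<in> carrier V \<Longrightarrow> x \<ominus>\<^bsub>V\<^esub> \<zero>\<^bsub>V\<^esub> = x"
  by (simp add: M.minus_eq)

lemma diff_zero_imp_eq:
  assumes "x \<ominus>\<^bsub>V\<^esub> y = \<zero>\<^bsub>V\<^esub>" "x \<in> carrier V" "y \<in> carrier V"
  shows "x = y"
proof -
  have "x = (x \<ominus>\<^bsub>V\<^esub> y) \<oplus>\<^bsub>V\<^esub> y" using assms(2,3) by (simp add: M.minus_eq M.a_assoc M.l_neg)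
  then show ?thesis using assms by simp
qed

section \<open>Basic neighbourhoods and open sets\<close>

definition nball :: "'v \<Rightarrow> ('v \<Rightarrow> real) set \<Rightarrow> real \<Rightarrow> 'v set" where
  "nball x F e = {y \<in> carrier V. \<forall>q\<in>F. q (y \<ominus>\<^bsub>V\<^esub> x) < e}"

lemma centre_in_nball: "F \<subseteq> Q \<Longrightarrow> x \<in> carrier V \<Longrightarrow> 0 < e \<Longrightarrow> x \<in> nball x F e"
  by (auto simp: nball_def diff_self seminorm_zero)

lemma topspace_T: "topspace T = carrier V"
proof -
  obtain q where q: "q \<in> Q" using seminorms_nonempty by blast
  have "x \<in> topspace T" if x: "x \<in> carrier V" for x
  proof -
    have "x \<in> {y \<in> carrier V. q (y \<ominus>\<^bsub>V\<^esub> x) < 1}"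
      using x q by (simp add: diff_self seminorm_zero)
    then show ?thesis using q x unfolding seminorm_topology_def topology_generated_by_topspace
      by (intro UnionI[of "{y \<in> carrier V. q (y \<ominus>\<^bsub>V\<^esub> x) < 1}"] CollectI exI[of _ q] exI[of _ x]
          exI[of _ "1::real"]) auto
  qed
  moreover have "topspace T \<subseteq> carrier V"
    unfolding seminorm_topology_def topology_generated_by_topspace by auto
  ultimately show ?thesis by blast
qed

lemma openin_nball:
  assumes "finite F" "F \<subseteq> Q" "x \<in> carrier V" "0 < e"
  shows "openin T (nball x F e)"
  using assms(1,2)
proof (induction F)
  case empty
  then show ?case using openin_topspace[of T] by (simp add: nball_def topspace_T)
next
  case (insert q F)
  have "openin T {y \<in> carrier V. q (y \<ominus>\<^bsub>V\<^esub> x) < e}"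
    unfolding seminorm_topology_def
    by (rule topology_generated_by_Basis) (use insert assms in auto)
  moreover have "nball x (insert q F) e = {y \<in> carrier V. q (y \<ominus>\<^bsub>V\<^esub> x) < e} \<inter> nball x F e"
    by (auto simp: nball_def)
  ultimately show ?case using insert by auto
qed

text \<open>Subbasic balls may be centred anywhere, whereas \<open>nball x F e\<close> is centred at
  the point under consideration. By the triangle inequality the ball of radius r about z contains
  the ball about x of radius r - q (x - z); intersections are handled by uniting the finite sets of
  seminorms and taking the smaller radius.\<close>

lemma openin_T_iff:
  "openin T U \<longleftrightarrow> U \<subseteq> carrier V \<and>
     (\<forall>x\<in>U. \<exists>F e. finite F \<and> F \<subseteq> Q \<and> 0 < e \<and> nball x F e \<subseteq> U)" (is "_ \<longleftrightarrow> ?R U")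
proof
  assume "openin T U"
  then have "generate_topology_on {{y \<in> carrier V. q (y \<ominus>\<^bsub>V\<^esub> x) < e} |q x e. q \<in> Q \<and> x \<in> carrier V \<and> 0 < e} U"
    unfolding seminorm_topology_def by (rule openin_topology_generated_by)
  then show "?R U"
  proof induction
    case Empty
    then show ?case by simp
  next
    case (Int A B)
    have "\<exists>F e. finite F \<and> F \<subseteq> Q \<and> 0 < e \<and> nball x F e \<subseteq> A \<inter> B" if "x \<in> A \<inter> B" for x
    proof -
      have "x \<in> A" "x \<in> B" using that by auto
      obtain F e where F: "finite F" "F \<subseteq> Q" "0 < e" "nball x F e \<subseteq> A"
        using bspec[OF conjunct2[OF Int.IH(1)] \<open>x \<in> A\<close>] by metis
      obtain F' e' where F': "finite F'" "F' \<subseteq> Q" "0 < e'" "nball x F' e' \<subseteq> B"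
        using bspec[OF conjunct2[OF Int.IH(2)] \<open>x \<in> B\<close>] by metis
      have "nball x (F \<union> F') (min e e') \<subseteq> nball x F e \<inter> nball x F' e'"
        unfolding nball_def by auto
      then have "nball x (F \<union> F') (min e e') \<subseteq> A \<inter> B" using F F' by blast
      then show ?thesis using F F'
        by (intro exI[of _ "F \<union> F'"] exI[of _ "min e e'"]) simp
    qed
    then show ?case using Int.IH by blast
  next
    case (UN K)
    show ?case
    proof (intro conjI ballI)
      show "\<Union>K \<subseteq> carrier V" using UN.IH by blast
      fix x assume "x \<in> \<Union>K"
      then obtain k where k: "k \<in> K" "x \<in> k" by blast
      obtain F e where "finite F" "F \<subseteq> Q" "0 < e" "nball x F e \<subseteq> k"
        using bspec[OF conjunct2[OF UN.IH[OF k(1)]] k(2)] by metis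
      with k show "\<exists>F e. finite F \<and> F \<subseteq> Q \<and> 0 < e \<and> nball x F e \<subseteq> \<Union>K"
        by (metis Union_upper order_trans)
    qed
  next
    case (Basis B)
    then obtain q z r where B: "B = {y \<in> carrier V. q (y \<ominus>\<^bsub>V\<^esub> z) < r}"
      and q: "q \<in> Q" and z: "z \<in> carrier V" "0 < r" by blast
    have "\<exists>F e. finite F \<and> F \<subseteq> Q \<and> 0 < e \<and> nball x F e \<subseteq> B" if x: "x \<in> B" for x
    proof (intro exI conjI)
      show "nball x {q} (r - q (x \<ominus>\<^bsub>V\<^esub> z)) \<subseteq> B"
      proof
        fix y assume "y \<in> nball x {q} (r - q (x \<ominus>\<^bsub>V\<^esub> z))"
        then show "y \<in> B" using seminorm_triangle[OF q, of y x z] x z unfolding B nball_def by auto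
      qed
    qed (use x q in \<open>auto simp: B\<close>)
    then show ?case by (auto simp: B)
  qed
next
  assume R: "?R U"
  show "openin T U"
  proof (subst openin_subopen, intro ballI)
    fix x assume "x \<in> U"
    then obtain F e where "finite F" "F \<subseteq> Q" "0 < e" "nball x F e \<subseteq> U" "x \<in> carrier V"
      using R by blast
    then show "\<exists>S. openin T S \<and> x \<in> S \<and> S \<subseteq> U"
      using openin_nball[of F x e] centre_in_nball[of F x e] by blast
  qed
qed

section \<open>A metric from an enumeration of the seminorms\<close>

abbreviation qn :: "nat \<Rightarrow> 'v \<Rightarrow> real" where "qn \<equiv> from_nat_into Q"

lemma qn_in: "qn k \<in> Q"
  using from_nat_into[OF seminorms_nonempty] .

text \<open>A supremum instead of the usual weighted series: the truncation heights 1 / (k + 1) tend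
  to 0, so a ball of given radius constrains only finitely many seminorms, and no series has to be
  estimated. Outside the carrier the value is 0 because \<open>Metric_space\<close> asks for
  nonnegativity and symmetry at all arguments.\<close>

definition frechet_dist :: "'v \<Rightarrow> 'v \<Rightarrow> real" where
  "frechet_dist x y =
     (if x \<in> carrier V \<and> y \<in> carrier V
      then SUP k. min (1 / real (Suc k)) (qn k (x \<ominus>\<^bsub>V\<^esub> y)) else 0)"

lemma bdd_above_frechet_dist: "bdd_above (range (\<lambda>k. min (1 / real (Suc k)) (qn k z)))"
  by (intro bdd_aboveI2[of _ _ 1]) (simp add: min.coboundedI1)

lemma frechet_dist_upper:
  assumes "x \<in> carrier V" "y \<in> carrier V"
  shows "min (1 / real (Suc k)) (qn k (x \<ominus>\<^bsub>V\<^esub> y)) \<le> frechet_dist x y"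
  using assms cSUP_upper[OF UNIV_I bdd_above_frechet_dist[of "x \<ominus>\<^bsub>V\<^esub> y"], of k]
  by (simp add: frechet_dist_def)

lemma frechet_dist_least:
  assumes "\<And>k. min (1 / real (Suc k)) (qn k (x \<ominus>\<^bsub>V\<^esub> y)) \<le> e" "x \<in> carrier V" "y \<in> carrier V"
  shows "frechet_dist x y \<le> e"
  using assms by (auto simp: frechet_dist_def intro!: cSUP_least)

lemma frechet_dist_nonneg: "0 \<le> frechet_dist x y"
proof (cases "x \<in> carrier V \<and> y \<in> carrier V")
  case True
  then show ?thesis
    using frechet_dist_upper[of x y 0] seminorm_nonneg[OF qn_in[of 0], of "x \<ominus>\<^bsub>V\<^esub> y"] by auto
qed (auto simp: frechet_dist_def)

sublocale frechet: Metric_space "carrier V" frechet_dist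
proof
  show "0 \<le> frechet_dist x y" for x y by (rule frechet_dist_nonneg)
  show "frechet_dist x y = frechet_dist y x" for x y
    using seminorm_diff_commute[OF qn_in, of x y] by (auto simp: frechet_dist_def)
  show "frechet_dist x y = 0 \<longleftrightarrow> x = y" if xy: "x \<in> carrier V" "y \<in> carrier V" for x y
  proof
    assume 0: "frechet_dist x y = 0"
    have "q (x \<ominus>\<^bsub>V\<^esub> y) = 0" if "q \<in> Q" for q
    proof -
      obtain k where k: "q = qn k"
        using from_nat_into_surj[OF seminorms_countable \<open>q \<in> Q\<close>] by metis
      have "min (1 / real (Suc k)) (q (x \<ominus>\<^bsub>V\<^esub> y)) \<le> 0"
        using frechet_dist_upper[of x y k] 0 k xy by simp
      moreover have "0 < 1 / real (Suc k)" by simp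
      ultimately have "q (x \<ominus>\<^bsub>V\<^esub> y) \<le> 0" by (auto simp: min_le_iff_disj not_less[symmetric])
      with seminorm_nonneg[OF that, of "x \<ominus>\<^bsub>V\<^esub> y"] xy show ?thesis by simp
    qed
    then have "x \<ominus>\<^bsub>V\<^esub> y = \<zero>\<^bsub>V\<^esub>" using seminorms_separate[of "x \<ominus>\<^bsub>V\<^esub> y"] xy by simp
    then show "x = y" using xy diff_zero_imp_eq by blast
  next
    assume "x = y"
    then show "frechet_dist x y = 0"
      using xy frechet_dist_nonneg[of x y]
      by (intro antisym frechet_dist_least) (auto simp: diff_self seminorm_zero[OF qn_in])
  qed
  show "frechet_dist x z \<le> frechet_dist x y + frechet_dist y z"
    if xyz: "x \<in> carrier V" "y \<in> carrier V" "z \<in> carrier V" for x y z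
  proof (rule frechet_dist_least)
    fix k
    \<comment> \<open>If the truncated value for (x, y) or for (y, z) equals 1 / (k + 1), that
      distance alone suffices; otherwise both are values of \<open>qn k\<close> and its triangle
      inequality applies.\<close>
    show "min (1 / real (Suc k)) (qn k (x \<ominus>\<^bsub>V\<^esub> z)) \<le> frechet_dist x y + frechet_dist y z"
      using seminorm_triangle[OF qn_in[of k] xyz] frechet_dist_upper[of x y k]
        frechet_dist_upper[of y z k] frechet_dist_nonneg[of x y] frechet_dist_nonneg[of y z] xyz
      by (auto simp: min_def split: if_splits)
  qed (use xyz in auto)
qed

lemma T_eq_mtopology: "T = frechet.mtopology"
proof (rule topology_eq[THEN iffD2], intro allI iffI)
  fix U assume U: "openin T U"
  show "openin frechet.mtopology U"
    unfolding frechet.openin_mtopology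
  proof (intro conjI allI impI)
    show "U \<subseteq> carrier V" using U by (simp add: openin_T_iff)
    fix x assume "x \<in> U"
    with U obtain F e where F: "finite F" "F \<subseteq> Q" "0 < e" "nball x F e \<subseteq> U" and x: "x \<in> carrier V"
      unfolding openin_T_iff by blast
    define ix where "ix q = (SOME k. qn k = q)" for q
    have ix: "qn (ix q) = q" if "q \<in> F" for q
    proof -
      have "\<exists>k. qn k = q" using from_nat_into_surj[OF seminorms_countable] that F(2) by blast
      then show ?thesis unfolding ix_def by (rule someI_ex)
    qed
    \<comment> \<open>Not above the truncation height of any seminorm in F, so that a truncated
      value less than r must be the value of the seminorm itself.\<close>
    define r where "r = Min (insert e ((\<lambda>q. 1 / real (Suc (ix q))) ` F))"
    have r0: "0 < r" unfolding r_def using F(1,3) by (subst Min_gr_iff) auto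
    have re: "r \<le> e" unfolding r_def using F(1) by (intro Min_le) auto
    have rq: "r \<le> 1 / real (Suc (ix q))" if "q \<in> F" for q
      unfolding r_def using F(1) that by (intro Min_le) auto
    have "frechet.mball x r \<subseteq> U"
    proof (rule order_trans[OF _ F(4)], rule subsetI)
      fix y assume y: "y \<in> frechet.mball x r"
      then have yc: "y \<in> carrier V" and d: "frechet_dist x y < r" by auto
      have "q (y \<ominus>\<^bsub>V\<^esub> x) < e" if q: "q \<in> F" for q
      proof -
        have "min (1 / real (Suc (ix q))) (q (x \<ominus>\<^bsub>V\<^esub> y)) < r"
          using frechet_dist_upper[OF x yc, of "ix q"] d ix[OF q] by simp
        then have "q (x \<ominus>\<^bsub>V\<^esub> y) < r" using rq[OF q] by (auto simp: min_less_iff_disj)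
        then show ?thesis using re seminorm_diff_commute[of q x y] q F(2) x yc by auto
      qed
      then show "y \<in> nball x F e" using yc by (auto simp: nball_def)
    qed
    then show "\<exists>r>0. frechet.mball x r \<subseteq> U" using r0 by blast
  qed
next
  fix U assume U: "openin frechet.mtopology U"
  show "openin T U" unfolding openin_T_iff
  proof (intro conjI ballI)
    show "U \<subseteq> carrier V" using U by (simp add: frechet.openin_mtopology)
    fix x assume xU: "x \<in> U"
    with U obtain r where r: "0 < r" "frechet.mball x r \<subseteq> U" and x: "x \<in> carrier V"
      unfolding frechet.openin_mtopology by blast
    \<comment> \<open>Beyond K the truncation alone keeps the terms below r, so only the first K + 1
      seminorms need to be small. They are taken below r / 2 because a supremum of numbers below r
      may equal r.\<close>
    obtain K where K: "1 / real (Suc K) < r" using r(1) nat_approx_posE by blast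
    have "nball x (qn ` {..K}) (r / 2) \<subseteq> frechet.mball x r"
    proof
      fix y assume y: "y \<in> nball x (qn ` {..K}) (r / 2)"
      then have yc: "y \<in> carrier V" by (simp add: nball_def)
      have "frechet_dist x y \<le> max (1 / real (Suc K)) (r / 2)"
      proof (rule frechet_dist_least[OF _ x yc])
        fix k
        show "min (1 / real (Suc k)) (qn k (x \<ominus>\<^bsub>V\<^esub> y)) \<le> max (1 / real (Suc K)) (r / 2)"
        proof (cases "k \<le> K")
          case True
          then have "qn k (y \<ominus>\<^bsub>V\<^esub> x) < r / 2" using y by (auto simp: nball_def)
          then show ?thesis using seminorm_diff_commute[OF qn_in[of k] x yc] by auto
        next
          case False
          then have "1 / real (Suc k) \<le> 1 / real (Suc K)" by (intro divide_left_mono) auto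
          then show ?thesis by linarith
        qed
      qed
      also have "\<dots> < r" using K r(1) by auto
      finally show "y \<in> frechet.mball x r" using x yc by simp
    qed
    then show "\<exists>F e. finite F \<and> F \<subseteq> Q \<and> 0 < e \<and> nball x F e \<subseteq> U"
      using r qn_in by (intro exI[of _ "qn ` {..K}"] exI[of _ "r / 2"]) auto
  qed
qed

lemma T_metrizable: "metrizable_space T"
  by (simp add: T_eq_mtopology frechet.metrizable_space_mtopology)

section \<open>Continuity of the operations and local convexity\<close>

lemma add_diff_add:
  assumes "x \<in> carrier V" "y \<in> carrier V" "x' \<in> carrier V" "y' \<in> carrier V"
  shows "(x' \<oplus>\<^bsub>V\<^esub> y') \<ominus>\<^bsub>V\<^esub> (x \<oplus>\<^bsub>V\<^esub> y) = (x' \<ominus>\<^bsub>V\<^esub> x) \<oplus>\<^bsub>V\<^esub> (y' \<ominus>\<^bsub>V\<^esub> y)"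
  using assms by (simp add: M.minus_eq M.minus_add M.a_ac)

lemma smult_diff_smult:
  assumes "x \<in> carrier V" "y \<in> carrier V"
  shows "c' \<odot>\<^bsub>V\<^esub> y \<ominus>\<^bsub>V\<^esub> c \<odot>\<^bsub>V\<^esub> x = (c' \<odot>\<^bsub>V\<^esub> (y \<ominus>\<^bsub>V\<^esub> x)) \<oplus>\<^bsub>V\<^esub> ((c' - c) \<odot>\<^bsub>V\<^esub> x)"
proof -
  have 1: "c' \<odot>\<^bsub>V\<^esub> (y \<ominus>\<^bsub>V\<^esub> x) = c' \<odot>\<^bsub>V\<^esub> y \<ominus>\<^bsub>V\<^esub> c' \<odot>\<^bsub>V\<^esub> x"
    using smult_r_distr[of c' y "\<ominus>\<^bsub>V\<^esub> x"] smult_r_minus[of c' x] assms by (simp add: M.minus_eq)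
  have "(-c) \<odot>\<^bsub>V\<^esub> x = \<ominus>\<^bsub>V\<^esub> (c \<odot>\<^bsub>V\<^esub> x)"
    using smult_assoc1[of "-1" c x] assms by (simp add: uminus_eq_smult)
  then have 2: "(c' - c) \<odot>\<^bsub>V\<^esub> x = c' \<odot>\<^bsub>V\<^esub> x \<ominus>\<^bsub>V\<^esub> c \<odot>\<^bsub>V\<^esub> x"
    using smult_l_distr[of c' "-c" x] assms by (simp add: M.minus_eq)
  show ?thesis unfolding 1 2 using assms by (simp add: diff_add_diff)
qed

text \<open>Continuity may be checked on the subbasis, and a subbasic ball about another centre
  contains a ball of the same seminorm about each of its points. So single seminorms and balls about
  g z are enough.\<close>

lemma continuous_map_into_T:
  assumes "\<And>z. z \<in> topspace Y \<Longrightarrow> g z \<in> carrier V"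
    and "\<And>z q e. \<lbrakk>z \<in> topspace Y; q \<in> Q; 0 < e\<rbrakk> \<Longrightarrow>
           \<exists>W. openin Y W \<and> z \<in> W \<and> (\<forall>w\<in>W. q (g w \<ominus>\<^bsub>V\<^esub> g z) < e)"
  shows "continuous_map Y T g"
  unfolding seminorm_topology_def
proof (rule continuous_on_generated_topo)
  fix U assume "U \<in> {{y \<in> carrier V. q (y \<ominus>\<^bsub>V\<^esub> x) < e} |q x e. q \<in> Q \<and> x \<in> carrier V \<and> 0 < e}"
  then obtain q x e where U: "U = {y \<in> carrier V. q (y \<ominus>\<^bsub>V\<^esub> x) < e}"
    and q: "q \<in> Q" and x: "x \<in> carrier V" by blast
  show "openin Y (g -` U \<inter> topspace Y)"
  proof (subst openin_subopen, intro ballI)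
    fix z assume z: "z \<in> g -` U \<inter> topspace Y"
    then have "0 < e - q (g z \<ominus>\<^bsub>V\<^esub> x)" by (auto simp: U)
    then obtain W where W: "openin Y W" "z \<in> W" "\<forall>w\<in>W. q (g w \<ominus>\<^bsub>V\<^esub> g z) < e - q (g z \<ominus>\<^bsub>V\<^esub> x)"
      using assms(2)[of z q] z q by blast
    have "w \<in> g -` U \<inter> topspace Y" if w: "w \<in> W" for w
    proof -
      have wX: "w \<in> topspace Y" using W(1) w openin_subset by blast
      then show ?thesis
        using seminorm_triangle[OF q assms(1)[OF wX] assms(1)[of z] x] W(3) w z assms(1)
        by (force simp: U)
    qed
    with W show "\<exists>S. openin Y S \<and> z \<in> S \<and> S \<subseteq> g -` U \<inter> topspace Y" by blast
  qed
next
  show "g ` topspace Y \<subseteq> \<Union> {{y \<in> carrier V. q (y \<ominus>\<^bsub>V\<^esub> x) < e} |q x e. q \<in> Q \<and> x \<in> carrier V \<and> 0 < e}"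
    using assms(1) topspace_T unfolding seminorm_topology_def topology_generated_by_topspace by blast
qed

lemma continuous_map_add: "continuous_map (prod_topology T T) T (\<lambda>(x, y). x \<oplus>\<^bsub>V\<^esub> y)"
proof (rule continuous_map_into_T)
  fix z q and e :: real assume z: "z \<in> topspace (prod_topology T T)" and q: "q \<in> Q" and e: "0 < e"
  obtain x y where xy: "z = (x, y)" "x \<in> carrier V" "y \<in> carrier V"
    using z by (auto simp: topspace_T)
  let ?W = "nball x {q} (e / 2) \<times> nball y {q} (e / 2)"
  have "openin (prod_topology T T) ?W" "z \<in> ?W"
    using openin_nball[of "{q}"] centre_in_nball[of "{q}"] q e xy by (auto simp: openin_prod_Times_iff)
  moreover have "q ((x' \<oplus>\<^bsub>V\<^esub> y') \<ominus>\<^bsub>V\<^esub> (x \<oplus>\<^bsub>V\<^esub> y)) < e" if "(x', y') \<in> ?W" for x' y'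
    using that xy seminorm_add[OF q, of "x' \<ominus>\<^bsub>V\<^esub> x" "y' \<ominus>\<^bsub>V\<^esub> y"] by (auto simp: nball_def add_diff_add)
  ultimately show "\<exists>W. openin (prod_topology T T) W \<and> z \<in> W \<and>
      (\<forall>w\<in>W. q ((case w of (x, y) \<Rightarrow> x \<oplus>\<^bsub>V\<^esub> y) \<ominus>\<^bsub>V\<^esub> (case z of (x, y) \<Rightarrow> x \<oplus>\<^bsub>V\<^esub> y)) < e)"
    using xy(1) by (intro exI[of _ ?W]) auto
qed (auto simp: topspace_T)

lemma continuous_map_smult: "continuous_map (prod_topology euclidean T) T (\<lambda>(c, x). c \<odot>\<^bsub>V\<^esub> x)"
proof (rule continuous_map_into_T)
  fix z :: "complex \<times> 'v" and q and e :: real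
  assume z: "z \<in> topspace (prod_topology euclidean T)" and q: "q \<in> Q" and e: "0 < e"
  obtain c x where cx: "z = (c, x)" "x \<in> carrier V"
    using z by (auto simp: topspace_T)
  \<comment> \<open>The bound 1 gives |c'| < |c| + 1, and the other bound makes (|c| + 1) * d + d *
    q x at most e. This dominates q (c' x' - c x) through the splitting c' x' - c x = c' (x' - x) +
    (c' - c) x. The summand 1 keeps the denominator positive.\<close>
  define d where "d = min 1 (e / (cmod c + 1 + q x))"
  have pos: "0 < cmod c + 1 + q x" using seminorm_nonneg[OF q cx(2)] by (smt (verit) norm_ge_zero)
  have d: "0 < d" "d \<le> 1" using e pos by (auto simp: d_def)
  have "d \<le> e / (cmod c + 1 + q x)" by (simp add: d_def)
  then have de: "(cmod c + 1) * d + d * q x \<le> e" using pos by (simp add: field_simps)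
  let ?W = "ball c d \<times> nball x {q} d"
  have "openin (prod_topology euclidean T) ?W" "z \<in> ?W"
    using openin_nball[of "{q}"] centre_in_nball[of "{q}"] q d cx by (auto simp: openin_prod_Times_iff)
  moreover have "q ((c' \<odot>\<^bsub>V\<^esub> x') \<ominus>\<^bsub>V\<^esub> (c \<odot>\<^bsub>V\<^esub> x)) < e" if W: "(c', x') \<in> ?W" for c' x'
  proof -
    have x': "x' \<in> carrier V" "q (x' \<ominus>\<^bsub>V\<^esub> x) < d" and c': "cmod (c' - c) < d"
      using W by (auto simp: nball_def dist_norm norm_minus_commute)
    have "cmod c' < cmod c + 1" using c' d(2) norm_triangle_ineq2[of c' c] by linarith
    have "q ((c' \<odot>\<^bsub>V\<^esub> x') \<ominus>\<^bsub>V\<^esub> (c \<odot>\<^bsub>V\<^esub> x)) \<le> cmod c' * q (x' \<ominus>\<^bsub>V\<^esub> x) + cmod (c' - c) * q x"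
      using seminorm_add[OF q, of "c' \<odot>\<^bsub>V\<^esub> (x' \<ominus>\<^bsub>V\<^esub> x)" "(c' - c) \<odot>\<^bsub>V\<^esub> x"] x'(1) cx(2)
      by (simp add: smult_diff_smult seminorm_smult[OF q])
    also have "cmod c' * q (x' \<ominus>\<^bsub>V\<^esub> x) \<le> cmod c' * d"
      using x' by (intro mult_left_mono) auto
    also have "cmod c' * d < (cmod c + 1) * d"
      using \<open>cmod c' < cmod c + 1\<close> d by (intro mult_strict_right_mono) auto
    also have "cmod (c' - c) * q x \<le> d * q x"
      using c' seminorm_nonneg[OF q cx(2)] by (intro mult_right_mono) auto
    finally show ?thesis using de by linarith
  qed
  ultimately show "\<exists>W. openin (prod_topology euclidean T) W \<and> z \<in> W \<and>
      (\<forall>w\<in>W. q ((case w of (c, x) \<Rightarrow> c \<odot>\<^bsub>V\<^esub> x) \<ominus>\<^bsub>V\<^esub> (case z of (c, x) \<Rightarrow> c \<odot>\<^bsub>V\<^esub> x)) < e)"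
    using cx(1) by (intro exI[of _ ?W]) auto
qed (auto simp: topspace_T)

lemma topological_vector_space_T: "topological_vector_space V T"
  unfolding topological_vector_space_def
  using continuous_map_add continuous_map_smult topspace_T module_axioms by blast

lemma convex_in_nball:
  assumes "F \<subseteq> Q"
  shows "convex_in V (nball \<zero>\<^bsub>V\<^esub> F e)"
  unfolding convex_in_def
proof (intro ballI)
  fix x y and t :: real
  assume x: "x \<in> nball \<zero>\<^bsub>V\<^esub> F e" and y: "y \<in> nball \<zero>\<^bsub>V\<^esub> F e" and t: "t \<in> {0..1}"
  have c: "x \<in> carrier V" "y \<in> carrier V" using x y by (auto simp: nball_def)
  let ?w = "(complex_of_real t \<odot>\<^bsub>V\<^esub> x) \<oplus>\<^bsub>V\<^esub> (complex_of_real (1 - t) \<odot>\<^bsub>V\<^esub> y)"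
  have "q ?w < e" if q: "q \<in> F" for q
  proof -
    have qQ: "q \<in> Q" and "q x < e" "q y < e" using q x y assms c by (auto simp: nball_def diff_zero)
    have "q ?w \<le> q (complex_of_real t \<odot>\<^bsub>V\<^esub> x) + q (complex_of_real (1 - t) \<odot>\<^bsub>V\<^esub> y)"
      using seminorm_add[OF qQ] c by simp
    also have "\<dots> = t * q x + (1 - t) * q y"
      unfolding seminorm_smult[OF qQ c(1)] seminorm_smult[OF qQ c(2)] norm_of_real using t by simp
    also have "\<dots> < e"
      using convex_bound_lt[OF \<open>q x < e\<close> \<open>q y < e\<close>, of t "1 - t"] t by simp
    finally show ?thesis .
  qed
  then show "?w \<in> nball \<zero>\<^bsub>V\<^esub> F e" using c by (auto simp: nball_def diff_zero)
qed

lemma locally_convex_space_T: "locally_convex_space V T"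
  unfolding locally_convex_space_def
proof (intro conjI allI impI topological_vector_space_T)
  fix U assume U: "openin T U \<and> \<zero>\<^bsub>V\<^esub> \<in> U"
  then obtain F e where "finite F" "F \<subseteq> Q" "0 < e" "nball \<zero>\<^bsub>V\<^esub> F e \<subseteq> U"
    unfolding openin_T_iff by blast
  then show "\<exists>C. openin T C \<and> \<zero>\<^bsub>V\<^esub> \<in> C \<and> C \<subseteq> U \<and> convex_in V C"
    using openin_nball convex_in_nball centre_in_nball M.zero_closed by (intro exI[of _ "nball \<zero>\<^bsub>V\<^esub> F e"]) auto
qed

text \<open>A Cauchy filter can be traced by a sequence: as the seminorms are countably many, there
  are members P k of the filter on which differences are small in the first k + 1 seminorms, and
  points Y k chosen from them form a Cauchy sequence. Its limit is also the limit of the filter,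
  because all points of P K are close to every late Y k.\<close>

lemma complete_tvs_T:
  assumes complete: "\<And>Y. \<lbrakk>\<And>k. Y k \<in> carrier V;
      \<And>q e. \<lbrakk>q \<in> Q; 0 < e\<rbrakk> \<Longrightarrow> \<exists>K. \<forall>i\<ge>K. \<forall>j\<ge>K. q (Y i \<ominus>\<^bsub>V\<^esub> Y j) < e\<rbrakk> \<Longrightarrow>
      \<exists>l\<in>carrier V. \<forall>q\<in>Q. (\<lambda>k. q (Y k \<ominus>\<^bsub>V\<^esub> l)) \<longlonglongrightarrow> 0"
  shows "complete_tvs V T"
  unfolding complete_tvs_def
proof (intro allI impI)
  fix \<F> :: "'v filter" assume "\<F> \<noteq> bot \<and> tvs_cauchy_filter V T \<F>"
  then have ne: "\<F> \<noteq> bot" and car: "\<forall>\<^sub>F x in \<F>. x \<in> carrier V"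
    and cau: "\<And>U. openin T U \<Longrightarrow> \<zero>\<^bsub>V\<^esub> \<in> U \<Longrightarrow> \<forall>\<^sub>F (x, y) in \<F> \<times>\<^sub>F \<F>. x \<ominus>\<^bsub>V\<^esub> y \<in> U"
    by (auto simp: tvs_cauchy_filter_def)
  let ?U = "\<lambda>k. nball \<zero>\<^bsub>V\<^esub> (qn ` {..k}) (1 / real (Suc k))"
  have "\<exists>P. eventually P \<F> \<and> (\<forall>x y. P x \<longrightarrow> P y \<longrightarrow> x \<ominus>\<^bsub>V\<^esub> y \<in> ?U k)" for k
  proof -
    have "openin T (?U k)" "\<zero>\<^bsub>V\<^esub> \<in> ?U k"
      using qn_in by (auto intro!: openin_nball centre_in_nball)
    then show ?thesis using cau[of "?U k"] by (simp add: eventually_prod_same)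
  qed
  then obtain P where P: "\<And>k. eventually (P k) \<F>"
    and PU: "\<And>k x y. P k x \<Longrightarrow> P k y \<Longrightarrow> x \<ominus>\<^bsub>V\<^esub> y \<in> ?U k" by metis
  \<comment> \<open>The P k are not known to be nested. Choosing Y k in all P j with j \<le> k puts
    a whole tail of Y into each P j.\<close>
  have "\<exists>x. x \<in> carrier V \<and> (\<forall>j\<le>k. P j x)" for k
  proof -
    have "\<forall>\<^sub>F x in \<F>. x \<in> carrier V \<and> (\<forall>j\<in>{..k}. P j x)"
      using car P by (simp add: eventually_conj_iff eventually_ball_finite)
    then show ?thesis using eventually_happens'[OF ne] by fastforce
  qed
  then obtain Y where Xc: "\<And>k. Y k \<in> carrier V" and XP: "\<And>k j. j \<le> k \<Longrightarrow> P j (Y k)" by metis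
  have small: "\<exists>K. \<forall>x y. P K x \<and> P K y \<longrightarrow> q (x \<ominus>\<^bsub>V\<^esub> y) < e"
    if q: "q \<in> Q" and e: "0 < e" for q e
  proof -
    obtain k where k: "q = qn k"
      using from_nat_into_surj[OF seminorms_countable \<open>q \<in> Q\<close>] by metis
    obtain n where n: "1 / real (Suc n) < e" using e nat_approx_posE by blast
    have "q (x \<ominus>\<^bsub>V\<^esub> y) < e" if "P (max k n) x \<and> P (max k n) y" for x y
    proof -
      have U: "x \<ominus>\<^bsub>V\<^esub> y \<in> ?U (max k n)" using PU that by blast
      then have "q (x \<ominus>\<^bsub>V\<^esub> y) < 1 / real (Suc (max k n))"
        unfolding nball_def k by (auto simp: diff_zero)
      also have "\<dots> \<le> 1 / real (Suc n)" by (intro divide_left_mono) auto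
      finally show ?thesis using n by linarith
    qed
    then show ?thesis by blast
  qed
  have cauY: "\<exists>K. \<forall>i\<ge>K. \<forall>j\<ge>K. q (Y i \<ominus>\<^bsub>V\<^esub> Y j) < e" if qe: "q \<in> Q" "0 < e" for q e
  proof -
    obtain K where "\<And>x y. P K x \<and> P K y \<longrightarrow> q (x \<ominus>\<^bsub>V\<^esub> y) < e" using small[OF qe] by auto
    then have "\<forall>i\<ge>K. \<forall>j\<ge>K. q (Y i \<ominus>\<^bsub>V\<^esub> Y j) < e" using XP by simp
    then show ?thesis ..
  qed
  obtain l where l: "l \<in> carrier V" and lim: "\<And>q. q \<in> Q \<Longrightarrow> (\<lambda>k. q (Y k \<ominus>\<^bsub>V\<^esub> l)) \<longlonglongrightarrow> 0"
    using complete[of Y, OF Xc cauY] by auto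
  have conv: "\<forall>\<^sub>F x in \<F>. q (x \<ominus>\<^bsub>V\<^esub> l) < e" if q: "q \<in> Q" and e: "0 < e" for q e
  proof -
    obtain K where K: "\<And>x y. P K x \<Longrightarrow> P K y \<Longrightarrow> q (x \<ominus>\<^bsub>V\<^esub> y) < e / 2"
      using small[OF q, of "e / 2"] e by auto
    have "\<forall>\<^sub>F k in sequentially. q (Y k \<ominus>\<^bsub>V\<^esub> l) < e / 2"
      using order_tendstoD(2)[OF lim[OF q], of "e / 2"] e by simp
    then obtain N where N: "\<And>k. k \<ge> N \<Longrightarrow> q (Y k \<ominus>\<^bsub>V\<^esub> l) < e / 2"
      by (auto simp: eventually_sequentially)
    \<comment> \<open>Late enough for Y ?k to lie in P K together with x and to be within e / 2 of
      l.\<close>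
    let ?k = "max K N"
    have "\<forall>\<^sub>F x in \<F>. x \<in> carrier V \<and> P K x" using car P by (simp add: eventually_conj_iff)
    then show ?thesis
    proof eventually_elim
      case (elim x)
      then show ?case
        using seminorm_triangle[OF q, of x "Y ?k" l] Xc[of ?k] l K[of x "Y ?k"] XP[of K ?k] N[of ?k]
        by auto
    qed
  qed
  have "limitin T (\<lambda>x. x) l \<F>"
    unfolding limitin_def
  proof (intro conjI allI impI)
    show "l \<in> topspace T" using l by (simp add: topspace_T)
    fix U assume "openin T U \<and> l \<in> U"
    then obtain F e where F: "finite F" "F \<subseteq> Q" "0 < e" "nball l F e \<subseteq> U"
      unfolding openin_T_iff by blast
    have "\<forall>\<^sub>F x in \<F>. \<forall>q\<in>F. q (x \<ominus>\<^bsub>V\<^esub> l) < e"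
      using F conv by (intro eventually_ball_finite) auto
    with car show "\<forall>\<^sub>F x in \<F>. x \<in> U"
      by eventually_elim (use F(4) in \<open>auto simp: nball_def\<close>)
  qed
  then show "\<exists>l. limitin T (\<lambda>x. x) l \<F>" by blast
qed

theorem frechet_space_T:
  assumes "\<And>Y. \<lbrakk>\<And>k. Y k \<in> carrier V;
      \<And>q e. \<lbrakk>q \<in> Q; 0 < e\<rbrakk> \<Longrightarrow> \<exists>K. \<forall>i\<ge>K. \<forall>j\<ge>K. q (Y i \<ominus>\<^bsub>V\<^esub> Y j) < e\<rbrakk> \<Longrightarrow>
      \<exists>l\<in>carrier V. \<forall>q\<in>Q. (\<lambda>k. q (Y k \<ominus>\<^bsub>V\<^esub> l)) \<longlonglongrightarrow> 0"
  shows "frechet_space V T"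
  unfolding frechet_space_def
  using locally_convex_space_T T_metrizable metrizable_imp_Hausdorff_space complete_tvs_T[OF assms] by blast

end


section \<open>Seminorms of arrays of derivatives\<close>

lemma infsum_ennreal_eq_SUP:
  fixes f :: "'i \<Rightarrow> ennreal"
  shows "infsum f A = (SUP F\<in>{F. finite F \<and> F \<subseteq> A}. sum f F)"
  by (rule nonneg_infsum_complete) simp

lemma sum_le_infsum_ennreal:
  fixes f :: "'i \<Rightarrow> ennreal"
  assumes "finite F" "F \<subseteq> A"
  shows "sum f F \<le> infsum f A"
  unfolding infsum_ennreal_eq_SUP using assms by (intro SUP_upper) auto

lemma le_infsum_ennreal:
  fixes f :: "'i \<Rightarrow> ennreal"
  assumes "x \<in> A"
  shows "f x \<le> infsum f A"
  using sum_le_infsum_ennreal[of "{x}" A f] assms by simp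

lemma infsum_cmult_ennreal:
  fixes f :: "'i \<Rightarrow> ennreal"
  shows "(\<Sum>\<^sub>\<infinity>x\<in>A. c * f x) = c * infsum f A"
proof -
  have "{F. finite F \<and> F \<subseteq> A} \<noteq> {}" by blast
  then show ?thesis
    unfolding infsum_ennreal_eq_SUP by (simp add: SUP_mult_left_ennreal sum_distrib_left)
qed

lemma infsum_mono_ennreal:
  fixes f g :: "'i \<Rightarrow> ennreal"
  assumes "\<And>x. x \<in> A \<Longrightarrow> f x \<le> g x"
  shows "infsum f A \<le> infsum g A"
  using assms by (intro infsum_mono) (auto intro: nonneg_summable_on_complete)

lemma sum_liminf_le_ennreal:
  fixes f :: "nat \<Rightarrow> 'i \<Rightarrow> ennreal"
  assumes "finite A"
  shows "(\<Sum>x\<in>A. liminf (\<lambda>k. f k x)) \<le> liminf (\<lambda>k. \<Sum>x\<in>A. f k x)"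
  using nn_integral_liminf[of f "count_space A"] assms
  by (simp add: nn_integral_count_space_finite)

text \<open>Fatou's lemma for the counting measure: the left-hand side is the supremum of its finite
  partial sums, and the finite case applies to each of them.\<close>

lemma infsum_liminf_le_ennreal:
  fixes f :: "nat \<Rightarrow> 'i \<Rightarrow> ennreal"
  shows "(\<Sum>\<^sub>\<infinity>x\<in>A. liminf (\<lambda>k. f k x)) \<le> liminf (\<lambda>k. \<Sum>\<^sub>\<infinity>x\<in>A. f k x)"
  unfolding infsum_ennreal_eq_SUP[of "\<lambda>x. liminf (\<lambda>k. f k x)"]
proof (rule SUP_least)
  fix F assume F: "F \<in> {F. finite F \<and> F \<subseteq> A}"
  then have "(\<Sum>x\<in>F. liminf (\<lambda>k. f k x)) \<le> liminf (\<lambda>k. \<Sum>x\<in>F. f k x)"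
    by (intro sum_liminf_le_ennreal) auto
  also have "\<dots> \<le> liminf (\<lambda>k. \<Sum>\<^sub>\<infinity>x\<in>A. f k x)"
    using F by (intro Liminf_mono always_eventually allI sum_le_infsum_ennreal) auto
  finally show "(\<Sum>x\<in>F. liminf (\<lambda>k. f k x)) \<le> liminf (\<lambda>k. \<Sum>\<^sub>\<infinity>x\<in>A. f k x)" .
qed

section \<open>Convexity and continuity of the square\<close>

lemma square_convex_real:
  fixes x y t :: real
  assumes "0 \<le> t" "t \<le> 1"
  shows "(t * x + (1 - t) * y)\<^sup>2 \<le> t * x\<^sup>2 + (1 - t) * y\<^sup>2"
proof -
  have "t * x\<^sup>2 + (1 - t) * y\<^sup>2 - (t * x + (1 - t) * y)\<^sup>2 = t * (1 - t) * (x - y)\<^sup>2"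
    by (simp add: power2_eq_square algebra_simps)
  moreover have "0 \<le> t * (1 - t) * (x - y)\<^sup>2" using assms by simp
  ultimately show ?thesis by linarith
qed

lemma ennreal_mult_add_mult:
  assumes "0 \<le> a" "0 \<le> b" "0 \<le> c" "0 \<le> d"
  shows "ennreal a * ennreal b + ennreal c * ennreal d = ennreal (a * b + c * d)"
  using assms by (simp add: ennreal_plus ennreal_mult)

text \<open>With 0 < t < 1 both weights are positive, so an infinite x or y makes the right-hand
  side infinite; what remains is the real case.\<close>

lemma square_convex_ennreal:
  fixes x y :: ennreal and t :: real
  assumes "0 < t" "t < 1"
  shows "(ennreal t * x + ennreal (1 - t) * y)\<^sup>2 \<le> ennreal t * x\<^sup>2 + ennreal (1 - t) * y\<^sup>2"
proof (cases "x = \<infinity> \<or> y = \<infinity>")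
  case True
  then show ?thesis using assms by (auto simp: ennreal_mult_top power2_eq_square ennreal_top_mult)
next
  case False
  then obtain u v where uv: "x = ennreal u" "0 \<le> u" "y = ennreal v" "0 \<le> v"
    by (metis ennreal_cases infinity_ennreal_def)
  have "ennreal ((t * u + (1 - t) * v)\<^sup>2) \<le> ennreal (t * u\<^sup>2 + (1 - t) * v\<^sup>2)"
    using square_convex_real[of t u v] assms by (intro ennreal_leI) auto
  moreover have "(ennreal t * x + ennreal (1 - t) * y)\<^sup>2 = ennreal ((t * u + (1 - t) * v)\<^sup>2)"
    using uv assms ennreal_mult_add_mult[of t u "1 - t" v] ennreal_power[of "t * u + (1 - t) * v" 2]
    by (metis add_nonneg_nonneg diff_ge_0_iff_ge less_imp_le mult_nonneg_nonneg)
  moreover have "ennreal t * x\<^sup>2 + ennreal (1 - t) * y\<^sup>2 = ennreal (t * u\<^sup>2 + (1 - t) * v\<^sup>2)"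
    unfolding uv(1,3) ennreal_power[OF uv(2)] ennreal_power[OF uv(4)]
    using assms by (intro ennreal_mult_add_mult) auto
  ultimately show ?thesis by simp
qed

lemma continuous_on_square_ennreal: "continuous_on A (\<lambda>x::ennreal. x\<^sup>2)"
  unfolding continuous_on_def power2_eq_square
  by (auto intro!: tendsto_mult_ennreal tendsto_ident_at)

lemma finite_multiindices_le: "finite {J :: nat^'n. J \<le> K}"
proof (rule finite_imageD)
  have "vec_nth ` {J. J \<le> K} \<subseteq> PiE UNIV (\<lambda>i. {..K $ i})" by (auto simp: less_eq_vec_def)
  then show "finite (vec_nth ` {J. J \<le> K})" by (rule finite_subset) (auto intro: finite_PiE)
qed (auto simp: inj_on_def vec_eq_iff)

text \<open>A limit of jets is at first only an array, not known to be the jet of a function, so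
  values are defined for arbitrary arrays. The even and odd cases of \<open>h_val\<close> are merged
  by exchanging I and J, so that each induction on m treats both at once.\<close>

primrec jet_val :: "real \<Rightarrow> (nat^'n \<Rightarrow> nat^'n \<Rightarrow> complex) \<Rightarrow> nat \<Rightarrow> nat \<Rightarrow> nat^'n \<Rightarrow> nat^'n \<Rightarrow> ennreal" where
  "jet_val hbar a 0 = (\<lambda>l R S.
     \<Sum>\<^sub>\<infinity>N\<in>UNIV. ennreal ((2 * hbar) ^ (mi_size R + mi_size S + mi_size N) / real (mi_fact N)
                     * (cmod (a R (N + S)))\<^sup>2))"
| "jet_val hbar a (Suc m) = (\<lambda>l R S.
     \<Sum>\<^sub>\<infinity>N\<in>UNIV. ennreal (1 / real (mi_fact N)) *
       (\<Sum>I\<in>{I. I \<le> R}. \<Sum>J\<in>{J. J \<le> N + S}.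
          of_nat (mi_binom R I) * of_nat (mi_binom (N + S) J)
          * jet_val hbar a m (l div 2) (if even l then I else J) (if even l then J else I))\<^sup>2)"

lemma h_val_eq_jet_val: "h_val p hbar f m l R S = jet_val hbar (\<lambda>R S. wirtinger R S f p) m l R S"
proof (induction m arbitrary: l R S)
  case (Suc m)
  have "(l - 1) div 2 = l div 2" if "odd l" using that by presburger
  then show ?case by (simp add: Suc)
qed simp

declare jet_val.simps [simp del]

text \<open>The degree doubles with each level: the base case is quadratic in the entries, and every
  further level squares linear expressions in the values below it.\<close>

lemma jet_val_cmult:
  "jet_val hbar (\<lambda>R S. c * a R S) m l R S = ennreal (cmod c ^ 2 ^ Suc m) * jet_val hbar a m l R S"
proof (induction m arbitrary: l R S)
  case 0
  show ?case unfolding jet_val.simps infsum_cmult_ennreal[symmetric]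
    by (intro infsum_cong) (simp add: norm_mult power_mult_distrib ennreal_mult'[symmetric] mult_ac)
next
  case (Suc m)
  let ?c = "ennreal (cmod c ^ 2 ^ Suc m)"
  have "?c\<^sup>2 = ennreal (cmod c ^ 2 ^ Suc (Suc m))"
    by (simp add: ennreal_power mult.commute flip: power_mult)
  moreover have "(\<Sum>I\<in>A. \<Sum>J\<in>B. ?c * z I J) = ?c * (\<Sum>I\<in>A. \<Sum>J\<in>B. z I J)"
    for A B :: "(nat^'a) set" and z
    by (simp add: sum_distrib_left)
  ultimately show ?case
    unfolding jet_val.simps infsum_cmult_ennreal[symmetric] Suc
    by (simp only: power_mult_distrib mult.left_commute)
qed

lemma norm_square_convex:
  assumes "0 \<le> t" "t \<le> 1"
  shows "(cmod (of_real t * x + of_real (1 - t) * y))\<^sup>2 \<le> t * (cmod x)\<^sup>2 + (1 - t) * (cmod y)\<^sup>2"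
proof -
  have "cmod (of_real t * x + of_real (1 - t) * y) \<le> t * cmod x + (1 - t) * cmod y"
    using norm_triangle_ineq[of "of_real t * x" "of_real (1 - t) * y"] assms
    by (simp add: norm_mult del: of_real_diff)
  then have "(cmod (of_real t * x + of_real (1 - t) * y))\<^sup>2 \<le> (t * cmod x + (1 - t) * cmod y)\<^sup>2"
    by (intro power_mono) auto
  also note square_convex_real[OF assms]
  finally show ?thesis .
qed

text \<open>Convexity survives each level: all weights are nonnegative, and the square is both
  convex and increasing on [0, infinity], so the square of a convex function is convex.\<close>

lemma jet_val_convex:
  assumes "0 < hbar" "0 < t" "t < 1"
  shows "jet_val hbar (\<lambda>R S. of_real t * a R S + of_real (1 - t) * b R S) m l R S
    \<le> ennreal t * jet_val hbar a m l R S + ennreal (1 - t) * jet_val hbar b m l R S"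
proof (induction m arbitrary: l R S)
  case 0
  have "ennreal ((2 * hbar) ^ k / real M * (cmod (of_real t * x + of_real (1 - t) * y))\<^sup>2)
    \<le> ennreal t * ennreal ((2 * hbar) ^ k / real M * (cmod x)\<^sup>2)
      + ennreal (1 - t) * ennreal ((2 * hbar) ^ k / real M * (cmod y)\<^sup>2)" for k M x y
  proof -
    let ?w = "(2 * hbar) ^ k / real M"
    have w: "0 \<le> ?w" using assms by simp
    have "?w * (cmod (of_real t * x + of_real (1 - t) * y))\<^sup>2
      \<le> ?w * (t * (cmod x)\<^sup>2 + (1 - t) * (cmod y)\<^sup>2)"
      using norm_square_convex[of t x y] assms w by (intro mult_left_mono) auto
    also have "\<dots> = t * (?w * (cmod x)\<^sup>2) + (1 - t) * (?w * (cmod y)\<^sup>2)"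
      by (simp add: field_simps add_divide_distrib diff_divide_distrib)
    finally have "ennreal (?w * (cmod (of_real t * x + of_real (1 - t) * y))\<^sup>2)
      \<le> ennreal (t * (?w * (cmod x)\<^sup>2) + (1 - t) * (?w * (cmod y)\<^sup>2))"
      by (rule ennreal_leI)
    also have "\<dots> = ennreal t * ennreal (?w * (cmod x)\<^sup>2) + ennreal (1 - t) * ennreal (?w * (cmod y)\<^sup>2)"
      using assms w
      by (metis diff_ge_0_iff_ge ennreal_mult ennreal_plus less_imp_le mult_nonneg_nonneg zero_le_power2)
    finally show ?thesis .
  qed
  then show ?case
    unfolding jet_val.simps infsum_cmult_ennreal[symmetric]
    by (subst infsum_add[symmetric]) (auto intro!: infsum_mono_ennreal nonneg_summable_on_complete simp del: of_real_diff)
next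
  case (Suc m)
  let ?c = "\<lambda>a I J. jet_val hbar a m (l div 2) (if even l then I else J) (if even l then J else I)"
  let ?ab = "\<lambda>R S. of_real t * a R S + of_real (1 - t) * b R S"
  let ?s = "\<lambda>a N. \<Sum>I\<in>{I. I \<le> R}. \<Sum>J\<in>{J. J \<le> N + S}.
          of_nat (mi_binom R I) * of_nat (mi_binom (N + S) J) * ?c a I J"
  have "?s ?ab N \<le> ennreal t * ?s a N + ennreal (1 - t) * ?s b N" for N
  proof -
    have "?s ?ab N \<le> (\<Sum>I\<in>{I. I \<le> R}. \<Sum>J\<in>{J. J \<le> N + S}.
          of_nat (mi_binom R I) * of_nat (mi_binom (N + S) J) * (ennreal t * ?c a I J + ennreal (1 - t) * ?c b I J))"
      by (intro sum_mono mult_left_mono Suc) auto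
    also have "\<dots> = ennreal t * ?s a N + ennreal (1 - t) * ?s b N"
      by (simp add: sum.distrib sum_distrib_left algebra_simps)
    finally show ?thesis .
  qed
  then have sq: "(?s ?ab N)\<^sup>2 \<le> ennreal t * (?s a N)\<^sup>2 + ennreal (1 - t) * (?s b N)\<^sup>2" for N
    using square_convex_ennreal[OF assms(2,3)] by (meson order_trans power_mono zero_le)
  have "ennreal (1 / real (mi_fact N)) * (?s ?ab N)\<^sup>2 \<le>
     ennreal t * (ennreal (1 / real (mi_fact N)) * (?s a N)\<^sup>2)
     + ennreal (1 - t) * (ennreal (1 / real (mi_fact N)) * (?s b N)\<^sup>2)" for N
  proof -
    have distr: "c * (t * A + u * B) = t * (c * A) + u * (c * B)" for c t u A B :: ennreal
      by (simp add: distrib_left mult_ac)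
    show ?thesis
      unfolding distr[symmetric] using sq by (rule mult_left_mono) simp
  qed
  then show ?case
    unfolding jet_val.simps infsum_cmult_ennreal[symmetric]
    by (subst infsum_add[symmetric]) (auto intro!: infsum_mono_ennreal nonneg_summable_on_complete simp del: of_real_diff)
qed

text \<open>The inner sums and the sum over N obey Fatou's inequality, while the square and
  multiplication by a finite factor are continuous and increasing and therefore commute with
  liminf.\<close>

lemma jet_val_le_liminf:
  assumes "0 < hbar" and lim: "\<And>R S. (\<lambda>k. a k R S) \<longlonglongrightarrow> b R S"
  shows "jet_val hbar b m l R S \<le> liminf (\<lambda>k. jet_val hbar (a k) m l R S)"
proof (induction m arbitrary: l R S)
  case 0
  have "ennreal (w * (cmod (b R N))\<^sup>2) \<le> liminf (\<lambda>k. ennreal (w * (cmod (a k R N))\<^sup>2))" for w N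
  proof -
    have "(\<lambda>k. ennreal (w * (cmod (a k R N))\<^sup>2)) \<longlonglongrightarrow> ennreal (w * (cmod (b R N))\<^sup>2)"
      by (intro tendsto_intros lim)
    then show ?thesis by (simp add: lim_imp_Liminf)
  qed
  then show ?case
    unfolding jet_val.simps
    by (intro order_trans[OF infsum_mono_ennreal infsum_liminf_le_ennreal])
next
  case (Suc m)
  let ?c = "\<lambda>a I J. jet_val hbar a m (l div 2) (if even l then I else J) (if even l then J else I)"
  let ?s = "\<lambda>a N. \<Sum>I\<in>{I. I \<le> R}. \<Sum>J\<in>{J. J \<le> N + S}.
          of_nat (mi_binom R I) * of_nat (mi_binom (N + S) J) * ?c a I J"
  \<comment> \<open>Multiplication by infinity is discontinuous at 0, hence the restriction to
    finite c. Binomial coefficients and inverse factorials qualify.\<close>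
  have mult: "c * liminf f = liminf (\<lambda>k. c * f k)" if "c < \<infinity>" for c :: ennreal and f
    using that by (intro Liminf_compose_continuous_mono[symmetric] ennreal_continuous_on_cmult
        monoI mult_left_mono continuous_on_id) auto
  have s: "?s b N \<le> liminf (\<lambda>k. ?s (a k) N)" for N
  proof -
    have "?s b N \<le> (\<Sum>I\<in>{I. I \<le> R}. \<Sum>J\<in>{J. J \<le> N + S}.
          liminf (\<lambda>k. of_nat (mi_binom R I) * of_nat (mi_binom (N + S) J) * ?c (a k) I J))"
      by (subst mult[symmetric]) (auto intro!: sum_mono mult_left_mono Suc simp: ennreal_mult_less_top of_nat_less_top)
    also have "\<dots> \<le> (\<Sum>I\<in>{I. I \<le> R}. liminf (\<lambda>k. \<Sum>J\<in>{J. J \<le> N + S}.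
          of_nat (mi_binom R I) * of_nat (mi_binom (N + S) J) * ?c (a k) I J))"
      by (intro sum_mono sum_liminf_le_ennreal finite_multiindices_le)
    also have "\<dots> \<le> liminf (\<lambda>k. ?s (a k) N)"
      by (intro sum_liminf_le_ennreal finite_multiindices_le)
    finally show ?thesis .
  qed
  have "ennreal (1 / real (mi_fact N)) * (?s b N)\<^sup>2
    \<le> liminf (\<lambda>k. ennreal (1 / real (mi_fact N)) * (?s (a k) N)\<^sup>2)" for N
  proof -
    have "(?s b N)\<^sup>2 \<le> (liminf (\<lambda>k. ?s (a k) N))\<^sup>2" using s by (intro power_mono) auto
    also have "\<dots> = liminf (\<lambda>k. (?s (a k) N)\<^sup>2)"
      by (intro Liminf_compose_continuous_mono[symmetric] monoI power_mono continuous_on_square_ennreal) auto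
    finally show ?thesis by (subst mult[symmetric]) (auto intro: mult_left_mono)
  qed
  then show ?case
    unfolding jet_val.simps
    by (intro order_trans[OF infsum_mono_ennreal infsum_liminf_le_ennreal])
qed

section \<open>From values to seminorms\<close>

lemma enn2real_root_power:
  assumes "x < \<infinity>" "0 < k"
  shows "ennreal (root k (enn2real x) ^ k) = x"
  using assms by (simp add: less_top)

text \<open>
  A convex function that is positively homogeneous of degree \<open>k\<close> is the \<open>k\<close>-th power of a
  seminorm; this replaces the Minkowski inequality for the mixed norms defined by \<open>jet_val\<close>.
\<close>

lemma jet_val_root_triangle:
  assumes "0 < hbar" and fin: "jet_val hbar a m l R S < \<infinity>" "jet_val hbar b m l R S < \<infinity>"
  defines "k \<equiv> 2 ^ Suc m"
  shows "jet_val hbar (\<lambda>R S. a R S + b R S) m l R S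
    \<le> ennreal ((root k (enn2real (jet_val hbar a m l R S)) + root k (enn2real (jet_val hbar b m l R S))) ^ k)"
proof -
  define r s where "r = root k (enn2real (jet_val hbar a m l R S))"
    and "s = root k (enn2real (jet_val hbar b m l R S))"
  have k: "0 < k" by (simp add: k_def)
  have rs: "0 \<le> r" "0 \<le> s" by (auto simp: r_def s_def intro: real_root_ge_zero)
  have ra: "jet_val hbar a m l R S = ennreal (r ^ k)" "jet_val hbar b m l R S = ennreal (s ^ k)"
    using enn2real_root_power[OF fin(1) k] enn2real_root_power[OF fin(2) k] by (simp_all add: r_def s_def)
  \<comment> \<open>The convex weights will be in the ratio r : s and must be positive. Raising both
    numbers by e covers r = 0 and s = 0; at the end e tends to 0.\<close>
  have eps: "jet_val hbar (\<lambda>R S. a R S + b R S) m l R S \<le> ennreal ((r + s + 2 * e) ^ k)"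
    if e: "0 < e" for e
  proof -
    define r' s' where "r' = r + e" and "s' = s + e"
    have pos: "0 < r'" "0 < s'" "r \<le> r'" "s \<le> s'" using rs e by (auto simp: r'_def s'_def)
    \<comment> \<open>With this choice the k-th roots of the values of a / t and b / (1 - t) are
      both at most r' + s', and a + b is their convex combination with weights t and 1 - t.\<close>
    define t where "t = r' / (r' + s')"
    have t: "0 < t" "t < 1" "1 - t = s' / (r' + s')" using pos by (auto simp: t_def field_simps)
    have abs: "\<bar>1 / t\<bar> = 1 / t" "\<bar>1 / (1 - t)\<bar> = 1 / (1 - t)" using t(1,2) by auto
    let ?a = "\<lambda>R S. of_real (1 / t) * a R S" and ?b = "\<lambda>R S. of_real (1 / (1 - t)) * b R S"
    have "(\<lambda>R S. a R S + b R S) = (\<lambda>R S. of_real t * ?a R S + of_real (1 - t) * ?b R S)"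
    proof -
      have "complex_of_real u * (of_real (1 / u) * x) = x" if "u \<noteq> 0" for u x
        using that by simp
      then show ?thesis using t(1,2) by (metis diff_gt_0_iff_gt less_irrefl)
    qed
    then have "jet_val hbar (\<lambda>R S. a R S + b R S) m l R S
       \<le> ennreal t * jet_val hbar ?a m l R S + ennreal (1 - t) * jet_val hbar ?b m l R S"
      using jet_val_convex[OF assms(1) t(1,2), of ?a ?b] by simp
    also have "\<dots> = ennreal t * ennreal ((1 / t) ^ k * r ^ k) + ennreal (1 - t) * ennreal ((1 / (1 - t)) ^ k * s ^ k)"
      unfolding jet_val_cmult ra norm_of_real k_def[symmetric] abs
      using t(1,2) rs by (subst (1 2) ennreal_mult) auto
    also have "\<dots> = ennreal (t * ((1 / t) ^ k * r ^ k) + (1 - t) * ((1 / (1 - t)) ^ k * s ^ k))"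
      using t(1,2) rs by (intro ennreal_mult_add_mult) auto
    also have "\<dots> \<le> ennreal ((r' + s') ^ k)"
    proof (rule ennreal_leI)
      have "(1 / t) ^ k * r ^ k = (r / t) ^ k" "(1 / (1 - t)) ^ k * s ^ k = (s / (1 - t)) ^ k"
        by (simp_all add: power_divide)
      moreover have "r / t \<le> r' + s'" "s / (1 - t) \<le> r' + s'"
      proof -
        have "t * (r' + s') = r'" "(1 - t) * (r' + s') = s'"
          using pos unfolding t(3) by (simp_all add: t_def)
        then show "r / t \<le> r' + s'" "s / (1 - t) \<le> r' + s'"
          using pos t(1,2) by (simp_all add: pos_divide_le_eq mult.commute)
      qed
      moreover have "0 \<le> r / t" "0 \<le> s / (1 - t)" using rs t(1,2) by auto
      ultimately have "(1 / t) ^ k * r ^ k \<le> (r' + s') ^ k" "(1 / (1 - t)) ^ k * s ^ k \<le> (r' + s') ^ k"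
        by (auto intro: power_mono)
      then show "t * ((1 / t) ^ k * r ^ k) + (1 - t) * ((1 / (1 - t)) ^ k * s ^ k) \<le> (r' + s') ^ k"
        using t by (intro convex_bound_le) auto
    qed
    finally show ?thesis by (simp add: r'_def s'_def algebra_simps)
  qed
  have "((\<lambda>e. ennreal ((r + s + 2 * e) ^ k)) \<longlongrightarrow> ennreal ((r + s + 2 * 0) ^ k)) (at_right 0)"
    by (intro tendsto_intros)
  then have "jet_val hbar (\<lambda>R S. a R S + b R S) m l R S \<le> ennreal ((r + s + 2 * 0) ^ k)"
    by (rule tendsto_lowerbound) (use eps in \<open>auto simp: eventually_at_right_less eventually_at_filter\<close>)
  then show ?thesis by (simp add: r_def s_def)
qed

lemma jet_val_add_finite:
  assumes "0 < hbar" "jet_val hbar a m l R S < \<infinity>" "jet_val hbar b m l R S < \<infinity>"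
  shows "jet_val hbar (\<lambda>R S. a R S + b R S) m l R S < \<infinity>"
  using jet_val_root_triangle[OF assms] by (simp add: le_less_trans)

lemma jet_val_cmult_finite:
  assumes "jet_val hbar a m l R S < \<infinity>"
  shows "jet_val hbar (\<lambda>R S. c * a R S) m l R S < \<infinity>"
  using assms by (simp add: jet_val_cmult ennreal_mult_less_top)

text \<open>\<open>enn2real\<close> sends infinity to 0, so this number carries information only
  when \<open>jet_val\<close> is finite; hence the finiteness hypotheses of the triangle inequality
  and of \<open>jet_norm_le_iff\<close>.\<close>

definition jet_norm :: "real \<Rightarrow> (nat^'n \<Rightarrow> nat^'n \<Rightarrow> complex) \<Rightarrow> nat \<Rightarrow> nat \<Rightarrow> nat^'n \<Rightarrow> nat^'n \<Rightarrow> real" where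
  "jet_norm hbar a m l R S = root (2 ^ (m + 1)) (enn2real (jet_val hbar a m l R S))"

lemma jet_norm_nonneg: "0 \<le> jet_norm hbar a m l R S"
  by (simp add: jet_norm_def)

lemma jet_norm_triangle:
  assumes "0 < hbar" "jet_val hbar a m l R S < \<infinity>" "jet_val hbar b m l R S < \<infinity>"
  shows "jet_norm hbar (\<lambda>R S. a R S + b R S) m l R S \<le> jet_norm hbar a m l R S + jet_norm hbar b m l R S"
proof -
  have "enn2real (jet_val hbar (\<lambda>R S. a R S + b R S) m l R S)
    \<le> (jet_norm hbar a m l R S + jet_norm hbar b m l R S) ^ 2 ^ (m + 1)"
    using jet_val_root_triangle[OF assms] jet_norm_nonneg[of hbar a m l R S] jet_norm_nonneg[of hbar b m l R S]
    by (intro enn2real_leI) (auto simp: jet_norm_def)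
  then have "jet_norm hbar (\<lambda>R S. a R S + b R S) m l R S
    \<le> root (2 ^ (m + 1)) ((jet_norm hbar a m l R S + jet_norm hbar b m l R S) ^ 2 ^ (m + 1))"
    by (simp add: jet_norm_def)
  then show ?thesis
    by (simp add: real_root_power_cancel jet_norm_nonneg)
qed

lemma jet_norm_cmult: "jet_norm hbar (\<lambda>R S. c * a R S) m l R S = cmod c * jet_norm hbar a m l R S"
  by (simp add: jet_norm_def jet_val_cmult enn2real_mult real_root_mult real_root_power_cancel)

text \<open>Translates between the real seminorms, in which Cauchy conditions are stated, and the
  values in [0, infinity], to which Fatou's inequality applies.\<close>

lemma jet_norm_le_iff:
  assumes "jet_val hbar a m l R S < \<infinity>" "0 \<le> e"
  shows "jet_norm hbar a m l R S \<le> e \<longleftrightarrow> jet_val hbar a m l R S \<le> ennreal (e ^ 2 ^ (m + 1))"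
proof -
  have "jet_norm hbar a m l R S \<le> e \<longleftrightarrow>
      root (2 ^ (m + 1)) (enn2real (jet_val hbar a m l R S)) \<le> root (2 ^ (m + 1)) (e ^ 2 ^ (m + 1))"
    using assms by (simp add: jet_norm_def real_root_power_cancel)
  also have "\<dots> \<longleftrightarrow> enn2real (jet_val hbar a m l R S) \<le> e ^ 2 ^ (m + 1)" by simp
  also have "\<dots> \<longleftrightarrow> jet_val hbar a m l R S \<le> ennreal (e ^ 2 ^ (m + 1))"
    using assms by (metis enn2real_leI ennreal_enn2real_if ennreal_leI infinity_ennreal_def less_irrefl zero_le_power)
  finally show ?thesis .
qed

lemma jet_val_limit_bound:
  assumes "0 < hbar" "\<And>R S. (\<lambda>k. a k R S) \<longlonglongrightarrow> b R S"
    and "\<forall>\<^sub>F k in sequentially. jet_val hbar (a k) m l R S \<le> c"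
  shows "jet_val hbar b m l R S \<le> c"
proof -
  have "jet_val hbar b m l R S \<le> liminf (\<lambda>k. jet_val hbar (a k) m l R S)"
    by (rule jet_val_le_liminf[OF assms(1,2)])
  also have "\<dots> \<le> liminf (\<lambda>k. c)" by (rule Liminf_mono[OF assms(3)])
  also have "liminf (\<lambda>k. c) = c" by (rule Liminf_const) simp
  finally show ?thesis .
qed

text \<open>Keeps the single summand N of the series at S = 0. One value thus bounds the entries a R
  N for all N together, which is what a growth estimate needs.\<close>

lemma coeff_le_jet_val:
  assumes "0 < hbar"
  shows "ennreal ((2 * hbar) ^ (mi_size R + mi_size N) / real (mi_fact N) * (cmod (a R N))\<^sup>2)
    \<le> jet_val hbar a 0 l R 0"
  using le_infsum_ennreal[of N UNIV "\<lambda>N. ennreal ((2 * hbar) ^ (mi_size R + mi_size 0 + mi_size N) / real (mi_fact N)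
                     * (cmod (a R (N + 0)))\<^sup>2)"]
  by (simp add: jet_val.simps mi_size_def)

text \<open>Keeps the summand N = 0, whose factorial is 1. Here each entry has its own seminorm,
  which serves for entrywise convergence and for separating points.\<close>

lemma coeff_le_jet_norm:
  assumes "0 < hbar" "jet_val hbar a 0 l R S < \<infinity>"
  shows "sqrt ((2 * hbar) ^ (mi_size R + mi_size S)) * cmod (a R S) \<le> jet_norm hbar a 0 l R S"
proof -
  have "ennreal ((2 * hbar) ^ (mi_size R + mi_size S) * (cmod (a R S))\<^sup>2) \<le> jet_val hbar a 0 l R S"
    using le_infsum_ennreal[of 0 UNIV "\<lambda>N. ennreal ((2 * hbar) ^ (mi_size R + mi_size S + mi_size N) / real (mi_fact N)
                     * (cmod (a R (N + S)))\<^sup>2)"]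
    by (simp add: jet_val.simps mi_size_def mi_fact_def)
  then have "(2 * hbar) ^ (mi_size R + mi_size S) * (cmod (a R S))\<^sup>2 \<le> enn2real (jet_val hbar a 0 l R S)"
    using assms by (metis enn2real_ennreal enn2real_mono infinity_ennreal_def mult_nonneg_nonneg
        zero_le_power zero_le_power2 less_imp_le mult_pos_pos zero_less_numeral)
  then have "sqrt ((2 * hbar) ^ (mi_size R + mi_size S) * (cmod (a R S))\<^sup>2) \<le> sqrt (enn2real (jet_val hbar a 0 l R S))"
    by (rule real_sqrt_le_mono)
  then have "sqrt ((2 * hbar) ^ (mi_size R + mi_size S)) * cmod (a R S) \<le> sqrt (enn2real (jet_val hbar a 0 l R S))"
    by (simp add: real_sqrt_mult)
  then show ?thesis by (simp add: jet_norm_def sqrt_def)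
qed


section \<open>Smooth functions and their jets\<close>

lemma dir_deriv_eqI: "(f has_derivative f') (at x) \<Longrightarrow> dir_deriv v f x = f' v"
  by (metis dir_deriv_def frechet_derivative_at)

lemma C_infinity_differentiable: "f \<in> C_infinity \<Longrightarrow> f differentiable (at x)"
  unfolding C_infinity_def by (metis C_k.simps(2) mem_Collect_eq)

lemma C_infinity_has_derivative:
  "f \<in> C_infinity \<Longrightarrow> (f has_derivative (\<lambda>v. dir_deriv v f x)) (at x)"
  using C_infinity_differentiable[of f x] frechet_derivative_works[of f "at x"]
  by (simp add: dir_deriv_def)

lemma dir_deriv_C_infinity: "f \<in> C_infinity \<Longrightarrow> dir_deriv v f \<in> C_infinity"
proof -
  assume "f \<in> C_infinity"
  then have "C_k (Suc k) f" for k unfolding C_infinity_def by blast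
  then show "dir_deriv v f \<in> C_infinity" by (simp add: C_infinity_def)
qed

text \<open>\<open>C_infinity\<close> is the largest family of differentiable functions closed under
  \<open>dir_deriv\<close>. Smoothness is thus shown by exhibiting such a family; the induction on
  the order runs over all its members at once.\<close>

lemma C_infinity_coinduct:
  assumes "f \<in> A"
    and step: "\<And>f x. f \<in> A \<Longrightarrow> f differentiable (at x)" "\<And>f v. f \<in> A \<Longrightarrow> dir_deriv v f \<in> A"
  shows "f \<in> C_infinity"
proof -
  have "\<forall>f\<in>A. C_k k f" for k
  proof (induction k)
    case 0
    show ?case
      using step(1) by (auto intro!: continuous_at_imp_continuous_on differentiable_imp_continuous_within)
  next
    case (Suc k)
    then show ?case using step by auto
  qed
  then show ?thesis using assms(1) by (simp add: C_infinity_def)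
qed

lemma C_infinity_isCont: "f \<in> C_infinity \<Longrightarrow> isCont f x"
  by (simp add: C_infinity_differentiable differentiable_imp_continuous_within)

lemma dir_deriv_add:
  assumes "f \<in> C_infinity" "g \<in> C_infinity"
  shows "dir_deriv v (\<lambda>x. f x + g x) = (\<lambda>x. dir_deriv v f x + dir_deriv v g x)"
  by (intro ext dir_deriv_eqI has_derivative_add C_infinity_has_derivative assms)

lemma dir_deriv_bounded_linear:
  assumes "bounded_linear L" "f \<in> C_infinity"
  shows "dir_deriv v (\<lambda>x. L (f x)) = (\<lambda>x. L (dir_deriv v f x))"
  by (intro ext dir_deriv_eqI bounded_linear.has_derivative[OF assms(1)] C_infinity_has_derivative assms)

lemma C_infinity_bounded_linear:
  assumes "bounded_linear L" "f \<in> C_infinity"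
  shows "(\<lambda>x. L (f x)) \<in> C_infinity"
proof (rule C_infinity_coinduct[where A = "(\<lambda>f x. L (f x)) ` C_infinity"])
  fix g assume "g \<in> (\<lambda>f x. L (f x)) ` C_infinity"
  then obtain f where f: "f \<in> C_infinity" "g = (\<lambda>x. L (f x))" by blast
  show "g differentiable (at x)" for x
    using bounded_linear.has_derivative[OF assms(1) C_infinity_has_derivative[OF f(1)]] f(2)
    unfolding differentiable_def by blast
  show "dir_deriv v g \<in> (\<lambda>f x. L (f x)) ` C_infinity" for v
    using dir_deriv_bounded_linear[OF assms(1) f(1)] dir_deriv_C_infinity[OF f(1)] f(2) by auto
qed (use assms in auto)

lemma C_infinity_add:
  assumes "f \<in> C_infinity" "g \<in> C_infinity"
  shows "(\<lambda>x. f x + g x) \<in> C_infinity"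
proof (rule C_infinity_coinduct[where A = "{\<lambda>x. f x + g x |f g. f \<in> C_infinity \<and> g \<in> C_infinity}"])
  fix h :: "'a \<Rightarrow> 'b" assume "h \<in> {\<lambda>x. f x + g x |f g. f \<in> C_infinity \<and> g \<in> C_infinity}"
  then obtain f g where f: "f \<in> C_infinity" "g \<in> C_infinity" "h = (\<lambda>x. f x + g x)" by blast
  show "h differentiable (at x)" for x
    unfolding f(3) by (intro differentiable_add C_infinity_differentiable f)
  show "dir_deriv v h \<in> {\<lambda>x. f x + g x |f g. f \<in> C_infinity \<and> g \<in> C_infinity}" for v
    using dir_deriv_add[OF f(1,2)] dir_deriv_C_infinity f by blast
qed (use assms in auto)

lemma C_infinity_cmult:
  fixes f :: "'a::real_normed_vector \<Rightarrow> complex"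
  shows "f \<in> C_infinity \<Longrightarrow> (\<lambda>x. c * f x) \<in> C_infinity"
  by (rule C_infinity_bounded_linear[OF bounded_linear_mult_right])

lemma dir_deriv_cmult:
  fixes f :: "'a::real_normed_vector \<Rightarrow> complex"
  shows "f \<in> C_infinity \<Longrightarrow> dir_deriv v (\<lambda>x. c * f x) = (\<lambda>x. c * dir_deriv v f x)"
  by (rule dir_deriv_bounded_linear[OF bounded_linear_mult_right])

lemma C_infinity_zero: "(\<lambda>x. 0) \<in> (C_infinity :: ('a::real_normed_vector \<Rightarrow> 'b::real_normed_vector) set)"
proof (rule C_infinity_coinduct[where A = "{\<lambda>x. 0}"])
  fix f :: "'a \<Rightarrow> 'b" and v assume "f \<in> {\<lambda>x. 0}"
  then have f: "f = (\<lambda>x. 0)" by simp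
  show "dir_deriv v f \<in> {\<lambda>x. 0}"
    unfolding f using dir_deriv_eqI[OF has_derivative_const[of "0::'b"]] by auto
qed auto

section \<open>Symmetry of second derivatives\<close>

lemma has_real_derivative_along_line:
  fixes g :: "'a::real_normed_vector \<Rightarrow> real"
  assumes "g \<in> C_infinity"
  shows "((\<lambda>s. g (y + s *\<^sub>R u)) has_real_derivative dir_deriv u g (y + s *\<^sub>R u)) (at s)"
proof -
  have "((\<lambda>s. y + s *\<^sub>R u) has_derivative (\<lambda>t. t *\<^sub>R u)) (at s)"
    by (auto intro!: derivative_eq_intros)
  from has_derivative_compose[OF this C_infinity_has_derivative[OF assms]]
  have "((\<lambda>s. g (y + s *\<^sub>R u)) has_derivative (\<lambda>t. dir_deriv (t *\<^sub>R u) g (y + s *\<^sub>R u))) (at s)" .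
  moreover have "dir_deriv (t *\<^sub>R u) g z = dir_deriv u g z * t" for t z
    using linear_scale[OF has_derivative_linear[OF C_infinity_has_derivative[OF assms]], of t u z]
    by simp
  ultimately show ?thesis by (simp add: has_field_derivative_def)
qed

text \<open>Two applications of the mean value theorem: along u to the difference of g at points h v
  apart, then along v to the derivative so obtained. Real values of g give an equality instead of an
  estimate.\<close>

lemma second_difference_mvt:
  fixes g :: "'a::real_normed_vector \<Rightarrow> real"
  assumes g: "g \<in> C_infinity" and h: "0 < h"
  shows "\<exists>s t. 0 < s \<and> s < h \<and> 0 < t \<and> t < h \<and>
    g (x + h *\<^sub>R u + h *\<^sub>R v) - g (x + h *\<^sub>R u) - g (x + h *\<^sub>R v) + g x
      = h * (h * dir_deriv v (dir_deriv u g) (x + s *\<^sub>R u + t *\<^sub>R v))"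
proof -
  let ?\<phi> = "\<lambda>s. g ((x + h *\<^sub>R v) + s *\<^sub>R u) - g (x + s *\<^sub>R u)"
  have "\<exists>s>0. s < h \<and> ?\<phi> h - ?\<phi> 0 = (h - 0) * (dir_deriv u g ((x + h *\<^sub>R v) + s *\<^sub>R u) - dir_deriv u g (x + s *\<^sub>R u))"
    by (intro MVT2 h DERIV_diff has_real_derivative_along_line g)
  then obtain s where s: "0 < s" "s < h"
    "?\<phi> h - ?\<phi> 0 = h * (dir_deriv u g ((x + h *\<^sub>R v) + s *\<^sub>R u) - dir_deriv u g (x + s *\<^sub>R u))"
    by auto
  let ?\<psi> = "\<lambda>t. dir_deriv u g ((x + s *\<^sub>R u) + t *\<^sub>R v)"
  have "\<exists>t>0. t < h \<and> ?\<psi> h - ?\<psi> 0 = (h - 0) * dir_deriv v (dir_deriv u g) ((x + s *\<^sub>R u) + t *\<^sub>R v)"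
    by (intro MVT2 h has_real_derivative_along_line dir_deriv_C_infinity g)
  then obtain t where t: "0 < t" "t < h"
    "?\<psi> h - ?\<psi> 0 = h * dir_deriv v (dir_deriv u g) ((x + s *\<^sub>R u) + t *\<^sub>R v)"
    by auto
  have "?\<phi> h - ?\<phi> 0 = h * (?\<psi> h - ?\<psi> 0)" using s(3) by (simp add: add_ac)
  then have "?\<phi> h - ?\<phi> 0 = h * (h * dir_deriv v (dir_deriv u g) ((x + s *\<^sub>R u) + t *\<^sub>R v))"
    unfolding t(3) .
  then show ?thesis using s t by (intro exI[of _ s] exI[of _ t]) (auto simp: algebra_simps)
qed

text \<open>The second difference is symmetric in u and v, so the two mixed derivatives agree at a
  pair of points, both of which approach x as the step h n shrinks. Continuity of the mixed
  derivatives does the rest.\<close>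

lemma dir_deriv_commute_real:
  fixes g :: "'a::real_normed_vector \<Rightarrow> real"
  assumes g: "g \<in> C_infinity"
  shows "dir_deriv u (dir_deriv v g) x = dir_deriv v (dir_deriv u g) x"
proof -
  define h where "h n = 1 / real (Suc n)" for n
  have h: "0 < h n" for n by (simp add: h_def)
  have h0: "h \<longlonglongrightarrow> 0"
    unfolding h_def using LIMSEQ_Suc[OF lim_1_over_n[where 'a = real]] by simp
  obtain s t where st: "\<And>n. 0 < s n \<and> s n < h n \<and> 0 < t n \<and> t n < h n \<and>
    g (x + h n *\<^sub>R u + h n *\<^sub>R v) - g (x + h n *\<^sub>R u) - g (x + h n *\<^sub>R v) + g x
      = h n * (h n * dir_deriv v (dir_deriv u g) (x + s n *\<^sub>R u + t n *\<^sub>R v))"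
    using second_difference_mvt[OF g h, where x = x and u = u and v = v] by metis
  obtain s' t' where st': "\<And>n. 0 < s' n \<and> s' n < h n \<and> 0 < t' n \<and> t' n < h n \<and>
    g (x + h n *\<^sub>R v + h n *\<^sub>R u) - g (x + h n *\<^sub>R v) - g (x + h n *\<^sub>R u) + g x
      = h n * (h n * dir_deriv u (dir_deriv v g) (x + s' n *\<^sub>R v + t' n *\<^sub>R u))"
    using second_difference_mvt[OF g h, where x = x and u = v and v = u] by metis
  have eq: "dir_deriv v (dir_deriv u g) (x + s n *\<^sub>R u + t n *\<^sub>R v)
    = dir_deriv u (dir_deriv v g) (x + s' n *\<^sub>R v + t' n *\<^sub>R u)" for n
  proof -
    have sym: "x + h n *\<^sub>R v + h n *\<^sub>R u = x + h n *\<^sub>R u + h n *\<^sub>R v" by (simp add: add_ac)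
    have "g (x + h n *\<^sub>R u + h n *\<^sub>R v) - g (x + h n *\<^sub>R u) - g (x + h n *\<^sub>R v) + g x
      = h n * (h n * dir_deriv v (dir_deriv u g) (x + s n *\<^sub>R u + t n *\<^sub>R v))"
      using st by blast
    moreover have "g (x + h n *\<^sub>R u + h n *\<^sub>R v) - g (x + h n *\<^sub>R v) - g (x + h n *\<^sub>R u) + g x
      = h n * (h n * dir_deriv u (dir_deriv v g) (x + s' n *\<^sub>R v + t' n *\<^sub>R u))"
      using st'[of n] unfolding sym by blast
    ultimately have "h n * (h n * dir_deriv v (dir_deriv u g) (x + s n *\<^sub>R u + t n *\<^sub>R v))
      = h n * (h n * dir_deriv u (dir_deriv v g) (x + s' n *\<^sub>R v + t' n *\<^sub>R u))"
      by linarith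
    then show ?thesis using h[of n] by simp
  qed
  have null: "r \<longlonglongrightarrow> 0" if "\<And>n. 0 < r n \<and> r n < h n" for r
    using that by (intro tendsto_sandwich[OF _ _ tendsto_const h0] always_eventually) (auto intro: less_imp_le)
  have lim: "(\<lambda>n. D (x + r n *\<^sub>R a + r' n *\<^sub>R b)) \<longlonglongrightarrow> D x"
    if "D \<in> C_infinity" "\<And>n. 0 < r n \<and> r n < h n" "\<And>n. 0 < r' n \<and> r' n < h n"
    for D :: "'a \<Rightarrow> real" and r r' a b
  proof -
    have "(\<lambda>n. x + r n *\<^sub>R a + r' n *\<^sub>R b) \<longlonglongrightarrow> x + 0 *\<^sub>R a + 0 *\<^sub>R b"
      by (intro tendsto_intros null that)
    then show ?thesis using isCont_tendsto_compose[OF C_infinity_isCont[OF that(1)]] by simp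
  qed
  have "(\<lambda>n. dir_deriv v (dir_deriv u g) (x + s n *\<^sub>R u + t n *\<^sub>R v)) \<longlonglongrightarrow> dir_deriv v (dir_deriv u g) x"
    using st by (intro lim dir_deriv_C_infinity g) auto
  moreover have "(\<lambda>n. dir_deriv u (dir_deriv v g) (x + s' n *\<^sub>R v + t' n *\<^sub>R u)) \<longlonglongrightarrow> dir_deriv u (dir_deriv v g) x"
    using st' by (intro lim dir_deriv_C_infinity g) auto
  ultimately show ?thesis unfolding eq by (metis LIMSEQ_unique)
qed

lemma dir_deriv_commute:
  fixes f :: "'a::real_normed_vector \<Rightarrow> complex"
  assumes f: "f \<in> C_infinity"
  shows "dir_deriv u (dir_deriv v f) = dir_deriv v (dir_deriv u f)"
proof
  fix x
  have L: "L (dir_deriv u (dir_deriv v f) x) = L (dir_deriv v (dir_deriv u f) x)"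
    if L: "bounded_linear L" for L :: "complex \<Rightarrow> real"
    using dir_deriv_commute_real[OF C_infinity_bounded_linear[OF L f], of u v x]
    by (simp add: dir_deriv_bounded_linear[OF L] f dir_deriv_C_infinity)
  show "dir_deriv u (dir_deriv v f) x = dir_deriv v (dir_deriv u f) x"
    using L[OF bounded_linear_Re] L[OF bounded_linear_Im] by (rule complex_eqI)
qed

text \<open>Linearity is asked on smooth functions only, since the rules for
  \<open>dir_deriv\<close> need differentiability. The notion is stable under combinations, powers
  and folds and so reaches \<open>wirtinger R S\<close>.\<close>

definition smooth_operator ::
  "(('a::real_normed_vector \<Rightarrow> complex) \<Rightarrow> 'a \<Rightarrow> complex) \<Rightarrow> bool" where
  "smooth_operator D \<longleftrightarrow>
     (\<forall>f\<in>C_infinity. D f \<in> C_infinity) \<and>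
     (\<forall>f\<in>C_infinity. \<forall>g\<in>C_infinity. D (\<lambda>x. f x + g x) = (\<lambda>x. D f x + D g x)) \<and>
     (\<forall>f\<in>C_infinity. \<forall>c. D (\<lambda>x. c * f x) = (\<lambda>x. c * D f x))"

lemma smooth_operator_closed: "smooth_operator D \<Longrightarrow> f \<in> C_infinity \<Longrightarrow> D f \<in> C_infinity"
  and smooth_operator_add: "smooth_operator D \<Longrightarrow> f \<in> C_infinity \<Longrightarrow> g \<in> C_infinity \<Longrightarrow>
    D (\<lambda>x. f x + g x) = (\<lambda>x. D f x + D g x)"
  and smooth_operator_cmult: "smooth_operator D \<Longrightarrow> f \<in> C_infinity \<Longrightarrow>
    D (\<lambda>x. c * f x) = (\<lambda>x. c * D f x)"
  by (auto simp: smooth_operator_def)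

lemma smooth_operator_dir_deriv: "smooth_operator (dir_deriv v)"
  by (simp add: smooth_operator_def dir_deriv_C_infinity dir_deriv_add dir_deriv_cmult)

lemma smooth_operator_combination:
  assumes "smooth_operator D" "smooth_operator E"
  shows "smooth_operator (\<lambda>f x. a * D f x + b * E f x)"
  using assms unfolding smooth_operator_def
  by (auto intro!: C_infinity_add C_infinity_cmult simp: algebra_simps)

lemma smooth_operator_funpow: "smooth_operator D \<Longrightarrow> smooth_operator (D ^^ n)"
  by (induction n) (auto simp: smooth_operator_def)

lemma smooth_operator_fold:
  "(\<And>i. smooth_operator (D i)) \<Longrightarrow> smooth_operator (fold D xs)"
  by (induction xs) (auto simp: smooth_operator_def)

lemma smooth_operator_sum:
  assumes D: "smooth_operator D" and "\<And>i. i \<in> A \<Longrightarrow> f i \<in> C_infinity"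
  shows "(\<lambda>x. \<Sum>i\<in>A. c i * f i x) \<in> C_infinity \<and> D (\<lambda>x. \<Sum>i\<in>A. c i * f i x) = (\<lambda>x. \<Sum>i\<in>A. c i * D (f i) x)"
  using assms(2)
proof (induction A rule: infinite_finite_induct)
  case (insert j A)
  then show ?case
    using smooth_operator_add[OF D C_infinity_cmult, of "f j" "\<lambda>x. \<Sum>i\<in>A. c i * f i x" "c j"]
      smooth_operator_cmult[OF D, of "f j" "c j"]
    by (auto intro!: C_infinity_add C_infinity_cmult)
qed (use smooth_operator_cmult[OF D C_infinity_zero, of 0] C_infinity_zero in auto)

definition commuting ::
  "(('a::real_normed_vector \<Rightarrow> complex) \<Rightarrow> 'a \<Rightarrow> complex) \<Rightarrow> (('a \<Rightarrow> complex) \<Rightarrow> 'a \<Rightarrow> complex) \<Rightarrow> bool" where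
  "commuting D E \<longleftrightarrow> (\<forall>f\<in>C_infinity. D (E f) = E (D f))"

lemma commuting_sym: "commuting D E \<Longrightarrow> commuting E D"
  by (simp add: commuting_def)

lemma commuting_combination:
  assumes "smooth_operator D" "smooth_operator E" "smooth_operator E'" "commuting D E" "commuting D E'"
  shows "commuting D (\<lambda>f x. a * E f x + b * E' f x)"
  unfolding commuting_def
proof
  fix f :: "'a \<Rightarrow> complex" assume f: "f \<in> C_infinity"
  have C: "E f \<in> C_infinity" "E' f \<in> C_infinity"
    using f assms smooth_operator_closed by blast+
  have "D (\<lambda>x. a * E f x + b * E' f x) = (\<lambda>x. a * D (E f) x + b * D (E' f) x)"
    using smooth_operator_add[OF assms(1) C_infinity_cmult[OF C(1)] C_infinity_cmult[OF C(2)]]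
    by (simp add: smooth_operator_cmult[OF assms(1)] C)
  also have "D (E f) = E (D f)" using assms(4) f by (simp add: commuting_def)
  also have "D (E' f) = E' (D f)" using assms(5) f by (simp add: commuting_def)
  finally show "D (\<lambda>x. a * E f x + b * E' f x) = (\<lambda>x. a * E (D f) x + b * E' (D f) x)" .
qed

lemma commuting_funpow:
  assumes "smooth_operator E" "commuting D E"
  shows "commuting D (E ^^ n)"
  unfolding commuting_def
proof (induction n)
  case (Suc n)
  then show ?case
    using assms(2) smooth_operator_closed[OF smooth_operator_funpow[OF assms(1)]] by (simp add: commuting_def)
qed simp

lemma commuting_fold:
  assumes "\<And>i. smooth_operator (E i)" "\<And>i. commuting D (E i)"
  shows "commuting D (fold E xs)"
  unfolding commuting_def
proof (induction xs)
  case (Cons y ys)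
  then show ?case
    using assms smooth_operator_closed[OF assms(1)] by (simp add: commuting_def)
qed simp

text \<open>The shape \<open>a * D f x + b * E f x\<close> is the one to which the combination
  lemmas for linearity and commutation apply.\<close>

lemma d_z_eq: "d_z i = (\<lambda>f x. 1/2 * dir_deriv (axis i 1) f x + (-\<i>/2) * dir_deriv (axis i \<i>) f x)"
  and d_zbar_eq: "d_zbar i = (\<lambda>f x. 1/2 * dir_deriv (axis i 1) f x + (\<i>/2) * dir_deriv (axis i \<i>) f x)"
  by (auto simp: d_z_def d_zbar_def fun_eq_iff field_simps)

lemma smooth_operator_d_z: "smooth_operator (d_z i)"
  and smooth_operator_d_zbar: "smooth_operator (d_zbar i)"
  unfolding d_z_eq d_zbar_eq by (intro smooth_operator_combination smooth_operator_dir_deriv)+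

lemma commuting_dir_deriv: "commuting (dir_deriv u) (dir_deriv v)"
  by (simp add: commuting_def dir_deriv_commute)

lemma commuting_dir_deriv_wirtinger: "commuting (dir_deriv u) (d_z i)" "commuting (dir_deriv u) (d_zbar i)"
  unfolding d_z_eq d_zbar_eq
  by (intro commuting_combination smooth_operator_dir_deriv commuting_dir_deriv)+

lemma commuting_d_z_dir_deriv: "commuting (d_z i) (dir_deriv u)"
  and commuting_d_zbar_dir_deriv: "commuting (d_zbar i) (dir_deriv u)"
  by (rule commuting_sym, rule commuting_dir_deriv_wirtinger)+

lemma commuting_d_z: "commuting (d_z i) (d_z j)" "commuting (d_z i) (d_zbar j)"
  unfolding d_z_eq[of j] d_zbar_eq[of j]
  by (intro commuting_combination smooth_operator_d_z smooth_operator_dir_deriv commuting_d_z_dir_deriv)+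

lemma commuting_d_zbar: "commuting (d_zbar i) (d_zbar j)"
  unfolding d_zbar_eq[of j]
  by (intro commuting_combination smooth_operator_d_zbar smooth_operator_dir_deriv commuting_d_zbar_dir_deriv)

section \<open>Iterated Wirtinger derivatives\<close>

lemma distinct_coords: "distinct (coords :: 'n::finite list)"
  and set_coords: "set (coords :: 'n::finite list) = UNIV"
proof -
  have "\<exists>is :: 'n list. distinct is \<and> set is = UNIV"
    using finite_distinct_list[of "UNIV :: 'n set"] by auto
  then have "distinct (coords :: 'n list) \<and> set (coords :: 'n list) = UNIV"
    unfolding coords_def by (rule someI_ex)
  then show "distinct (coords :: 'n list)" "set (coords :: 'n list) = UNIV" by auto
qed

text \<open>An extra D j, applied first, is moved past the powers of the other operators until it
  meets the power of D j and raises its exponent by one. Distinctness of the list makes j occur only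
  once.\<close>

lemma fold_funpow_shift:
  assumes D: "\<And>i. smooth_operator (D i)" "\<And>i j. commuting (D i) (D j)"
    and "f \<in> C_infinity" "distinct xs" "j \<in> set xs"
  shows "fold (\<lambda>i. D i ^^ r i) xs (D j f) = fold (\<lambda>i. D i ^^ (r(j := Suc (r j))) i) xs f"
  using assms(3-)
proof (induction xs arbitrary: f)
  case (Cons x xs)
  show ?case
  proof (cases "x = j")
    case True
    have "fold (\<lambda>i. D i ^^ r i) xs = fold (\<lambda>i. D i ^^ (r(j := Suc (r j))) i) xs"
      using Cons.prems True by (intro ext fold_cong) auto
    then show ?thesis using True by (simp add: funpow_swap1)
  next
    case False
    have "(D x ^^ r x) (D j f) = D j ((D x ^^ r x) f)"
      using commuting_funpow[OF D(1) D(2)[of j x]] Cons.prems(1) by (simp add: commuting_def)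
    moreover have "(D x ^^ r x) f \<in> C_infinity"
      using smooth_operator_closed[OF smooth_operator_funpow[OF D(1)] Cons.prems(1)] .
    ultimately show ?thesis using Cons False by simp
  qed
qed simp

lemma multi_deriv_shift:
  assumes "\<And>i. smooth_operator (D i)" "\<And>i j. commuting (D i) (D j)" "f \<in> C_infinity"
  shows "multi_deriv D R (D j f) = multi_deriv D (R + axis j 1) f"
proof -
  have "(vec_nth R)(j := Suc (R $ j)) = vec_nth (R + axis j 1)"
    by (auto simp: axis_def)
  from fold_funpow_shift[where D = D and r = "vec_nth R" and j = j, OF assms distinct_coords, unfolded this]
  show ?thesis unfolding multi_deriv_def set_coords by simp
qed

lemma smooth_operator_multi_deriv:
  assumes "\<And>i. smooth_operator (D i)"
  shows "smooth_operator (multi_deriv D R)"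
  unfolding multi_deriv_def by (intro smooth_operator_fold smooth_operator_funpow assms)

lemma smooth_operator_wirtinger: "smooth_operator (wirtinger R S)"
  using smooth_operator_multi_deriv[of d_z R, OF smooth_operator_d_z]
    smooth_operator_multi_deriv[of d_zbar S, OF smooth_operator_d_zbar]
  unfolding wirtinger_def by (simp add: smooth_operator_def)

lemma wirtinger_d_zbar:
  "f \<in> C_infinity \<Longrightarrow> wirtinger R S (d_zbar i f) = wirtinger R (S + axis i 1) f"
  unfolding wirtinger_def by (simp add: multi_deriv_shift smooth_operator_d_zbar commuting_d_zbar)

lemma wirtinger_d_z:
  assumes "f \<in> C_infinity"
  shows "wirtinger R S (d_z i f) = wirtinger (R + axis i 1) S f"
proof -
  have "commuting (d_z i) (multi_deriv d_zbar S)"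
    unfolding multi_deriv_def
    by (intro commuting_fold commuting_funpow smooth_operator_funpow smooth_operator_d_zbar commuting_d_z)
  then have "multi_deriv d_zbar S (d_z i f) = d_z i (multi_deriv d_zbar S f)"
    using assms by (simp add: commuting_def)
  then show ?thesis
    unfolding wirtinger_def
    using smooth_operator_closed[OF smooth_operator_multi_deriv[of d_zbar, OF smooth_operator_d_zbar] assms]
      multi_deriv_shift[of d_z, OF smooth_operator_d_z commuting_d_z(1)] by auto
qed

text \<open>Expand v in the real basis of the vectors \<open>axis i 1\<close> and
  \<open>axis i \<i>\<close> and use real linearity of the derivative. This brings the real
  directional derivatives of \<open>jet_vanishes\<close> into the language of the Wirtinger
  array.\<close>

lemma dir_deriv_eq_wirtinger:
  fixes f :: "complex^'n \<Rightarrow> complex"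
  assumes "f \<in> C_infinity"
  shows "dir_deriv v f = (\<lambda>x. (\<Sum>i\<in>UNIV. v $ i * d_z i f x) + (\<Sum>i\<in>UNIV. cnj (v $ i) * d_zbar i f x))"
proof
  fix x
  interpret linear "\<lambda>v. dir_deriv v f x"
    using C_infinity_has_derivative[OF assms] by (rule has_derivative_linear)
  have "v = (\<Sum>i\<in>UNIV. Re (v $ i) *\<^sub>R axis i 1 + Im (v $ i) *\<^sub>R axis i \<i>)"
  proof (subst vec_eq_iff, intro allI)
    fix j
    have "(\<Sum>i\<in>UNIV. Re (v $ i) *\<^sub>R axis i 1 + Im (v $ i) *\<^sub>R axis i \<i>) $ j
      = (\<Sum>i\<in>UNIV. if i = j then v $ i else 0)"
      unfolding sum_component by (intro sum.cong) (auto simp: axis_def complex_eq_iff)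
    then show "v $ j = (\<Sum>i\<in>UNIV. Re (v $ i) *\<^sub>R axis i 1 + Im (v $ i) *\<^sub>R axis i \<i>) $ j" by simp
  qed
  then have "dir_deriv v f x = dir_deriv (\<Sum>i\<in>UNIV. Re (v $ i) *\<^sub>R axis i 1 + Im (v $ i) *\<^sub>R axis i \<i>) f x"
    by (rule arg_cong)
  also have "\<dots> = (\<Sum>i\<in>UNIV. of_real (Re (v $ i)) * dir_deriv (axis i 1) f x + of_real (Im (v $ i)) * dir_deriv (axis i \<i>) f x)"
    by (simp only: sum add scale) (simp add: scaleR_conv_of_real)
  also have "\<dots> = (\<Sum>i\<in>UNIV. v $ i * d_z i f x + cnj (v $ i) * d_zbar i f x)"
    by (intro sum.cong) (auto simp: d_z_def d_zbar_def complex_eq_iff field_simps)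
  finally show "dir_deriv v f x = (\<Sum>i\<in>UNIV. v $ i * d_z i f x) + (\<Sum>i\<in>UNIV. cnj (v $ i) * d_zbar i f x)"
    by (simp add: sum.distrib)
qed

text \<open>The hypothesis passes from f to \<open>dir_deriv v f\<close>, whose Wirtinger
  derivatives are linear combinations of those of f of one order higher. Hence the induction on the
  list with f arbitrary.\<close>

lemma wirtinger_zero_imp_jet_vanishes:
  fixes f :: "complex^'n \<Rightarrow> complex"
  assumes "f \<in> C_infinity" "\<And>R S. wirtinger R S f p = 0"
  shows "fold dir_deriv vs f p = 0"
  using assms
proof (induction vs arbitrary: f)
  case Nil
  have "fold (\<lambda>i. D i ^^ ((0::nat^'n) $ i)) xs f = f" for D :: "'n \<Rightarrow> (complex^'n \<Rightarrow> complex) \<Rightarrow> _" and xs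
    by (induction xs) auto
  then show ?case using Nil(2)[of 0 0] by (simp add: wirtinger_def multi_deriv_def)
next
  case (Cons v vs)
  have C: "d_z i f \<in> C_infinity" "d_zbar i f \<in> C_infinity" for i
    using smooth_operator_closed smooth_operator_d_z smooth_operator_d_zbar Cons.prems(1) by blast+
  have "wirtinger R S (dir_deriv v f) p = 0" for R S
  proof -
    let ?g = "\<lambda>x. \<Sum>i\<in>UNIV. v $ i * d_z i f x" and ?h = "\<lambda>x. \<Sum>i\<in>UNIV. cnj (v $ i) * d_zbar i f x"
    have g: "?g \<in> C_infinity \<and> wirtinger R S ?g = (\<lambda>x. \<Sum>i\<in>UNIV. v $ i * wirtinger R S (d_z i f) x)"
      by (intro smooth_operator_sum smooth_operator_wirtinger C)
    have h: "?h \<in> C_infinity \<and> wirtinger R S ?h = (\<lambda>x. \<Sum>i\<in>UNIV. cnj (v $ i) * wirtinger R S (d_zbar i f) x)"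
      by (intro smooth_operator_sum smooth_operator_wirtinger C)
    have "wirtinger R S (dir_deriv v f) = (\<lambda>x. wirtinger R S ?g x + wirtinger R S ?h x)"
      unfolding dir_deriv_eq_wirtinger[OF Cons.prems(1)]
      using g h by (intro smooth_operator_add smooth_operator_wirtinger) auto
    then show ?thesis
      using g h by (simp add: wirtinger_d_z wirtinger_d_zbar Cons.prems)
  qed
  then show ?case using Cons.IH dir_deriv_C_infinity[OF Cons.prems(1)] by simp
qed

section \<open>Flat functions\<close>

lemma flat_functions_dir_deriv: "f \<in> flat_functions p \<Longrightarrow> dir_deriv v f \<in> flat_functions p"
  unfolding flat_functions_def jet_vanishes_def
  by (auto intro: dir_deriv_C_infinity) (metis fold_simps(2))

lemma flat_functions_combination:
  assumes "f \<in> flat_functions p" "g \<in> flat_functions p"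
  shows "(\<lambda>x. a * f x + b * g x) \<in> flat_functions p"
proof -
  have "fold dir_deriv vs (\<lambda>x. a * f x + b * g x) = (\<lambda>x. a * fold dir_deriv vs f x + b * fold dir_deriv vs g x)" for vs
    using assms smooth_operator_fold[of dir_deriv vs, OF smooth_operator_dir_deriv]
    by (simp add: smooth_operator_def flat_functions_def C_infinity_cmult)
  then show ?thesis
    using assms by (auto simp: flat_functions_def jet_vanishes_def intro: C_infinity_add C_infinity_cmult)
qed

lemma flat_functions_wirtinger:
  assumes "f \<in> flat_functions p"
  shows "wirtinger R S f \<in> flat_functions p"
proof -
  have multi: "multi_deriv D R f \<in> flat_functions p"
    if D: "\<And>i f. f \<in> flat_functions p \<Longrightarrow> D i f \<in> flat_functions p" and f: "f \<in> flat_functions p" for D R f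
  proof -
    have pow: "(D i ^^ k) f \<in> flat_functions p" if "f \<in> flat_functions p" for i k f
      using that by (induction k) (auto intro: D)
    have "fold (\<lambda>i. D i ^^ (R $ i)) xs f \<in> flat_functions p" for xs
      using f by (induction xs arbitrary: f) (auto intro: pow)
    then show ?thesis by (simp add: multi_deriv_def)
  qed
  show ?thesis
    unfolding wirtinger_def d_z_eq d_zbar_eq
    by (intro multi flat_functions_combination flat_functions_dir_deriv assms)
qed

text \<open>Links the two descriptions of the jet: the quotient is defined by real directional
  derivatives, the seminorms by Wirtinger derivatives. Consequently a coset of smooth functions is
  determined by its array.\<close>

lemma flat_functions_iff:
  "f \<in> flat_functions p \<longleftrightarrow> f \<in> C_infinity \<and> (\<forall>R S. wirtinger R S f p = 0)"
proof
  assume f: "f \<in> flat_functions p"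
  have "wirtinger R S f p = 0" for R S
  proof -
    have "\<forall>vs. fold dir_deriv vs (wirtinger R S f) p = 0"
      using flat_functions_wirtinger[OF f, of R S] by (simp add: flat_functions_def jet_vanishes_def)
    from spec[OF this, of "[]"] show ?thesis by simp
  qed
  then show "f \<in> C_infinity \<and> (\<forall>R S. wirtinger R S f p = 0)"
    using f by (auto simp: flat_functions_def)
next
  assume "f \<in> C_infinity \<and> (\<forall>R S. wirtinger R S f p = 0)"
  then show "f \<in> flat_functions p"
    using wirtinger_zero_imp_jet_vanishes[of f p] by (auto simp: flat_functions_def jet_vanishes_def)
qed


section \<open>Power series in finitely many coordinate functionals\<close>

lemma summable_power_over_sqrt_fact:
  fixes x :: real
  assumes "0 \<le> x"
  shows "summable (\<lambda>k. x ^ k / sqrt (fact k))"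
proof -
  \<comment> \<open>From this index on the ratio x / sqrt (k + 1) of consecutive terms is at most
    1/2.\<close>
  define N where "N = nat \<lceil>4 * x\<^sup>2\<rceil>"
  have "norm (x ^ Suc k / sqrt (fact (Suc k))) \<le> 1/2 * norm (x ^ k / sqrt (fact k))" if "k \<ge> N" for k
  proof -
    have "4 * x\<^sup>2 \<le> real k" using that unfolding N_def by linarith
    then have "(2 * x)\<^sup>2 \<le> real (Suc k)" by (simp add: power2_eq_square)
    then have "2 * x \<le> sqrt (real (Suc k))" by (rule real_le_rsqrt)
    then have "x / sqrt (real (Suc k)) \<le> 1/2" by (simp add: field_simps)
    then have "(x / sqrt (real (Suc k))) * (x ^ k / sqrt (fact k)) \<le> 1/2 * (x ^ k / sqrt (fact k))"
      using assms by (intro mult_right_mono) auto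
    moreover have eq: "x ^ Suc k / sqrt (fact (Suc k)) = (x / sqrt (real (Suc k))) * (x ^ k / sqrt (fact k))"
      by (simp add: real_sqrt_mult)
    moreover have n: "norm (x ^ i / sqrt (fact i)) = x ^ i / sqrt (fact i)" for i
      using assms by simp
    ultimately show ?thesis unfolding n by (simp only:)
  qed
  then show ?thesis by (intro summable_ratio_test[of "1/2" N]) auto
qed

text \<open>A finite set of multiindices lies in a box, and the sum over a box factors into
  one-variable partial sums, each at most \<open>suminf u\<close>.\<close>

lemma summable_on_prod_nonneg:
  fixes u :: "nat \<Rightarrow> real"
  assumes u: "summable u" "\<And>k. 0 \<le> u k"
  shows "(\<lambda>\<alpha>::'j::finite \<Rightarrow> nat. \<Prod>j\<in>UNIV. u (\<alpha> j)) summable_on UNIV"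
proof (rule nonneg_bdd_above_summable_on)
  show "bdd_above (sum (\<lambda>\<alpha>::'j \<Rightarrow> nat. \<Prod>j\<in>UNIV. u (\<alpha> j)) ` {F. F \<subseteq> UNIV \<and> finite F})"
  proof (rule bdd_aboveI2)
    fix F :: "('j \<Rightarrow> nat) set" assume "F \<in> {F. F \<subseteq> UNIV \<and> finite F}"
    then have F: "finite F" by simp
    define K where "K = Max (insert 0 ((\<lambda>(\<alpha>, j). \<alpha> j) ` (F \<times> UNIV)))"
    have "\<alpha> j \<le> K" if "\<alpha> \<in> F" for \<alpha> j
      unfolding K_def using F that by (intro Max_ge) auto
    then have sub: "F \<subseteq> PiE UNIV (\<lambda>_. {..K})" by auto
    have "(\<Sum>\<alpha>\<in>F. \<Prod>j\<in>UNIV. u (\<alpha> j)) \<le> (\<Sum>\<alpha>\<in>PiE (UNIV::'j set) (\<lambda>_. {..K}). \<Prod>j\<in>UNIV. u (\<alpha> j))"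
      by (intro sum_mono2 finite_PiE prod_nonneg) (use sub u(2) in auto)
    also have "\<dots> = (\<Prod>j\<in>(UNIV::'j set). \<Sum>k\<le>K. u k)"
      by (rule prod_sum_PiE[symmetric]) auto
    also have "\<dots> \<le> (\<Prod>j\<in>(UNIV::'j set). suminf u)"
      using u by (intro prod_mono conjI sum_nonneg sum_le_suminf) auto
    finally show "(\<Sum>\<alpha>\<in>F. \<Prod>j\<in>UNIV. u (\<alpha> j)) \<le> (\<Prod>j\<in>(UNIV::'j set). suminf u)" .
  qed
qed (use u(2) in \<open>auto intro: prod_nonneg\<close>)

text \<open>Here b \<alpha> plays the part of a derivative of order \<alpha>, to be divided by
  \<alpha>! in the series. Growth like q^|\<alpha>| * sqrt (\<alpha>!) is slow enough for
  convergence everywhere, is what the seminorms provide, and is preserved by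
  differentiation.\<close>

definition moderate :: "(('j::finite \<Rightarrow> nat) \<Rightarrow> complex) \<Rightarrow> bool" where
  "moderate b \<longleftrightarrow> (\<exists>C q. 0 \<le> C \<and> 0 \<le> q \<and>
     (\<forall>\<alpha>. cmod (b \<alpha>) \<le> C * (\<Prod>j\<in>UNIV. q ^ \<alpha> j * sqrt (fact (\<alpha> j)))))"

text \<open>The effect on the coefficients of differentiating the series with respect to coordinate
  j; no factor appears because of the division by \<alpha>!.\<close>

definition shift :: "'j \<Rightarrow> (('j \<Rightarrow> nat) \<Rightarrow> 'c) \<Rightarrow> ('j \<Rightarrow> nat) \<Rightarrow> 'c" where
  "shift j b = (\<lambda>\<alpha>. b (\<alpha>(j := Suc (\<alpha> j))))"

lemma moderate_add:
  assumes "moderate b" "moderate c"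
  shows "moderate (\<lambda>\<alpha>. b \<alpha> + c \<alpha>)"
proof -
  obtain C q where b: "0 \<le> C" "0 \<le> q" "\<And>\<alpha>. cmod (b \<alpha>) \<le> C * (\<Prod>j\<in>UNIV. q ^ \<alpha> j * sqrt (fact (\<alpha> j)))"
    using assms(1) unfolding moderate_def by blast
  obtain C' q' where c: "0 \<le> C'" "0 \<le> q'" "\<And>\<alpha>. cmod (c \<alpha>) \<le> C' * (\<Prod>j\<in>UNIV. q' ^ \<alpha> j * sqrt (fact (\<alpha> j)))"
    using assms(2) unfolding moderate_def by blast
  let ?P = "\<lambda>q \<alpha>. \<Prod>j\<in>UNIV. q ^ \<alpha> j * sqrt (fact (\<alpha> j))"
  have "cmod (b \<alpha> + c \<alpha>) \<le> (C + C') * ?P (max q q') \<alpha>" for \<alpha>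
  proof -
    have "?P q \<alpha> \<le> ?P (max q q') \<alpha>" "?P q' \<alpha> \<le> ?P (max q q') \<alpha>"
      using b(2) c(2) by (auto intro!: prod_mono mult_right_mono power_mono)
    then have "C * ?P q \<alpha> + C' * ?P q' \<alpha> \<le> C * ?P (max q q') \<alpha> + C' * ?P (max q q') \<alpha>"
      using b(1) c(1) by (intro add_mono mult_left_mono) auto
    moreover have "cmod (b \<alpha> + c \<alpha>) \<le> cmod (b \<alpha>) + cmod (c \<alpha>)" by (rule norm_triangle_ineq)
    ultimately show ?thesis using b(3)[of \<alpha>] c(3)[of \<alpha>] by (simp add: distrib_right)
  qed
  then show ?thesis
    unfolding moderate_def using b c by (intro exI[of _ "C + C'"] exI[of _ "max q q'"]) auto
qed

lemma moderate_cmult: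
  assumes "moderate b"
  shows "moderate (\<lambda>\<alpha>. c * b \<alpha>)"
proof -
  obtain C q where b: "0 \<le> C" "0 \<le> q" "\<And>\<alpha>. cmod (b \<alpha>) \<le> C * (\<Prod>j\<in>UNIV. q ^ \<alpha> j * sqrt (fact (\<alpha> j)))"
    using assms unfolding moderate_def by blast
  have "cmod (c * b \<alpha>) \<le> (cmod c * C) * (\<Prod>j\<in>UNIV. q ^ \<alpha> j * sqrt (fact (\<alpha> j)))" for \<alpha>
    using mult_left_mono[OF b(3)[of \<alpha>], of "cmod c"] by (simp add: norm_mult mult.assoc)
  then show ?thesis
    unfolding moderate_def using b(1,2) by (intro exI[of _ "cmod c * C"] exI[of _ q]) auto
qed

lemma moderate_sum:
  "(\<And>i. i \<in> A \<Longrightarrow> moderate (b i)) \<Longrightarrow> moderate (\<lambda>\<alpha>. \<Sum>i\<in>A. c i * b i \<alpha>)"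
proof (induction A rule: infinite_finite_induct)
  case (insert i A)
  then show ?case by (simp add: moderate_add moderate_cmult)
qed (auto simp: moderate_def intro!: exI[of _ "0::real"])

text \<open>Raising one exponent costs a factor q * sqrt (k + 1), and sqrt (k + 1) \<le> 2^k. The
  power of 2 is absorbed by replacing q with 2 * q, the remaining q by the constant C.\<close>

lemma moderate_shift:
  assumes "moderate b"
  shows "moderate (shift j b)"
proof -
  obtain C q where b: "0 \<le> C" "0 \<le> q" "\<And>\<alpha>. cmod (b \<alpha>) \<le> C * (\<Prod>j\<in>UNIV. q ^ \<alpha> j * sqrt (fact (\<alpha> j)))"
    using assms unfolding moderate_def by blast
  let ?f = "\<lambda>q k. q ^ k * sqrt (fact k)"
  have "cmod (shift j b \<alpha>) \<le> (C * q) * (\<Prod>i\<in>UNIV. ?f (2 * q) (\<alpha> i))" for \<alpha>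
  proof -
    let ?\<beta> = "\<alpha>(j := Suc (\<alpha> j))"
    have fk: "?f q k \<le> ?f (2 * q) k" for k
      using b(2) by (intro mult_right_mono power_mono) auto
    have "sqrt (real (Suc k)) \<le> 2 ^ k" for k
    proof (rule real_le_lsqrt)
      have "Suc k \<le> 2 ^ k" by (simp add: Suc_leI)
      also have "\<dots> \<le> (2 ^ k)\<^sup>2" by (simp add: power2_eq_square)
      finally show "real (Suc k) \<le> (2 ^ k)\<^sup>2" by (metis of_nat_le_iff of_nat_numeral of_nat_power)
    qed auto
    then have fS: "?f q (Suc k) \<le> q * ?f (2 * q) k" for k
    proof -
      have "?f q (Suc k) = (q * (q ^ k * sqrt (fact k))) * sqrt (real (Suc k))"
        by (simp add: real_sqrt_mult)
      also have "\<dots> \<le> (q * (q ^ k * sqrt (fact k))) * 2 ^ k"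
        using b(2) \<open>\<And>k. sqrt (real (Suc k)) \<le> 2 ^ k\<close> by (intro mult_left_mono) auto
      finally show ?thesis by (simp add: power_mult_distrib mult_ac)
    qed
    have "?f q (?\<beta> j) * (\<Prod>i\<in>UNIV - {j}. ?f q (?\<beta> i)) \<le> (q * ?f (2 * q) (\<alpha> j)) * (\<Prod>i\<in>UNIV - {j}. ?f (2 * q) (\<alpha> i))"
    proof (rule mult_mono)
      show "?f q (?\<beta> j) \<le> q * ?f (2 * q) (\<alpha> j)" using fS[of "\<alpha> j"] by (simp only: fun_upd_same)
      show "(\<Prod>i\<in>UNIV - {j}. ?f q (?\<beta> i)) \<le> (\<Prod>i\<in>UNIV - {j}. ?f (2 * q) (\<alpha> i))"
        by (rule prod_mono) (use fk b(2) in auto)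
    qed (use b(2) in \<open>auto intro!: prod_nonneg mult_nonneg_nonneg\<close>)
    then have "(\<Prod>i\<in>UNIV. ?f q (?\<beta> i)) \<le> q * (\<Prod>i\<in>UNIV. ?f (2 * q) (\<alpha> i))"
      using prod.remove[of UNIV j "\<lambda>i. ?f q (?\<beta> i)"] prod.remove[of UNIV j "\<lambda>i. ?f (2 * q) (\<alpha> i)"]
      by (simp add: mult.assoc)
    then have "C * (\<Prod>i\<in>UNIV. ?f q (?\<beta> i)) \<le> C * (q * (\<Prod>i\<in>UNIV. ?f (2 * q) (\<alpha> i)))"
      using b(1) by (rule mult_left_mono)
    then show ?thesis unfolding shift_def using b(3)[of ?\<beta>] by (simp add: mult.assoc)
  qed
  then show ?thesis
    unfolding moderate_def using b(1,2) by (intro exI[of _ "C * q"] exI[of _ "2 * q"]) auto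
qed

text \<open>The majorant is a product of the one-variable terms (q r)^k / sqrt (k!). It will serve
  for all points at distance at most r from the centre.\<close>

lemma summable_on_moderate:
  assumes "moderate b" "0 \<le> r"
  shows "(\<lambda>\<alpha>. cmod (b \<alpha>) * (\<Prod>j\<in>UNIV. r ^ \<alpha> j / fact (\<alpha> j))) summable_on UNIV"
proof -
  obtain C q where b: "0 \<le> C" "0 \<le> q" "\<And>\<alpha>. cmod (b \<alpha>) \<le> C * (\<Prod>j\<in>UNIV. q ^ \<alpha> j * sqrt (fact (\<alpha> j)))"
    using assms unfolding moderate_def by blast
  let ?g = "\<lambda>\<alpha>::'a \<Rightarrow> nat. C * (\<Prod>j\<in>UNIV. (q * r) ^ \<alpha> j / sqrt (fact (\<alpha> j)))"
  have "?g summable_on UNIV"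
    using b assms summable_on_prod_nonneg[of "\<lambda>k. (q * r) ^ k / sqrt (fact k)"]
    by (intro summable_on_cmult_right) (simp add: summable_power_over_sqrt_fact)
  then show ?thesis
  proof (rule summable_on_comparison_test)
    fix \<alpha> :: "'a \<Rightarrow> nat"
    have "cmod (b \<alpha>) * (\<Prod>j\<in>UNIV. r ^ \<alpha> j / fact (\<alpha> j))
      \<le> (C * (\<Prod>j\<in>UNIV. q ^ \<alpha> j * sqrt (fact (\<alpha> j)))) * (\<Prod>j\<in>UNIV. r ^ \<alpha> j / fact (\<alpha> j))"
      using assms(2) b(3) by (intro mult_right_mono prod_nonneg) auto
    also have "\<dots> = C * (\<Prod>j\<in>UNIV. (q ^ \<alpha> j * sqrt (fact (\<alpha> j))) * (r ^ \<alpha> j / fact (\<alpha> j)))"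
      by (simp only: prod.distrib mult.assoc)
    also have "(\<lambda>j. (q ^ \<alpha> j * sqrt (fact (\<alpha> j))) * (r ^ \<alpha> j / fact (\<alpha> j)))
      = (\<lambda>j. (q * r) ^ \<alpha> j / sqrt (fact (\<alpha> j)))"
    proof
      fix j
      have "sqrt (fact (\<alpha> j)) * sqrt (fact (\<alpha> j)) = (fact (\<alpha> j) :: real)" by simp
      then show "(q ^ \<alpha> j * sqrt (fact (\<alpha> j))) * (r ^ \<alpha> j / fact (\<alpha> j)) = (q * r) ^ \<alpha> j / sqrt (fact (\<alpha> j))"
        by (simp add: power_mult_distrib divide_simps)
    qed
    finally show "cmod (b \<alpha>) * (\<Prod>j\<in>UNIV. r ^ \<alpha> j / fact (\<alpha> j)) \<le> ?g \<alpha>" .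
    show "0 \<le> cmod (b \<alpha>) * (\<Prod>j\<in>UNIV. r ^ \<alpha> j / fact (\<alpha> j))"
      using assms(2) by (auto intro!: mult_nonneg_nonneg prod_nonneg)
  qed
qed

section \<open>Power series and their termwise derivatives\<close>

lemma has_sum_sum_finite:
  fixes f :: "'i \<Rightarrow> 'k \<Rightarrow> 'c::topological_comm_monoid_add"
  assumes "\<And>i. i \<in> A \<Longrightarrow> (f i has_sum s i) B" "finite A"
  shows "((\<lambda>x. \<Sum>i\<in>A. f i x) has_sum (\<Sum>i\<in>A. s i)) B"
  using assms(2,1) by (induction A) (auto intro!: has_sum_add)

text \<open>Reindexes a differentiated series by the exponent before differentiation. Terms without
  coordinate j have derivative 0, whence the zeros at \<alpha> j = 0.\<close>

lemma has_sum_shift: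
  fixes v :: "('j \<Rightarrow> nat) \<Rightarrow> 'c::{comm_monoid_add, topological_space}"
  assumes "(v has_sum s) UNIV"
  shows "((\<lambda>\<alpha>. if \<alpha> j = 0 then 0 else v (\<alpha>(j := \<alpha> j - 1))) has_sum s) UNIV"
proof -
  have bij: "bij_betw (\<lambda>\<alpha>. \<alpha>(j := \<alpha> j - 1)) {\<alpha>. \<alpha> j \<noteq> (0::nat)} UNIV"
    by (rule bij_betwI[where g = "\<lambda>\<alpha>. \<alpha>(j := Suc (\<alpha> j))"]) (auto simp: fun_eq_iff)
  have "((\<lambda>\<alpha>. v (\<alpha>(j := \<alpha> j - 1))) has_sum s) {\<alpha>. \<alpha> j \<noteq> 0}"
    using has_sum_reindex_bij_betw[OF bij] assms by blast
  then show ?thesis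
    by (rule has_sum_cong_neutral[THEN iffD1, rotated -1]) auto
qed

text \<open>Meant for the 2n functions z_i and their conjugates. As complex-valued functionals that
  are only real-linear they stand on an equal footing, so a series in z and its conjugate is an
  ordinary power series in 2n coordinates. The bound by 1 lets powers of norm (x - p) majorize all
  monomials.\<close>

locale coordinate_functionals =
  fixes \<zeta> :: "'j::finite \<Rightarrow> 'a::real_normed_vector \<Rightarrow> complex" and p :: 'a
  assumes bounded_linear_\<zeta>: "bounded_linear (\<zeta> j)"
    and norm_\<zeta>_le: "cmod (\<zeta> j w) \<le> norm w"
begin

definition term_at :: "(('j \<Rightarrow> nat) \<Rightarrow> complex) \<Rightarrow> ('j \<Rightarrow> nat) \<Rightarrow> 'a \<Rightarrow> complex" where
  "term_at b \<alpha> x = b \<alpha> * (\<Prod>j\<in>UNIV. \<zeta> j (x - p) ^ \<alpha> j / fact (\<alpha> j))"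

definition power_series :: "(('j \<Rightarrow> nat) \<Rightarrow> complex) \<Rightarrow> 'a \<Rightarrow> complex" where
  "power_series b x = (\<Sum>\<^sub>\<infinity>\<alpha>. term_at b \<alpha> x)"

lemma norm_term_at_le:
  assumes "norm (x - p) \<le> r"
  shows "cmod (term_at b \<alpha> x) \<le> cmod (b \<alpha>) * (\<Prod>j\<in>UNIV. r ^ \<alpha> j / fact (\<alpha> j))"
  unfolding term_at_def norm_mult prod_norm[symmetric]
  by (intro mult_left_mono prod_mono)
    (auto simp: norm_divide norm_power intro!: divide_right_mono power_mono order_trans[OF norm_\<zeta>_le assms])

lemma term_at_abs_summable:
  assumes "moderate b"
  shows "(\<lambda>\<alpha>. term_at b \<alpha> x) summable_on UNIV"
  using summable_on_moderate[OF assms, of "norm (x - p)"]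
  by (rule abs_summable_summable[OF summable_on_comparison_test]) (use norm_term_at_le in auto)

lemma power_series_has_sum:
  "moderate b \<Longrightarrow> ((\<lambda>\<alpha>. term_at b \<alpha> x) has_sum power_series b x) UNIV"
  unfolding power_series_def by (intro has_sum_infsum term_at_abs_summable)

text \<open>The derivative of the term \<alpha> with respect to coordinate j, still indexed by
  \<alpha> so that the series can be differentiated term by term.\<close>

definition partial_term :: "'j \<Rightarrow> (('j \<Rightarrow> nat) \<Rightarrow> complex) \<Rightarrow> ('j \<Rightarrow> nat) \<Rightarrow> 'a \<Rightarrow> complex" where
  "partial_term j b \<alpha> x = (if \<alpha> j = 0 then 0 else term_at (shift j b) (\<alpha>(j := \<alpha> j - 1)) x)"

lemma has_derivative_normalized_power:
  "((\<lambda>x. \<zeta> j (x - p) ^ k / fact k) has_derivative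
     (\<lambda>h. \<zeta> j h * (if k = 0 then 0 else \<zeta> j (x - p) ^ (k - 1) / fact (k - 1)))) (at x)"
proof (cases k)
  case (Suc n)
  have "((\<lambda>x. \<zeta> j (x - p)) has_derivative (\<lambda>h. \<zeta> j h)) (at x)"
    by (rule bounded_linear.has_derivative[OF bounded_linear_\<zeta>]) (auto intro!: derivative_eq_intros)
  then have "((\<lambda>x. \<zeta> j (x - p) ^ k / fact k) has_derivative
    (\<lambda>h. (of_nat k * (\<zeta> j h) * \<zeta> j (x - p) ^ (k - 1)) / fact k)) (at x)"
    by (auto intro!: derivative_eq_intros simp: mult_ac)
  moreover have "(of_nat k * z * w) / fact k = z * (w / fact (k - 1))" for z w :: complex
    unfolding Suc by (simp add: divide_simps del: of_nat_Suc)
  ultimately show ?thesis using Suc by simp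
qed simp

lemma has_derivative_term_at:
  "(term_at b \<alpha> has_derivative (\<lambda>h. \<Sum>j\<in>UNIV. \<zeta> j h * partial_term j b \<alpha> x)) (at x)"
proof -
  let ?m = "\<lambda>j k. \<zeta> j (x - p) ^ k / fact k"
  let ?d = "\<lambda>j. if \<alpha> j = 0 then 0 else ?m j (\<alpha> j - 1)"
  have "((\<lambda>x. b \<alpha> * (\<Prod>j\<in>UNIV. \<zeta> j (x - p) ^ \<alpha> j / fact (\<alpha> j))) has_derivative
    (\<lambda>h. b \<alpha> * (\<Sum>j\<in>UNIV. (\<zeta> j h * ?d j) * (\<Prod>i\<in>UNIV - {j}. ?m i (\<alpha> i))))) (at x)"
    by (intro has_derivative_mult_right has_derivative_prod has_derivative_normalized_power)
  moreover have pt: "b \<alpha> * (?d j * (\<Prod>i\<in>UNIV - {j}. ?m i (\<alpha> i))) = partial_term j b \<alpha> x" for j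
  proof (cases "\<alpha> j = 0")
    case False
    let ?\<beta> = "\<alpha>(j := \<alpha> j - 1)"
    have "(\<Prod>i\<in>UNIV. ?m i (?\<beta> i)) = ?m j (\<alpha> j - 1) * (\<Prod>i\<in>UNIV - {j}. ?m i (\<alpha> i))"
      using prod.remove[of UNIV j "\<lambda>i. ?m i (?\<beta> i)"] by simp
    then show ?thesis using False by (simp add: partial_term_def term_at_def shift_def)
  qed (simp add: partial_term_def)
  then have "b \<alpha> * (\<Sum>j\<in>UNIV. (\<zeta> j h * ?d j) * (\<Prod>i\<in>UNIV - {j}. ?m i (\<alpha> i)))
    = (\<Sum>j\<in>UNIV. \<zeta> j h * partial_term j b \<alpha> x)" for h
    unfolding sum_distrib_left
    by (intro sum.cong refl) (simp only: pt[symmetric] mult.assoc mult.left_commute)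
  ultimately show ?thesis unfolding term_at_def[abs_def] by simp
qed

text \<open>The M-test and the theorem on differentiating a series concern series over
  \<open>nat\<close>, so the multiindices are enumerated; unconditional summability makes the order
  irrelevant.\<close>

lemma bij_enumeration: "bij_betw (from_nat_into UNIV) UNIV (UNIV :: ('j \<Rightarrow> nat) set)"
proof (rule bij_betw_from_nat_into)
  have "countable (PiE UNIV (\<lambda>_. UNIV) :: ('j \<Rightarrow> nat) set)" by (intro countable_PiE) auto
  then show "countable (UNIV :: ('j \<Rightarrow> nat) set)" by simp
  have "inj (\<lambda>k::nat. \<lambda>_::'j. k)" by (auto simp: inj_def fun_eq_iff)
  then show "infinite (UNIV :: ('j \<Rightarrow> nat) set)"
    using infinite_UNIV_nat finite_imageD finite_subset subset_UNIV by metis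
qed

text \<open>Termwise differentiation on a ball about p whose radius exceeds norm (x - p) by 1, so
  that x is an interior point. For each j the differentiated series converges uniformly there by the
  M-test, with the majorant of \<open>summable_on_moderate\<close> at that radius.\<close>

lemma power_series_has_derivative:
  assumes b: "moderate b"
  shows "(power_series b has_derivative (\<lambda>h. \<Sum>j\<in>UNIV. \<zeta> j h * power_series (shift j b) x)) (at x)"
proof -
  define r where "r = norm (x - p) + 1"
  have r: "0 \<le> r" by (simp add: r_def add_nonneg_nonneg)
  let ?S = "ball p r"
  let ?e = "from_nat_into UNIV :: nat \<Rightarrow> 'j \<Rightarrow> nat"
  have xS: "x \<in> ?S" by (simp add: r_def dist_norm norm_minus_commute)
  have sums_enum: "(\<lambda>n. v (?e n)) sums s" if "(v has_sum s) UNIV" for v and s :: "'c::real_normed_vector"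
    using has_sum_imp_sums has_sum_reindex_bij_betw[OF bij_enumeration] that by blast
  have partial_sum: "((\<lambda>\<alpha>. partial_term j b \<alpha> y) has_sum power_series (shift j b) y) UNIV" for j y
    unfolding partial_term_def by (intro has_sum_shift power_series_has_sum moderate_shift b)
  let ?M = "\<lambda>j \<alpha>. if \<alpha> j = 0 then 0
     else cmod (shift j b (\<alpha>(j := \<alpha> j - 1))) * (\<Prod>i\<in>UNIV. r ^ (\<alpha>(j := \<alpha> j - 1)) i / fact ((\<alpha>(j := \<alpha> j - 1)) i))"
  have unif: "uniform_limit ?S (\<lambda>n y. \<Sum>i<n. partial_term j b (?e i) y) (power_series (shift j b)) sequentially" for j
  proof -
    have "uniform_limit ?S (\<lambda>n y. \<Sum>i<n. partial_term j b (?e i) y) (\<lambda>y. \<Sum>i. partial_term j b (?e i) y) sequentially"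
    proof (rule Weierstrass_m_test[where M = "\<lambda>n. ?M j (?e n)"])
      fix n y assume "y \<in> ?S"
      then have "norm (y - p) \<le> r" by (simp add: dist_norm norm_minus_commute)
      show "norm (partial_term j b (?e n) y) \<le> ?M j (?e n)"
      proof (cases "?e n j = 0")
        case False
        show ?thesis
          unfolding partial_term_def if_not_P[OF False] by (rule norm_term_at_le) fact
      qed (simp add: partial_term_def)
    next
      show "summable (\<lambda>n. ?M j (?e n))"
        using sums_enum[OF has_sum_shift[OF has_sum_infsum[OF summable_on_moderate[OF moderate_shift[OF b] r]]]]
        by (rule sums_summable)
    qed
    also have "(\<lambda>y. \<Sum>i. partial_term j b (?e i) y) = power_series (shift j b)"
      using sums_enum[OF partial_sum] by (auto simp: sums_iff)
    finally show ?thesis .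
  qed
  have "\<exists>g. \<forall>y\<in>?S. (\<lambda>n. term_at b (?e n) y) sums g y \<and>
      (g has_derivative (\<lambda>h. \<Sum>j\<in>UNIV. \<zeta> j h * power_series (shift j b) y)) (at y within ?S)"
  proof (rule has_derivative_series[OF convex_ball _ _ xS])
    show "(term_at b (?e n) has_derivative (\<lambda>h. \<Sum>j\<in>UNIV. \<zeta> j h * partial_term j b (?e n) y)) (at y within ?S)" for n y
      using has_derivative_term_at has_derivative_at_withinI by blast
    show "(\<lambda>n. term_at b (?e n) x) sums power_series b x"
      by (rule sums_enum[OF power_series_has_sum[OF b]])
    fix \<epsilon> :: real assume \<epsilon>: "0 < \<epsilon>"
    \<comment> \<open>The error of the derivative is a sum over the coordinates, each contributing
      at most \<delta> * norm h.\<close>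
    define \<delta> where "\<delta> = \<epsilon> / real CARD('j)"
    have \<delta>: "0 < \<delta>" using \<epsilon> by (simp add: \<delta>_def)
    have "\<forall>\<^sub>F n in sequentially. \<forall>j\<in>UNIV. \<forall>y\<in>?S. dist (\<Sum>i<n. partial_term j b (?e i) y) (power_series (shift j b) y) < \<delta>"
      using uniform_limitD[OF unif \<delta>] by (intro eventually_ball_finite) auto
    then show "\<forall>\<^sub>F n in sequentially. \<forall>y\<in>?S. \<forall>h.
        norm ((\<Sum>i<n. \<Sum>j\<in>UNIV. \<zeta> j h * partial_term j b (?e i) y) - (\<Sum>j\<in>UNIV. \<zeta> j h * power_series (shift j b) y)) \<le> \<epsilon> * norm h"
    proof eventually_elim
      case (elim n)
      show ?case
      proof (intro ballI allI)
        fix y h assume y: "y \<in> ?S"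
        let ?D = "\<lambda>j. (\<Sum>i<n. partial_term j b (?e i) y) - power_series (shift j b) y"
        have "(\<Sum>i<n. \<Sum>j\<in>UNIV. \<zeta> j h * partial_term j b (?e i) y) - (\<Sum>j\<in>UNIV. \<zeta> j h * power_series (shift j b) y)
          = (\<Sum>j\<in>UNIV. \<zeta> j h * ?D j)"
          by (subst sum.swap) (simp add: sum_subtractf sum_distrib_left right_diff_distrib)
        also have "norm \<dots> \<le> (\<Sum>j\<in>(UNIV::'j set). norm h * \<delta>)"
        proof (rule sum_norm_le)
          fix j
          have "norm (?D j) \<le> \<delta>" using elim y by (auto simp: dist_norm intro: less_imp_le)
          then show "norm (\<zeta> j h * ?D j) \<le> norm h * \<delta>"
            unfolding norm_mult by (intro mult_mono norm_\<zeta>_le) auto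
        qed
        also have "\<dots> = \<epsilon> * norm h" by (simp add: \<delta>_def)
        finally show "norm ((\<Sum>i<n. \<Sum>j\<in>UNIV. \<zeta> j h * partial_term j b (?e i) y) - (\<Sum>j\<in>UNIV. \<zeta> j h * power_series (shift j b) y)) \<le> \<epsilon> * norm h" .
      qed
    qed
  qed
  then obtain g where g: "\<And>y. y \<in> ?S \<Longrightarrow> (\<lambda>n. term_at b (?e n) y) sums g y"
    "(g has_derivative (\<lambda>h. \<Sum>j\<in>UNIV. \<zeta> j h * power_series (shift j b) x)) (at x within ?S)"
    using xS by blast
  have "g y = power_series b y" if "y \<in> ?S" for y
    using sums_unique2[OF g(1)[OF that] sums_enum[OF power_series_has_sum[OF b]]] .
  then have "(power_series b has_derivative (\<lambda>h. \<Sum>j\<in>UNIV. \<zeta> j h * power_series (shift j b) x)) (at x within ?S)"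
    by (intro has_derivative_transform[OF xS _ g(2)]) auto
  then show ?thesis using at_within_open[OF xS open_ball] by simp
qed

lemma power_series_sum:
  assumes "\<And>i. i \<in> A \<Longrightarrow> moderate (b i)" "finite A"
  shows "power_series (\<lambda>\<alpha>. \<Sum>i\<in>A. c i * b i \<alpha>) x = (\<Sum>i\<in>A. c i * power_series (b i) x)"
proof -
  have "((\<lambda>\<alpha>. \<Sum>i\<in>A. c i * term_at (b i) \<alpha> x) has_sum (\<Sum>i\<in>A. c i * power_series (b i) x)) UNIV"
    using assms by (intro has_sum_sum_finite has_sum_cmult_right power_series_has_sum)
  moreover have "(\<lambda>\<alpha>. \<Sum>i\<in>A. c i * term_at (b i) \<alpha> x) = (\<lambda>\<alpha>. term_at (\<lambda>\<alpha>. \<Sum>i\<in>A. c i * b i \<alpha>) \<alpha> x)"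
    by (auto simp: term_at_def sum_distrib_right mult.assoc)
  ultimately show ?thesis unfolding power_series_def by (simp add: infsumI)
qed

lemma dir_deriv_power_series:
  assumes "moderate b"
  shows "dir_deriv v (power_series b) = power_series (\<lambda>\<alpha>. \<Sum>j\<in>UNIV. \<zeta> j v * shift j b \<alpha>)"
proof
  fix x
  show "dir_deriv v (power_series b) x = power_series (\<lambda>\<alpha>. \<Sum>j\<in>UNIV. \<zeta> j v * shift j b \<alpha>) x"
    using dir_deriv_eqI[OF power_series_has_derivative[OF assms], of v x]
    by (simp add: power_series_sum moderate_shift assms)
qed

text \<open>The series with moderate coefficients form a family closed under
  \<open>dir_deriv\<close>: the new coefficients are linear combinations of shifts and hence
  moderate again.\<close>

lemma power_series_C_infinity:
  assumes "moderate b"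
  shows "power_series b \<in> C_infinity"
proof (rule C_infinity_coinduct[where A = "power_series ` {b. moderate b}"])
  fix f :: "'a \<Rightarrow> complex" assume "f \<in> power_series ` {b. moderate b}"
  then obtain b where b: "moderate b" "f = power_series b" by blast
  show "f differentiable (at x)" for x
    using power_series_has_derivative[OF b(1)] b(2) unfolding differentiable_def by blast
  show "dir_deriv v f \<in> power_series ` {b. moderate b}" for v
    unfolding b(2) dir_deriv_power_series[OF b(1)]
    by (intro imageI CollectI moderate_sum moderate_shift b(1))
qed (use assms in auto)

lemma power_series_at_centre: "power_series b p = b (\<lambda>_. 0)"
proof -
  have "term_at b \<alpha> p = (if \<alpha> = (\<lambda>_. 0) then b \<alpha> else 0)" for \<alpha>
  proof (cases "\<alpha> = (\<lambda>_. 0)")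
    case False
    then obtain j where "\<alpha> j \<noteq> 0" by auto
    moreover have "\<zeta> j 0 = 0" using bounded_linear_\<zeta> by (rule linear_simps(3))
    ultimately have "(\<Prod>j\<in>UNIV. \<zeta> j (p - p) ^ \<alpha> j / fact (\<alpha> j)) = 0"
      by (intro prod_zero bexI[of _ j]) auto
    then show ?thesis using False by (simp add: term_at_def)
  qed (simp add: term_at_def)
  then have "power_series b p = (\<Sum>\<^sub>\<infinity>\<alpha>\<in>{\<lambda>_. 0}. b \<alpha>)"
    unfolding power_series_def by (intro infsum_cong_neutral) auto
  then show ?thesis by simp
qed

end


section \<open>Arrays of finite value are jets\<close>

definition wirtinger_coord :: "'n + 'n \<Rightarrow> complex^'n \<Rightarrow> complex" where
  "wirtinger_coord j w = (case j of Inl i \<Rightarrow> w $ i | Inr i \<Rightarrow> cnj (w $ i))"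

interpretation jet: coordinate_functionals wirtinger_coord p for p :: "complex^'n"
proof (rule coordinate_functionals.intro)
  show "bounded_linear (wirtinger_coord j)" for j :: "'n + 'n"
    unfolding wirtinger_coord_def
    by (cases j) (auto intro: bounded_linear_vec_nth bounded_linear_compose[OF bounded_linear_cnj])
  show "cmod (wirtinger_coord j w) \<le> norm w" for j :: "'n + 'n" and w
    by (cases j) (auto simp: wirtinger_coord_def Finite_Cartesian_Product.norm_nth_le)
qed

lemma dir_deriv_jet_series:
  "moderate b \<Longrightarrow> dir_deriv v (jet.power_series p b) x
    = (\<Sum>j\<in>UNIV. wirtinger_coord j v * jet.power_series p (shift j b) x)"
  by (rule dir_deriv_eqI[OF jet.power_series_has_derivative])

lemma d_z_jet_series:
  fixes b :: "('n::finite + 'n \<Rightarrow> nat) \<Rightarrow> complex"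
  assumes "moderate b"
  shows "d_z i (jet.power_series p b) = jet.power_series p (shift (Inl i) b)"
    and "d_zbar i (jet.power_series p b) = jet.power_series p (shift (Inr i) b)"
proof -
  let ?P = "\<lambda>j. jet.power_series p (shift j b)"
  \<comment> \<open>The Wirtinger operators are dual to the coordinates z_i and their conjugates, so
    only one summand of the derivative survives.\<close>
  have z: "(wirtinger_coord j (axis i 1) - \<i> * wirtinger_coord j (axis i \<i>)) / 2 = (if j = Inl i then 1 else 0)"
    and zbar: "(wirtinger_coord j (axis i 1) + \<i> * wirtinger_coord j (axis i \<i>)) / 2 = (if j = Inr i then 1 else 0)"
    for j :: "'n + 'n"
    by (cases j; auto simp: wirtinger_coord_def axis_def)+
  show "d_z i (jet.power_series p b) = ?P (Inl i)"
  proof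
    fix x
    have "d_z i (jet.power_series p b) x
      = (\<Sum>j\<in>UNIV. (wirtinger_coord j (axis i 1) - \<i> * wirtinger_coord j (axis i \<i>)) / 2 * ?P j x)"
      by (simp add: d_z_def dir_deriv_jet_series[OF assms] sum_distrib_left sum_divide_distrib
          algebra_simps diff_divide_distrib flip: sum_subtractf)
    also have "\<dots> = (\<Sum>j\<in>UNIV. if j = Inl i then ?P j x else 0)"
      unfolding z by (intro sum.cong) auto
    finally show "d_z i (jet.power_series p b) x = ?P (Inl i) x" by simp
  qed
  show "d_zbar i (jet.power_series p b) = ?P (Inr i)"
  proof
    fix x
    have "d_zbar i (jet.power_series p b) x
      = (\<Sum>j\<in>UNIV. (wirtinger_coord j (axis i 1) + \<i> * wirtinger_coord j (axis i \<i>)) / 2 * ?P j x)"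
      by (simp add: d_zbar_def dir_deriv_jet_series[OF assms] sum_distrib_left sum_divide_distrib
          algebra_simps add_divide_distrib flip: sum.distrib)
    also have "\<dots> = (\<Sum>j\<in>UNIV. if j = Inr i then ?P j x else 0)"
      unfolding zbar by (intro sum.cong) auto
    finally show "d_zbar i (jet.power_series p b) x = ?P (Inr i) x" by simp
  qed
qed

definition shift_by :: "('j \<Rightarrow> nat) \<Rightarrow> (('j \<Rightarrow> nat) \<Rightarrow> 'c) \<Rightarrow> ('j \<Rightarrow> nat) \<Rightarrow> 'c" where
  "shift_by \<gamma> b = (\<lambda>\<alpha>. b (\<lambda>j. \<alpha> j + \<gamma> j))"

text \<open>Stated for general D and c to serve both \<open>d_z\<close> with \<open>Inl\<close> and
  \<open>d_zbar\<close> with \<open>Inr\<close>. The sum over i writes the exponents R transported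
  along c without inverting c. Moderateness is carried along because each further differentiation
  requires it.\<close>

lemma multi_deriv_jet_series:
  fixes D :: "'n::finite \<Rightarrow> (complex^'n \<Rightarrow> complex) \<Rightarrow> complex^'n \<Rightarrow> complex"
    and R :: "nat^'n"
  assumes D: "\<And>i b. moderate b \<Longrightarrow> D i (jet.power_series p b) = jet.power_series p (shift (c i) b)"
    and "moderate b"
  shows "moderate (shift_by (\<lambda>j. \<Sum>i\<in>UNIV. if j = c i then R $ i else 0) b)" (is ?mod)
    and "multi_deriv D R (jet.power_series p b)
      = jet.power_series p (shift_by (\<lambda>j. \<Sum>i\<in>UNIV. if j = c i then R $ i else 0) b)" (is ?eq)
proof -
  have pow: "moderate (shift_by (\<lambda>j. if j = c i then k else 0) b) \<and>
      (D i ^^ k) (jet.power_series p b) = jet.power_series p (shift_by (\<lambda>j. if j = c i then k else 0) b)"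
    if "moderate b" for i k b
  proof (induction k)
    case 0
    show ?case using that by (simp add: shift_by_def)
  next
    case (Suc k)
    have eq: "shift (c i) (shift_by (\<lambda>j. if j = c i then k else 0) b) = shift_by (\<lambda>j. if j = c i then Suc k else 0) b"
      by (auto simp: shift_def shift_by_def fun_eq_iff intro!: arg_cong[where f = b])
    have "(D i ^^ Suc k) (jet.power_series p b) = D i (jet.power_series p (shift_by (\<lambda>j. if j = c i then k else 0) b))"
      using conjunct2[OF Suc] by (simp only: funpow.simps comp_apply)
    also have "\<dots> = jet.power_series p (shift_by (\<lambda>j. if j = c i then Suc k else 0) b)"
      unfolding eq[symmetric] by (rule D[OF conjunct1[OF Suc]])
    finally show ?case
      using moderate_shift[OF conjunct1[OF Suc], of "c i"] unfolding eq by blast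
  qed
  have "moderate (shift_by (\<lambda>j. \<Sum>i\<leftarrow>xs. if j = c i then R $ i else 0) b) \<and>
      fold (\<lambda>i. D i ^^ (R $ i)) xs (jet.power_series p b)
        = jet.power_series p (shift_by (\<lambda>j. \<Sum>i\<leftarrow>xs. if j = c i then R $ i else 0) b)" for xs
    using assms(2)
  proof (induction xs arbitrary: b)
    case Nil
    then show ?case by (simp add: shift_by_def)
  next
    case (Cons x xs)
    let ?b = "shift_by (\<lambda>j. if j = c x then R $ x else 0) b"
    have "shift_by (\<lambda>j. \<Sum>i\<leftarrow>xs. if j = c i then R $ i else 0) ?b
      = shift_by (\<lambda>j. \<Sum>i\<leftarrow>x # xs. if j = c i then R $ i else 0) b"
      by (auto simp: shift_by_def fun_eq_iff add_ac intro!: arg_cong[where f = b])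
    then show ?case
      using Cons.IH[of ?b] pow[OF Cons.prems, of x "R $ x"] by simp
  qed
  from this[of coords] show ?mod ?eq
    by (simp_all add: multi_deriv_def sum_list_distinct_conv_sum_set[OF distinct_coords] set_coords)
qed

text \<open>Differentiation shifts the coefficients by (R, S), and evaluation at the centre reads
  off the one with index 0.\<close>

lemma wirtinger_jet_series:
  fixes p :: "complex^'n"
  assumes "moderate b"
  shows "wirtinger R S (jet.power_series p b) p = b (case_sum (vec_nth R) (vec_nth S))"
proof -
  let ?\<gamma> = "\<lambda>c (R::nat^'n) (j::'n + 'n). \<Sum>i\<in>UNIV. if j = c i then R $ i else (0::nat)"
  have 1: "multi_deriv d_zbar S (jet.power_series p b) = jet.power_series p (shift_by (?\<gamma> Inr S) b)"
    "moderate (shift_by (?\<gamma> Inr S) b)"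
    using multi_deriv_jet_series[where D = d_zbar and c = Inr and R = S, OF d_z_jet_series(2) assms] by auto
  have 2: "multi_deriv d_z R (jet.power_series p (shift_by (?\<gamma> Inr S) b))
     = jet.power_series p (shift_by (?\<gamma> Inl R) (shift_by (?\<gamma> Inr S) b))"
    using multi_deriv_jet_series(2)[where D = d_z and c = Inl and R = R, OF d_z_jet_series(1) 1(2)] .
  have "(\<lambda>j. ?\<gamma> Inl R j + ?\<gamma> Inr S j) = case_sum (vec_nth R) (vec_nth S)"
    by (auto simp: fun_eq_iff split: sum.split)
  then show ?thesis
    unfolding wirtinger_def 1 2 jet.power_series_at_centre by (simp add: shift_by_def)
qed

lemma sqrt_prod: "finite A \<Longrightarrow> sqrt (\<Prod>i\<in>A. f i) = (\<Prod>i\<in>A. sqrt (f i))"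
  by (induction A rule: finite_induct) (auto simp: real_sqrt_mult)

text \<open>Since l = 1 is odd, the inner values carry the summation index J in the holomorphic
  slot. Keeping the outer summand N, the inner term J = N with binomial coefficient 1, and the
  summand M of the base series gives w^2 / N! \<le> k for the weighted square w of the
  entry.\<close>

lemma jet_val_one_bound:
  assumes hbar: "0 < hbar" and fin: "jet_val hbar a 1 1 0 0 < \<infinity>"
  shows "cmod (a N M) \<le> sqrt (sqrt (enn2real (jet_val hbar a 1 1 0 0))) *
    (sqrt (1 / (2 * hbar)) ^ (mi_size N + mi_size M) * (sqrt (mi_fact N) * sqrt (mi_fact M)))"
proof -
  define k where "k = enn2real (jet_val hbar a 1 1 0 0)"
  have k0: "0 \<le> k" by (simp add: k_def)
  have jk: "jet_val hbar a 1 1 0 0 = ennreal k" using fin by (simp add: k_def less_top)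
  define w where "w = (2 * hbar) ^ (mi_size N + mi_size M) / real (mi_fact M) * (cmod (a N M))\<^sup>2"
  have fpos: "0 < mi_fact K" for K :: "nat^'a" by (simp add: mi_fact_def prod_pos)
  have w0: "0 \<le> w" using hbar by (simp add: w_def)
  let ?s = "\<lambda>N. \<Sum>I\<in>{I. I \<le> (0::nat^'a)}. \<Sum>J\<in>{J. J \<le> N + 0}.
          of_nat (mi_binom 0 I) * of_nat (mi_binom (N + 0) J) * jet_val hbar a 0 0 J I"
  have j1: "jet_val hbar a 1 1 0 0 = (\<Sum>\<^sub>\<infinity>N\<in>UNIV. ennreal (1 / real (mi_fact N)) * (?s N)\<^sup>2)"
    unfolding One_nat_def jet_val.simps by simp
  have zero: "{I. I \<le> (0::nat^'a)} = {0}" by (auto simp: less_eq_vec_def vec_eq_iff)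
  have "ennreal w \<le> jet_val hbar a 0 0 N 0"
    unfolding w_def by (rule coeff_le_jet_val[OF hbar])
  also have "jet_val hbar a 0 0 N 0 = of_nat (mi_binom (N + 0) N) * jet_val hbar a 0 0 N 0"
    by (simp add: mi_binom_def)
  also have "\<dots> \<le> (\<Sum>J\<in>{J. J \<le> N + 0}. of_nat (mi_binom (N + 0) J) * jet_val hbar a 0 0 J 0)"
    by (rule member_le_sum[of N]) (auto intro: finite_multiindices_le)
  also have "\<dots> = ?s N" unfolding zero by (simp add: mi_binom_def)
  finally have "ennreal (1 / real (mi_fact N)) * (ennreal w)\<^sup>2 \<le> ennreal (1 / real (mi_fact N)) * (?s N)\<^sup>2"
    by (intro mult_left_mono power_mono) auto
  also have "\<dots> \<le> jet_val hbar a 1 1 0 0"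
    unfolding j1 by (rule le_infsum_ennreal) simp
  finally have "ennreal (1 / real (mi_fact N) * w\<^sup>2) \<le> ennreal k"
    unfolding jk ennreal_power[OF w0] by (subst ennreal_mult) auto
  then have "1 / real (mi_fact N) * w\<^sup>2 \<le> k" using k0 by (simp add: ennreal_le_iff)
  then have "w\<^sup>2 \<le> k * real (mi_fact N)" using fpos[of N] by (simp add: field_simps)
  \<comment> \<open>Replacing N! by its square weakens the estimate, but leads to the symmetric
    bound sqrt (N!) * sqrt (M!) required by \<open>moderate\<close>.\<close>
  also have "\<dots> \<le> k * (real (mi_fact N))\<^sup>2"
    using k0 fpos[of N] by (intro mult_left_mono) (auto simp: power2_eq_square)
  finally have "w\<^sup>2 \<le> (sqrt k * real (mi_fact N))\<^sup>2" using k0 by (simp add: power_mult_distrib)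
  then have w: "w \<le> sqrt k * real (mi_fact N)" by (rule power2_le_imp_le) (use k0 in auto)
  let ?h = "(2 * hbar) ^ (mi_size N + mi_size M)"
  have h: "0 < ?h" using hbar by simp
  have "(cmod (a N M))\<^sup>2 = w * real (mi_fact M) / ?h"
    using fpos[of M] hbar by (simp add: w_def)
  also have "\<dots> \<le> (sqrt k * real (mi_fact N)) * real (mi_fact M) / ?h"
    using w h by (intro divide_right_mono mult_right_mono) auto
  finally have "sqrt ((cmod (a N M))\<^sup>2) \<le> sqrt ((sqrt k * real (mi_fact N)) * real (mi_fact M) / ?h)"
    by (rule real_sqrt_le_mono)
  then show ?thesis
    by (simp add: real_sqrt_mult real_sqrt_divide real_sqrt_power power_mult_distrib power_divide k_def mult_ac)
qed

lemma jet_realization: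
  fixes p :: "complex^'n"
  assumes "0 < hbar" and "jet_val hbar a 1 1 0 0 < \<infinity>"
  shows "\<exists>f\<in>C_infinity. \<forall>R S. wirtinger R S f p = a R S"
proof -
  \<comment> \<open>The entries themselves serve as coefficients, since \<open>term_at\<close>
    already divides by the factorials. The exponents of z come from the \<open>Inl\<close> half of
    \<alpha>, those of its conjugate from the \<open>Inr\<close> half.\<close>
  define b where "b \<alpha> = a (\<chi> i. \<alpha> (Inl i)) (\<chi> i. \<alpha> (Inr i))" for \<alpha> :: "'n + 'n \<Rightarrow> nat"
  define C q where "C = sqrt (sqrt (enn2real (jet_val hbar a 1 1 0 0)))" and "q = sqrt (1 / (2 * hbar))"
  have "cmod (b \<alpha>) \<le> C * (\<Prod>j\<in>UNIV. q ^ \<alpha> j * sqrt (fact (\<alpha> j)))" for \<alpha>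
  proof -
    let ?N = "\<chi> i. \<alpha> (Inl i)" and ?M = "\<chi> i. \<alpha> (Inr i)"
    have half: "(\<Prod>i\<in>UNIV. q ^ \<beta> i * sqrt (fact (\<beta> i))) = q ^ mi_size (\<chi> i. \<beta> i) * sqrt (mi_fact (\<chi> i. \<beta> i))"
      for \<beta> :: "'n \<Rightarrow> nat"
      by (simp add: mi_size_def mi_fact_def prod.distrib power_sum sqrt_prod)
    have "(\<Prod>j\<in>UNIV. q ^ \<alpha> j * sqrt (fact (\<alpha> j)))
      = (\<Prod>i\<in>UNIV. q ^ \<alpha> (Inl i) * sqrt (fact (\<alpha> (Inl i)))) * (\<Prod>i\<in>UNIV. q ^ \<alpha> (Inr i) * sqrt (fact (\<alpha> (Inr i))))"
      by (simp flip: UNIV_Plus_UNIV add: prod.Plus comp_def)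
    also have "\<dots> = q ^ (mi_size ?N + mi_size ?M) * (sqrt (mi_fact ?N) * sqrt (mi_fact ?M))"
      unfolding half[of "\<lambda>i. \<alpha> (Inl i)"] half[of "\<lambda>i. \<alpha> (Inr i)"] by (simp add: power_add)
    finally show ?thesis
      using jet_val_one_bound[OF assms, of ?N ?M] by (simp add: b_def C_def q_def)
  qed
  then have b: "moderate b"
    unfolding moderate_def using assms(1) by (intro exI[of _ C] exI[of _ q]) (auto simp: C_def q_def)
  have "wirtinger R S (jet.power_series p b) p = a R S" for R S
    unfolding wirtinger_jet_series[OF b] by (simp add: b_def vec_nth_inverse)
  then show ?thesis using jet.power_series_C_infinity[OF b] by blast
qed


section \<open>The space of cosets\<close>

definition jet_of :: "complex^'n \<Rightarrow> (complex^'n \<Rightarrow> complex) \<Rightarrow> nat^'n \<Rightarrow> nat^'n \<Rightarrow> complex" where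
  "jet_of p f = (\<lambda>R S. wirtinger R S f p)"

lemma jet_of_add:
  assumes "f \<in> C_infinity" "g \<in> C_infinity"
  shows "jet_of p (\<lambda>x. f x + g x) = (\<lambda>R S. jet_of p f R S + jet_of p g R S)"
  using assms by (simp add: jet_of_def smooth_operator_add smooth_operator_wirtinger)

lemma jet_of_cmult:
  assumes "f \<in> C_infinity"
  shows "jet_of p (\<lambda>x. c * f x) = (\<lambda>R S. c * jet_of p f R S)"
  using assms by (simp add: jet_of_def smooth_operator_cmult smooth_operator_wirtinger)

lemma jet_of_diff:
  assumes "f \<in> C_infinity" "g \<in> C_infinity"
  shows "jet_of p (\<lambda>x. f x - g x) = (\<lambda>R S. jet_of p f R S - jet_of p g R S)"
  using jet_of_add[OF assms(1) C_infinity_cmult[OF assms(2)], of p "-1"]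
  unfolding jet_of_cmult[OF assms(2)] by simp

lemma flat_functions_iff_jet: "f \<in> flat_functions p \<longleftrightarrow> f \<in> C_infinity \<and> jet_of p f = (\<lambda>R S. 0)"
  by (auto simp: flat_functions_iff jet_of_def fun_eq_iff)

section \<open>The space and its seminorms in terms of jets\<close>

lemma h_norm_eq:
  "h_norm p hbar m l R S f =
    (if jet_val hbar (jet_of p f) m l R S = \<infinity> then \<infinity> else ennreal (jet_norm hbar (jet_of p f) m l R S))"
  by (simp add: h_norm_def ennroot_def h_val_eq_jet_val jet_norm_def jet_of_def)

lemma A_tilde_iff:
  "f \<in> A_tilde p hbar \<longleftrightarrow> f \<in> C_infinity \<and> (\<forall>m l R S. l < 2 ^ m \<longrightarrow> jet_val hbar (jet_of p f) m l R S < \<infinity>)"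
  by (auto simp: A_tilde_def h_norm_eq less_top)

lemma jet_val_finite:
  "f \<in> A_tilde p hbar \<Longrightarrow> l < 2 ^ m \<Longrightarrow> jet_val hbar (jet_of p f) m l R S < \<infinity>"
  by (simp add: A_tilde_iff)

lemma A_tilde_smooth: "f \<in> A_tilde p hbar \<Longrightarrow> f \<in> C_infinity"
  by (simp add: A_tilde_iff)

lemma jet_val_diff_finite:
  assumes "0 < hbar" "jet_val hbar a m l R S < \<infinity>" "jet_val hbar b m l R S < \<infinity>"
  shows "jet_val hbar (\<lambda>R S. a R S - b R S) m l R S < \<infinity>"
  using jet_val_add_finite[OF assms(1,2) jet_val_cmult_finite[OF assms(3), of "-1"]] by simp

lemma A_tilde_add: "0 < hbar \<Longrightarrow> f \<in> A_tilde p hbar \<Longrightarrow> g \<in> A_tilde p hbar \<Longrightarrow> (\<lambda>x. f x + g x) \<in> A_tilde p hbar"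
  by (auto simp: A_tilde_iff jet_of_add C_infinity_add intro!: jet_val_add_finite[simplified])

lemma A_tilde_cmult: "f \<in> A_tilde p hbar \<Longrightarrow> (\<lambda>x. c * f x) \<in> A_tilde p hbar"
  by (auto simp: A_tilde_iff jet_of_cmult C_infinity_cmult intro!: jet_val_cmult_finite[simplified])

lemma A_tilde_diff:
  assumes "0 < hbar" "f \<in> A_tilde p hbar" "g \<in> A_tilde p hbar"
  shows "(\<lambda>x. f x - g x) \<in> A_tilde p hbar"
  using A_tilde_add[OF assms(1,2) A_tilde_cmult[OF assms(3), of "-1"]] by simp

lemma jet_val_zero: "jet_val hbar (\<lambda>R S. 0) m l R S = 0"
  using jet_val_cmult[of hbar 0 "\<lambda>R S. 0" m l R S] by (simp add: power_0_left)

lemma zero_in_flat_functions: "(\<lambda>x. 0) \<in> flat_functions p"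
  using C_infinity_zero jet_of_cmult[OF C_infinity_zero, of p 0] by (simp add: flat_functions_iff_jet)

lemma zero_in_A_tilde: "(\<lambda>x. 0) \<in> A_tilde p hbar"
  using zero_in_flat_functions[of p] by (simp add: A_tilde_iff flat_functions_iff_jet jet_val_zero)

section \<open>Cosets of flat functions\<close>

abbreviation flat_coset :: "complex^'n \<Rightarrow> (complex^'n \<Rightarrow> complex) \<Rightarrow> (complex^'n \<Rightarrow> complex) set" where
  "flat_coset p f \<equiv> f +o flat_functions p"

lemma flat_functions_add: "flat_functions p + flat_functions p = flat_functions p"
proof
  show "flat_functions p + flat_functions p \<subseteq> flat_functions p"
    using flat_functions_combination[of _ p _ 1 1] by (auto simp: set_plus_def plus_fun_def)
  show "flat_functions p \<subseteq> flat_functions p + flat_functions p"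
    using set_zero_plus2[of "flat_functions p" "flat_functions p"] zero_in_flat_functions[of p]
    by (simp add: zero_fun_def)
qed

lemma flat_coset_flat:
  assumes f: "f \<in> flat_functions p"
  shows "flat_coset p f = flat_coset p (\<lambda>x. 0)"
proof -
  show ?thesis
  proof (intro equalityI subsetI)
    fix g assume "g \<in> flat_coset p f"
    then obtain w where w: "w \<in> flat_functions p" "g = (\<lambda>x. f x + w x)"
      by (auto simp: elt_set_plus_def plus_fun_def)
    then have "g \<in> flat_functions p"
      using flat_functions_combination[OF f w(1), of 1 1] by simp
    then show "g \<in> flat_coset p (\<lambda>x. 0)" by (simp add: elt_set_plus_def plus_fun_def)
  next
    fix g assume "g \<in> flat_coset p (\<lambda>x. 0)"
    then have "g \<in> flat_functions p" by (auto simp: elt_set_plus_def plus_fun_def)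
    then have "(\<lambda>x. g x - f x) \<in> flat_functions p"
      using flat_functions_combination[OF _ f, of g 1 "-1"] by simp
    then show "g \<in> flat_coset p f"
      by (auto simp: elt_set_plus_def plus_fun_def intro!: bexI[of _ "\<lambda>x. g x - f x"])
  qed
qed

lemma A_space_simps:
  "carrier (A_space p hbar) = flat_coset p ` A_tilde p hbar"
  "\<zero>\<^bsub>A_space p hbar\<^esub> = flat_coset p (\<lambda>x. 0)"
  "flat_coset p f \<oplus>\<^bsub>A_space p hbar\<^esub> flat_coset p g = flat_coset p (\<lambda>x. f x + g x)"
  "c \<odot>\<^bsub>A_space p hbar\<^esub> flat_coset p f = flat_coset p (\<lambda>x. c * f x)"
proof -
  show "carrier (A_space p hbar) = flat_coset p ` A_tilde p hbar" by (simp add: A_space_def)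
  show "\<zero>\<^bsub>A_space p hbar\<^esub> = flat_coset p (\<lambda>x. 0)"
    using set_zero_plus[of "flat_functions p"] by (simp add: A_space_def zero_fun_def)
  show "flat_coset p f \<oplus>\<^bsub>A_space p hbar\<^esub> flat_coset p g = flat_coset p (\<lambda>x. f x + g x)"
    using set_plus_rearrange[of f "flat_functions p" g "flat_functions p"]
    by (simp add: A_space_def flat_functions_add plus_fun_def)
  have "(\<lambda>f x. c * f x) ` flat_coset p f + flat_functions p = flat_coset p (\<lambda>x. c * f x)"
  proof (intro Set.set_eqI iffI)
    fix g assume "g \<in> (\<lambda>f x. c * f x) ` flat_coset p f + flat_functions p"
    then obtain u v where "u \<in> flat_functions p" "v \<in> flat_functions p" "g = (\<lambda>x. c * (f x + u x) + v x)"
      by (auto simp: set_plus_def elt_set_plus_def plus_fun_def)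
    then show "g \<in> flat_coset p (\<lambda>x. c * f x)"
      using flat_functions_combination[of u p v c 1]
      by (auto simp: elt_set_plus_def plus_fun_def algebra_simps intro!: bexI[of _ "\<lambda>x. c * u x + v x"])
  next
    fix g assume "g \<in> flat_coset p (\<lambda>x. c * f x)"
    then obtain v where v: "v \<in> flat_functions p" "g = (\<lambda>x. c * f x) + v"
      by (auto simp: elt_set_plus_def)
    \<comment> \<open>Scaling f itself and adding v afterwards avoids division by c, so c = 0 is
      included.\<close>
    have "f \<in> flat_coset p f"
      using zero_in_flat_functions[of p] by (auto simp: elt_set_plus_def plus_fun_def intro!: bexI[of _ "\<lambda>x. 0"])
    then show "g \<in> (\<lambda>f x. c * f x) ` flat_coset p f + flat_functions p"
      unfolding v(2) using v(1) by (intro set_plus_intro imageI)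
  qed
  then show "c \<odot>\<^bsub>A_space p hbar\<^esub> flat_coset p f = flat_coset p (\<lambda>x. c * f x)"
    by (simp add: A_space_def)
qed

lemma carrier_A_spaceE:
  assumes "A \<in> carrier (A_space p hbar)"
  obtains f where "f \<in> A_tilde p hbar" "A = flat_coset p f"
  using assms by (auto simp: A_space_simps)

lemma flat_coset_carrier: "f \<in> A_tilde p hbar \<Longrightarrow> flat_coset p f \<in> carrier (A_space p hbar)"
  by (simp add: A_space_simps)

lemma module_A_space:
  assumes hbar: "0 < hbar"
  shows "Module.module (ring_of_type_algebra :: complex ring) (A_space p hbar)"
proof (rule moduleI)
  show "cring (ring_of_type_algebra :: complex ring)" by (rule cring_from_type_algebra)
  let ?V = "A_space p hbar"
  show "abelian_group ?V"
  proof (rule abelian_groupI)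
    fix x y z assume "x \<in> carrier ?V" "y \<in> carrier ?V" "z \<in> carrier ?V"
    then show "(x \<oplus>\<^bsub>?V\<^esub> y) \<oplus>\<^bsub>?V\<^esub> z = x \<oplus>\<^bsub>?V\<^esub> (y \<oplus>\<^bsub>?V\<^esub> z)"
      by (auto elim!: carrier_A_spaceE simp: A_space_simps(3) add.assoc)
  next
    fix x y assume "x \<in> carrier ?V" "y \<in> carrier ?V"
    then show "x \<oplus>\<^bsub>?V\<^esub> y = y \<oplus>\<^bsub>?V\<^esub> x" "x \<oplus>\<^bsub>?V\<^esub> y \<in> carrier ?V"
      by (auto elim!: carrier_A_spaceE simp: A_space_simps(3) add.commute
          intro!: flat_coset_carrier A_tilde_add hbar)
  next
    fix x assume "x \<in> carrier ?V"
    then obtain f where f: "f \<in> A_tilde p hbar" "x = flat_coset p f" by (rule carrier_A_spaceE)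
    then show "\<zero>\<^bsub>?V\<^esub> \<oplus>\<^bsub>?V\<^esub> x = x" by (simp add: A_space_simps(2,3))
    have "flat_coset p (\<lambda>x. -1 * f x) \<oplus>\<^bsub>?V\<^esub> x = \<zero>\<^bsub>?V\<^esub>"
      unfolding f(2) A_space_simps(2,3) by simp
    then show "\<exists>y\<in>carrier ?V. y \<oplus>\<^bsub>?V\<^esub> x = \<zero>\<^bsub>?V\<^esub>"
      using flat_coset_carrier[OF A_tilde_cmult[OF f(1), of "-1"]] by blast
  next
    show "\<zero>\<^bsub>?V\<^esub> \<in> carrier ?V"
      unfolding A_space_simps(2) by (rule flat_coset_carrier[OF zero_in_A_tilde])
  qed
qed (auto elim!: carrier_A_spaceE simp: A_space_simps(3,4) ring_of_type_algebra_def algebra_simps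
      intro!: flat_coset_carrier A_tilde_cmult)

text \<open>All representatives have the same jet, so the infimum is over a constant function on a
  nonempty set.\<close>

lemma A_seminorm_flat_coset:
  assumes f: "f \<in> A_tilde p hbar" and l: "l < 2 ^ m"
  shows "A_seminorm p hbar m l R S (flat_coset p f) = jet_norm hbar (jet_of p f) m l R S"
proof -
  have "h_norm p hbar m l R S g = ennreal (jet_norm hbar (jet_of p f) m l R S)"
    if g: "g \<in> flat_coset p f" for g
  proof -
    obtain w where w: "w \<in> flat_functions p" "g = (\<lambda>x. f x + w x)"
      using g by (auto simp: elt_set_plus_def plus_fun_def)
    have "jet_of p g = jet_of p f"
      unfolding w(2) using w(1) A_tilde_smooth[OF f] by (simp add: jet_of_add flat_functions_iff_jet)
    then show ?thesis using jet_val_finite[OF f l, of R S] by (simp add: h_norm_eq less_top)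
  qed
  moreover have "flat_coset p f \<noteq> {}"
    using zero_in_flat_functions[of p] by (auto simp: elt_set_plus_def)
  ultimately have "(INF g\<in>flat_coset p f. h_norm p hbar m l R S g) = ennreal (jet_norm hbar (jet_of p f) m l R S)"
    by simp
  then show ?thesis by (simp add: A_seminorm_def jet_norm_nonneg)
qed

lemma coeff_tendsto:
  assumes "0 < hbar" and J: "\<And>i j. jet_val hbar (\<lambda>R S. a i R S - a j R S) 0 0 R S < \<infinity>"
    and cauchy: "\<And>e. 0 < e \<Longrightarrow> \<exists>K. \<forall>i\<ge>K. \<forall>j\<ge>K. jet_norm hbar (\<lambda>R S. a i R S - a j R S) 0 0 R S < e"
  shows "convergent (\<lambda>i. a i R S)"
proof -
  define c where "c = sqrt ((2 * hbar) ^ (mi_size R + mi_size S))"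
  have c: "0 < c" using assms(1) by (simp add: c_def)
  have "Cauchy (\<lambda>i. a i R S)"
  proof (rule CauchyI)
    fix e :: real assume "0 < e"
    then obtain K where K: "\<And>i j. i \<ge> K \<Longrightarrow> j \<ge> K \<Longrightarrow> jet_norm hbar (\<lambda>R S. a i R S - a j R S) 0 0 R S < c * e"
      using cauchy[of "c * e"] c by auto
    have "cmod (a i R S - a j R S) < e" if "i \<ge> K" "j \<ge> K" for i j
    proof -
      have "c * cmod (a i R S - a j R S) < c * e"
        using coeff_le_jet_norm[OF assms(1) J, of i j] K[OF that] by (simp add: c_def)
      then show ?thesis using c by simp
    qed
    then show "\<exists>K. \<forall>i\<ge>K. \<forall>j\<ge>K. norm (a i R S - a j R S) < e" by blast
  qed
  then show ?thesis by (rule Cauchy_convergent)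
qed

theorem theorem3p10:
  fixes p :: "complex^'n" and hbar :: real
  assumes "0 < hbar"
  shows "frechet_space (A_space p hbar) (A_topology p hbar)"
proof -
  let ?V = "A_space p hbar"
  let ?Q = "{A_seminorm p hbar m l R S |m l R S. l < 2 ^ m}"
  interpret V: Module.module "ring_of_type_algebra :: complex ring" ?V
    by (rule module_A_space[OF assms])
  interpret seminormed_module ?V ?Q
  proof unfold_locales
    have "(0::nat) < 2 ^ 0" by simp
    then show "?Q \<noteq> {}" by blast
    have "?Q \<subseteq> range (\<lambda>(m, l, R, S). A_seminorm p hbar m l R S)"
    proof
      fix q assume "q \<in> ?Q"
      then obtain m l R S where "q = A_seminorm p hbar m l R S" by blast
      then show "q \<in> range (\<lambda>(m, l, R, S). A_seminorm p hbar m l R S)"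
        by (intro range_eqI[of _ _ "(m, l, R, S)"]) simp
    qed
    then show "countable ?Q" by (rule countable_subset) simp
  next
    fix q x y assume "q \<in> ?Q" "x \<in> carrier ?V" "y \<in> carrier ?V"
    then show "q (x \<oplus>\<^bsub>?V\<^esub> y) \<le> q x + q y"
      using assms
      by (auto elim!: carrier_A_spaceE simp: A_space_simps(3) A_seminorm_flat_coset A_tilde_add
          jet_of_add A_tilde_smooth intro!: jet_norm_triangle jet_val_finite)
  next
    fix q x c assume "q \<in> ?Q" "x \<in> carrier ?V"
    then show "q (c \<odot>\<^bsub>?V\<^esub> x) = cmod c * q x"
      by (auto elim!: carrier_A_spaceE simp: A_space_simps(4) A_seminorm_flat_coset A_tilde_cmult
          jet_of_cmult A_tilde_smooth jet_norm_cmult)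
  next
    fix x assume x: "x \<in> carrier ?V" and 0: "\<And>q. q \<in> ?Q \<Longrightarrow> q x = 0"
    obtain f where f: "f \<in> A_tilde p hbar" "x = flat_coset p f" using x by (rule carrier_A_spaceE)
    have "jet_of p f R S = 0" for R S
    proof -
      have "A_seminorm p hbar 0 0 R S x = 0" by (rule 0) force
      then have "jet_norm hbar (jet_of p f) 0 0 R S = 0" using f by (simp add: A_seminorm_flat_coset)
      then have "sqrt ((2 * hbar) ^ (mi_size R + mi_size S)) * cmod (jet_of p f R S) \<le> 0"
        using coeff_le_jet_norm[OF assms jet_val_finite[OF f(1), of 0 0 R S]] by simp
      moreover have "0 < sqrt ((2 * hbar) ^ (mi_size R + mi_size S))" using assms by simp
      ultimately have "cmod (jet_of p f R S) \<le> 0" by (simp only: mult_le_0_iff not_le[symmetric]) auto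
      then show ?thesis by simp
    qed
    then have "f \<in> flat_functions p"
      using A_tilde_smooth[OF f(1)] by (simp add: flat_functions_iff_jet fun_eq_iff)
    then show "x = \<zero>\<^bsub>?V\<^esub>"
      unfolding f(2) A_space_simps(2) by (rule flat_coset_flat)
  qed
  have diff: "flat_coset p f \<ominus>\<^bsub>?V\<^esub> flat_coset p g = flat_coset p (\<lambda>x. f x - g x)"
    if "g \<in> A_tilde p hbar" for f g
    using uminus_eq_smult[OF flat_coset_carrier[OF that]]
    by (simp add: a_minus_def A_space_simps(3,4))
  have seminorm_diff: "A_seminorm p hbar m l R S (flat_coset p f \<ominus>\<^bsub>?V\<^esub> flat_coset p g)
      = jet_norm hbar (\<lambda>R S. jet_of p f R S - jet_of p g R S) m l R S"
    if fg: "f \<in> A_tilde p hbar" "g \<in> A_tilde p hbar" and "l < 2 ^ m" for f g m l R S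
    unfolding diff[OF fg(2)] A_seminorm_flat_coset[OF A_tilde_diff[OF assms fg] \<open>l < 2 ^ m\<close>]
      jet_of_diff[OF A_tilde_smooth[OF fg(1)] A_tilde_smooth[OF fg(2)]] ..
  show ?thesis
    unfolding A_topology_def
  proof (rule frechet_space_T)
    fix u :: "nat \<Rightarrow> (complex^'n \<Rightarrow> complex) set"
    assume u: "\<And>k. u k \<in> carrier ?V"
      and cauchy: "\<And>q e. \<lbrakk>q \<in> ?Q; 0 < e\<rbrakk> \<Longrightarrow> \<exists>K. \<forall>i\<ge>K. \<forall>j\<ge>K. q (u i \<ominus>\<^bsub>?V\<^esub> u j) < e"
    have "\<exists>f. f \<in> A_tilde p hbar \<and> u k = flat_coset p f" for k using u[of k] by (auto elim: carrier_A_spaceE)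
    then obtain f where f: "\<And>k. f k \<in> A_tilde p hbar" "\<And>k. u k = flat_coset p (f k)" by metis
    define a where "a k = jet_of p (f k)" for k
    have afin: "jet_val hbar (\<lambda>R S. a i R S - a j R S) m l R S < \<infinity>" if "l < 2 ^ m" for i j m l R S
      unfolding a_def using that by (intro jet_val_diff_finite assms jet_val_finite f)
    have acauchy: "\<exists>K. \<forall>i\<ge>K. \<forall>j\<ge>K. jet_norm hbar (\<lambda>R S. a i R S - a j R S) m l R S < e"
      if l: "l < 2 ^ m" and e: "0 < e" for m l R S e
    proof -
      have "A_seminorm p hbar m l R S (u i \<ominus>\<^bsub>?V\<^esub> u j) = jet_norm hbar (\<lambda>R S. a i R S - a j R S) m l R S" for i j
        unfolding f(2) a_def by (rule seminorm_diff[OF f(1) f(1) l])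
      moreover have "A_seminorm p hbar m l R S \<in> ?Q" using l by blast
      ultimately show ?thesis using cauchy[of "A_seminorm p hbar m l R S" e] e by simp
    qed
    have "convergent (\<lambda>i. a i R S)" for R S
      by (rule coeff_tendsto[OF assms]) (use afin acauchy in auto)
    then obtain b where b: "\<And>R S. (\<lambda>i. a i R S) \<longlonglongrightarrow> b R S"
      unfolding convergent_def by metis
    \<comment> \<open>Fix i and let j tend to infinity in the Cauchy condition. The bound is stated
      for \<open>jet_val\<close> because finiteness of the values of b is not known yet.\<close>
    have lim: "\<exists>K. \<forall>i\<ge>K. jet_val hbar (\<lambda>R S. a i R S - b R S) m l R S \<le> ennreal (e ^ 2 ^ (m + 1))"
      if l: "l < 2 ^ m" and e: "0 < e" for m l R S e
    proof -
      obtain K where K: "\<And>i j. i \<ge> K \<Longrightarrow> j \<ge> K \<Longrightarrow> jet_norm hbar (\<lambda>R S. a i R S - a j R S) m l R S < e"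
        using acauchy[OF l e] by blast
      have "jet_val hbar (\<lambda>R S. a i R S - b R S) m l R S \<le> ennreal (e ^ 2 ^ (m + 1))" if i: "i \<ge> K" for i
      proof (rule jet_val_limit_bound[OF assms, where a = "\<lambda>j R S. a i R S - a j R S"])
        show "(\<lambda>j. a i R S - a j R S) \<longlonglongrightarrow> a i R S - b R S" for R S
          by (intro tendsto_intros b)
        have "jet_val hbar (\<lambda>R S. a i R S - a j R S) m l R S \<le> ennreal (e ^ 2 ^ (m + 1))" if "j \<ge> K" for j
          using K[OF i that] e by (subst jet_norm_le_iff[OF afin[OF l], symmetric]) auto
        then show "\<forall>\<^sub>F j in sequentially. jet_val hbar (\<lambda>R S. a i R S - a j R S) m l R S \<le> ennreal (e ^ 2 ^ (m + 1))"
          unfolding eventually_sequentially by blast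
      qed
      then show ?thesis by blast
    qed
    \<comment> \<open>Write b as a K - (a K - b), where the difference has finite value by
      \<open>lim\<close> with e = 1.\<close>
    have bfin: "jet_val hbar b m l R S < \<infinity>" if l: "l < 2 ^ m" for m l R S
    proof -
      obtain K where "jet_val hbar (\<lambda>R S. a K R S - b R S) m l R S \<le> ennreal (1 ^ 2 ^ (m + 1))"
        using lim[OF l zero_less_one, of R S] by blast
      then have "jet_val hbar (\<lambda>R S. a K R S - b R S) m l R S < \<infinity>"
        by (rule le_less_trans) simp
      from jet_val_diff_finite[OF assms jet_val_finite[OF f(1)[of K] l] this[unfolded a_def]]
      show ?thesis by simp
    qed
    obtain g where g: "g \<in> C_infinity" "\<And>R S. wirtinger R S g p = b R S"
      using jet_realization[OF assms bfin[of 1 1 0 0], where p = p] by auto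
    have gb: "jet_of p g = b" using g(2) by (simp add: jet_of_def)
    have gA: "g \<in> A_tilde p hbar" using g(1) bfin by (simp add: A_tilde_iff gb)
    show "\<exists>x\<in>carrier ?V. \<forall>q\<in>?Q. (\<lambda>k. q (u k \<ominus>\<^bsub>?V\<^esub> x)) \<longlonglongrightarrow> 0"
    proof (intro bexI[of _ "flat_coset p g"] ballI flat_coset_carrier gA)
      fix q assume "q \<in> ?Q"
      then obtain m l R S where q: "q = A_seminorm p hbar m l R S" and l: "l < 2 ^ m" by blast
      have eq: "q (u k \<ominus>\<^bsub>?V\<^esub> flat_coset p g) = jet_norm hbar (\<lambda>R S. a k R S - b R S) m l R S" for k
        unfolding q f(2) a_def gb[symmetric] by (rule seminorm_diff[OF f(1) gA l])
      show "(\<lambda>k. q (u k \<ominus>\<^bsub>?V\<^esub> flat_coset p g)) \<longlonglongrightarrow> 0"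
        unfolding eq
      proof (rule LIMSEQ_I)
        fix r :: real assume r: "0 < r"
        \<comment> \<open>The limit bounds are not strict; r / 2 makes the final inequality
          strict.\<close>
        obtain K where K: "\<And>i. i \<ge> K \<Longrightarrow> jet_val hbar (\<lambda>R S. a i R S - b R S) m l R S \<le> ennreal ((r / 2) ^ 2 ^ (m + 1))"
          using lim[OF l half_gt_zero[OF r], of R S] by blast
        have "jet_norm hbar (\<lambda>R S. a i R S - b R S) m l R S \<le> r / 2" if "i \<ge> K" for i
          using K[OF that] r bfin[OF l] jet_val_finite[OF f(1) l]
          by (subst jet_norm_le_iff) (auto simp: a_def intro!: jet_val_diff_finite[simplified] assms)
        then have "norm (jet_norm hbar (\<lambda>R S. a i R S - b R S) m l R S - 0) < r" if "i \<ge> K" for i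
          using that r jet_norm_nonneg[of hbar "\<lambda>R S. a i R S - b R S" m l R S] by fastforce
        then show "\<exists>K. \<forall>i\<ge>K. norm (jet_norm hbar (\<lambda>R S. a i R S - b R S) m l R S - 0) < r"
          by blast
      qed
    qed
  qed
qed

end
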